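(* Let $n \geq 2$ be an integer. For virtual knot diagrams, a crossing virtualization can be realized by a finite sequence of $H(n)$-moves and generalized Reidemeister moves. That is, if $V'$ is obtained from a virtual knot diagram $V$ by replacing one classical crossing by a virtual crossing, then $V$ can be transformed into $V'$ by a finite sequence of $H(n)$-moves and generalized Reidemeister moves.
   Context: Virtual link diagrams. A virtual link diagram is a generic immersion of finitely many circles in the plane (considered up to planar isotopy), each of whose finitely many transverse double points is marked either as a classical crossing (with over/under information) or as a virtual crossing (no over/under information). A virtual knot diagram is a virtual link diagram with one component. Crossing virtualization. The local move that changes one classical crossing into a virtual crossing, leaving the rest of the diagram unchanged. Generalized Reidemeister moves. These are the classical Reidemeister moves R1, R2, R3 (involving only classical crossings), the virtual Reidemeister moves VR1, VR2, VR3 (the same moves with all crossings virtual), and the mixed move VR4 (an arc having two consecutive virtual crossings with the two strands of a classical crossing is moved across that classical crossing). All moves may be used in both directions. $H(n)$-move ($n\ge 2$). Let $B$ be a disk in the plane meeting a diagram $D$ in exactly $n$ pairwise disjoint simple arcs with no crossings in $B$, whose $2n$ endpoints $p_1,\dots,p_{2n}$, in cyclic order on $\partial B$, are joined in pairs $p_{2i-1},p_{2i}$ ($1\le i\le n$). The $H(n)$-move replaces these arcs by $n$ pairwise disjoint simple arcs in $B$ joining $p_{2i}$ to $p_{2i+1}$ ($1\le i\le n$, indices mod $2n$), leaving $D$ unchanged outside $B$. An $H(n)$-move is required to preserve the number of components of the diagram. The move is performed on the underlying unoriented diagram; it need not preserve orientations outside $B$. *)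

theory Defs
  imports "HOL-Analysis.Analysis"
begin

section \<open>Virtual link diagrams\<close>

text \<open>
  A diagram is an immersion of the disjoint union of \<open>ncomp\<close> standard circles into the plane
  (identified with the complex numbers), together with the set of those points of the domain
  at which the curve runs as the over-strand of a classical crossing.  Thus a double point
  with preimages x, y is classical if one of x, y lies in \<open>over\<close>, and virtual if
  neither does.  Only the values of \<open>imm\<close> on \<open>circles\<close> matter.

  The topological category is used: an immersion of a closed 1-manifold is a continuous locally
  injective map (hence, by compactness, locally an embedding), and two branches are transverse if
  a chart of the plane takes them to the two coordinate axes.
\<close>

record vdiagram =
  ncomp :: nat
  imm :: "nat \<times> complex \<Rightarrow> complex"
  over :: "(nat \<times> complex) set"

definition circles :: "vdiagram \<Rightarrow> (nat \<times> complex) set" where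
  "circles D = {..<ncomp D} \<times> sphere 0 1"

definition double_pair :: "vdiagram \<Rightarrow> nat \<times> complex \<Rightarrow> nat \<times> complex \<Rightarrow> bool" where
  "double_pair D x y \<longleftrightarrow> x \<in> circles D \<and> y \<in> circles D \<and> x \<noteq> y \<and> imm D x = imm D y"

definition immersed :: "vdiagram \<Rightarrow> bool" where
  "immersed D \<longleftrightarrow> continuous_on (circles D) (imm D) \<and>
     (\<forall>x\<in>circles D. \<exists>N. openin (top_of_set (circles D)) N \<and> x \<in> N \<and> inj_on (imm D) N)"

definition transverse_at :: "vdiagram \<Rightarrow> nat \<times> complex \<Rightarrow> nat \<times> complex \<Rightarrow> bool" where
  "transverse_at D x y \<longleftrightarrow>
     (\<exists>U h k M N f g.
        open U \<and> homeomorphism U (ball (0::complex) 1) h k \<and>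
        openin (top_of_set (circles D)) M \<and> x \<in> M \<and>
        openin (top_of_set (circles D)) N \<and> y \<in> N \<and>
        M \<inter> N = {} \<and> {z \<in> circles D. imm D z \<in> U} = M \<union> N \<and>
        homeomorphism M {w \<in> ball 0 1. Im w = 0} (h \<circ> imm D) f \<and>
        homeomorphism N {w \<in> ball 0 1. Re w = 0} (h \<circ> imm D) g)"

definition generic :: "vdiagram \<Rightarrow> bool" where
  "generic D \<longleftrightarrow>
     finite {x. \<exists>y. double_pair D x y} \<and>
     (\<forall>x y z. double_pair D x y \<and> double_pair D x z \<longrightarrow> y = z) \<and>
     (\<forall>x y. double_pair D x y \<longrightarrow> transverse_at D x y)"

definition virtual_link_diagram :: "vdiagram \<Rightarrow> bool" where
  "virtual_link_diagram D \<longleftrightarrow>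
     immersed D \<and> generic D \<and>
     over D \<subseteq> {x. \<exists>y. double_pair D x y} \<and>
     (\<forall>x y. double_pair D x y \<longrightarrow> \<not> (x \<in> over D \<and> y \<in> over D))"

definition virtual_knot_diagram :: "vdiagram \<Rightarrow> bool" where
  "virtual_knot_diagram D \<longleftrightarrow> virtual_link_diagram D \<and> ncomp D = 1"

text \<open>
  Planar isotopy: an ambient isotopy H of the plane carries D to D'.  The homeomorphism
  \<open>\<phi>\<close> of the domains makes the notion independent of the parametrization (and orientation)
  of the curves and of the numbering of the components.
\<close>

definition planar_isotopic :: "vdiagram \<Rightarrow> vdiagram \<Rightarrow> bool" where
  "planar_isotopic D D' \<longleftrightarrow>
     virtual_link_diagram D \<and> virtual_link_diagram D' \<and>
     (\<exists>(H :: real \<times> complex \<Rightarrow> complex) \<phi> \<psi>.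
        continuous_on ({0..1} \<times> UNIV) H \<and>
        (\<forall>t\<in>{0..1}. \<exists>k. homeomorphism UNIV UNIV (\<lambda>z. H (t, z)) k) \<and>
        (\<forall>z. H (0, z) = z) \<and>
        homeomorphism (circles D) (circles D') \<phi> \<psi> \<and>
        (\<forall>x\<in>circles D. imm D' (\<phi> x) = H (1, imm D x)) \<and>
        over D' = \<phi> ` over D)"

definition crossing_virtualization :: "vdiagram \<Rightarrow> vdiagram \<Rightarrow> bool" where
  "crossing_virtualization D D' \<longleftrightarrow>
     virtual_link_diagram D \<and>
     (\<exists>x\<in>over D. planar_isotopic (D\<lparr>over := over D - {x}\<rparr>) D')"

section \<open>Local changes inside a disk\<close>

definition agree_outside :: "complex set \<Rightarrow> vdiagram \<Rightarrow> vdiagram \<Rightarrow> bool" where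
  "agree_outside B D D' \<longleftrightarrow>
     (\<exists>\<phi> \<psi>. homeomorphism {x \<in> circles D. imm D x \<notin> interior B}
                         {x \<in> circles D'. imm D' x \<notin> interior B} \<phi> \<psi> \<and>
            (\<forall>x\<in>circles D. imm D x \<notin> interior B \<longrightarrow>
               imm D' (\<phi> x) = imm D x \<and> (\<phi> x \<in> over D' \<longleftrightarrow> x \<in> over D)))"

text \<open>
  \<open>c 0, \<dots>, c (m - 1)\<close> are disjoint arcs in the domain of D which together form the preimage
  of the disk B; their images are the m strands of D in B.  The strands meet the boundary
  of B exactly in their end points, but may cross each other and themselves.
\<close>

definition strands :: "complex set \<Rightarrow> nat \<Rightarrow> vdiagram \<Rightarrow> (nat \<Rightarrow> real \<Rightarrow> nat \<times> complex) \<Rightarrow> bool" where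
  "strands B m D c \<longleftrightarrow>
     (\<forall>i<m. arc (c i)) \<and>
     (\<forall>i<m. \<forall>j<m. i \<noteq> j \<longrightarrow> path_image (c i) \<inter> path_image (c j) = {}) \<and>
     (\<Union>i<m. path_image (c i)) = {x \<in> circles D. imm D x \<in> B} \<and>
     (\<forall>i<m. \<forall>t\<in>{0..1}. imm D (c i t) \<in> frontier B \<longleftrightarrow> t = 0 \<or> t = 1)"

definition local_change ::
  "complex set \<Rightarrow> nat \<Rightarrow> vdiagram \<Rightarrow> (nat \<Rightarrow> real \<Rightarrow> nat \<times> complex) \<Rightarrow>
     vdiagram \<Rightarrow> (nat \<Rightarrow> real \<Rightarrow> nat \<times> complex) \<Rightarrow> bool" where
  "local_change B m D c D' c' \<longleftrightarrow>
     virtual_link_diagram D \<and> virtual_link_diagram D' \<and>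
     B homeomorphic cball (0::complex) 1 \<and>
     strands B m D c \<and> strands B m D' c' \<and> agree_outside B D D'"

text \<open>In a Reidemeister move every strand keeps its two end points.\<close>

definition same_ends ::
  "nat \<Rightarrow> vdiagram \<Rightarrow> (nat \<Rightarrow> real \<Rightarrow> nat \<times> complex) \<Rightarrow>
     vdiagram \<Rightarrow> (nat \<Rightarrow> real \<Rightarrow> nat \<times> complex) \<Rightarrow> bool" where
  "same_ends m D c D' c' \<longleftrightarrow>
     (\<forall>i<m. imm D' (c' i 0) = imm D (c i 0) \<and> imm D' (c' i 1) = imm D (c i 1))"

text \<open>
  The pairs of parameters at which the strands p and q cross; for p = q these are the
  self-crossings of the strand, each of which occurs as (a, b) and as (b, a).
\<close>

definition crossing_times ::
  "vdiagram \<Rightarrow> (real \<Rightarrow> nat \<times> complex) \<Rightarrow> (real \<Rightarrow> nat \<times> complex) \<Rightarrow> (real \<times> real) set" where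
  "crossing_times D p q =
     {(s, t). s \<in> {0..1} \<and> t \<in> {0..1} \<and> p s \<noteq> q t \<and> imm D (p s) = imm D (q t)}"

definition no_crossings :: "nat \<Rightarrow> vdiagram \<Rightarrow> (nat \<Rightarrow> real \<Rightarrow> nat \<times> complex) \<Rightarrow> bool" where
  "no_crossings m D c \<longleftrightarrow> (\<forall>i<m. \<forall>j<m. crossing_times D (c i) (c j) = {})"

section \<open>Generalized Reidemeister moves\<close>

text \<open>Each of the first two kinds of moves is given in the direction which creates crossings.\<close>

definition curl :: "vdiagram \<Rightarrow> (nat \<Rightarrow> real \<Rightarrow> nat \<times> complex) \<Rightarrow> real \<Rightarrow> real \<Rightarrow> bool" where
  "curl D c a b \<longleftrightarrow> 0 < a \<and> a < b \<and> b < 1 \<and> crossing_times D (c 0) (c 0) = {(a, b), (b, a)}"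

definition R1 :: "vdiagram \<Rightarrow> vdiagram \<Rightarrow> bool" where
  "R1 D D' \<longleftrightarrow>
     (\<exists>B c c' a b. local_change B 1 D c D' c' \<and> same_ends 1 D c D' c' \<and>
        no_crossings 1 D c \<and> curl D' c' a b \<and>
        (c' 0 a \<in> over D' \<or> c' 0 b \<in> over D'))"

definition VR1 :: "vdiagram \<Rightarrow> vdiagram \<Rightarrow> bool" where
  "VR1 D D' \<longleftrightarrow>
     (\<exists>B c c' a b. local_change B 1 D c D' c' \<and> same_ends 1 D c D' c' \<and>
        no_crossings 1 D c \<and> curl D' c' a b \<and>
        c' 0 a \<notin> over D' \<and> c' 0 b \<notin> over D')"

definition bigon ::
  "vdiagram \<Rightarrow> (nat \<Rightarrow> real \<Rightarrow> nat \<times> complex) \<Rightarrow> real \<Rightarrow> real \<Rightarrow> real \<Rightarrow> real \<Rightarrow> bool" where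
  "bigon D c a a' b b' \<longleftrightarrow>
     {a, a', b, b'} \<subseteq> {0<..<1} \<and> a \<noteq> a' \<and> b \<noteq> b' \<and>
     crossing_times D (c 0) (c 0) = {} \<and> crossing_times D (c 1) (c 1) = {} \<and>
     crossing_times D (c 0) (c 1) = {(a, b), (a', b')}"

definition R2 :: "vdiagram \<Rightarrow> vdiagram \<Rightarrow> bool" where
  "R2 D D' \<longleftrightarrow>
     (\<exists>B c c' a a' b b'. local_change B 2 D c D' c' \<and> same_ends 2 D c D' c' \<and>
        no_crossings 2 D c \<and> bigon D' c' a a' b b' \<and>
        c' 0 a \<in> over D' \<and> c' 0 a' \<in> over D')"

definition VR2 :: "vdiagram \<Rightarrow> vdiagram \<Rightarrow> bool" where
  "VR2 D D' \<longleftrightarrow>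
     (\<exists>B c c' a a' b b'. local_change B 2 D c D' c' \<and> same_ends 2 D c D' c' \<and>
        no_crossings 2 D c \<and> bigon D' c' a a' b b' \<and>
        {c' 0 a, c' 0 a', c' 1 b, c' 1 b'} \<inter> over D' = {})"

text \<open>
  Three strands crossing pairwise once, the strand i meeting the strand j at its parameter
  \<open>T i j\<close>.  Pushing one strand across the crossing of the other two reverses, along each of the
  three strands, the order in which it meets the other two.
\<close>

definition triangle ::
  "vdiagram \<Rightarrow> (nat \<Rightarrow> real \<Rightarrow> nat \<times> complex) \<Rightarrow> (nat \<Rightarrow> nat \<Rightarrow> real) \<Rightarrow> bool" where
  "triangle D c T \<longleftrightarrow>
     (\<forall>i<3. crossing_times D (c i) (c i) = {}) \<and>
     (\<forall>i<3. \<forall>j<3. i \<noteq> j \<longrightarrow>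
        0 < T i j \<and> T i j < 1 \<and> crossing_times D (c i) (c j) = {(T i j, T j i)})"

definition triangle_move ::
  "vdiagram \<Rightarrow> (nat \<Rightarrow> real \<Rightarrow> nat \<times> complex) \<Rightarrow> (nat \<Rightarrow> nat \<Rightarrow> real) \<Rightarrow>
     vdiagram \<Rightarrow> (nat \<Rightarrow> real \<Rightarrow> nat \<times> complex) \<Rightarrow> (nat \<Rightarrow> nat \<Rightarrow> real) \<Rightarrow> bool" where
  "triangle_move D c T D' c' T' \<longleftrightarrow>
     (\<exists>B. local_change B 3 D c D' c') \<and> same_ends 3 D c D' c' \<and>
     triangle D c T \<and> triangle D' c' T' \<and>
     (\<forall>i<3. \<forall>j<3. \<forall>k<3. i \<noteq> j \<and> j \<noteq> k \<and> i \<noteq> k \<longrightarrow>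
        (T i j < T i k \<longleftrightarrow> T' i k < T' i j))"

definition R3 :: "vdiagram \<Rightarrow> vdiagram \<Rightarrow> bool" where
  "R3 D D' \<longleftrightarrow>
     (\<exists>c T c' T'. triangle_move D c T D' c' T' \<and>
        (\<forall>i<3. \<forall>j<3. i < j \<longrightarrow> c i (T i j) \<in> over D \<and> c' i (T' i j) \<in> over D'))"

definition VR3 :: "vdiagram \<Rightarrow> vdiagram \<Rightarrow> bool" where
  "VR3 D D' \<longleftrightarrow>
     (\<exists>c T c' T'. triangle_move D c T D' c' T' \<and>
        (\<forall>i<3. \<forall>j<3. i \<noteq> j \<longrightarrow> c i (T i j) \<notin> over D \<and> c' i (T' i j) \<notin> over D'))"

text \<open>The strand 0 is the moving one; the strands 1 and 2 cross classically, 1 above 2.\<close>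

definition VR4 :: "vdiagram \<Rightarrow> vdiagram \<Rightarrow> bool" where
  "VR4 D D' \<longleftrightarrow>
     (\<exists>c T c' T'. triangle_move D c T D' c' T' \<and>
        (\<forall>j\<in>{1, 2}. {c 0 (T 0 j), c j (T j 0)} \<inter> over D = {} \<and>
                     {c' 0 (T' 0 j), c' j (T' j 0)} \<inter> over D' = {}) \<and>
        c 1 (T 1 2) \<in> over D \<and> c' 1 (T' 1 2) \<in> over D')"

definition reidemeister_move :: "vdiagram \<Rightarrow> vdiagram \<Rightarrow> bool" where
  "reidemeister_move D D' \<longleftrightarrow>
     R1 D D' \<or> R2 D D' \<or> R3 D D' \<or> VR1 D D' \<or> VR2 D D' \<or> VR3 D D' \<or> VR4 D D'"

section \<open>H(n)-moves\<close>

text \<open>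
  The points p are numbered from 0 to 2n - 1.  The cyclic order on the boundary of B
  is the one transported from the unit circle by a homeomorphism of the closed unit disk onto B.
\<close>

definition H_move :: "nat \<Rightarrow> vdiagram \<Rightarrow> vdiagram \<Rightarrow> bool" where
  "H_move n D D' \<longleftrightarrow>
     (\<exists>B c c' e e' \<theta> p.
        local_change B n D c D' c' \<and>
        no_crossings n D c \<and> no_crossings n D' c' \<and>
        homeomorphism (cball (0::complex) 1) B e e' \<and>
        (\<forall>j<2*n. 0 \<le> \<theta> j \<and> \<theta> j < 2 * pi) \<and> (\<forall>j<2*n. \<forall>k<j. \<theta> k < \<theta> j) \<and>
        (\<forall>j<2*n. p j = e (cis (\<theta> j))) \<and>
        (\<forall>i<n. imm D (c i 0) = p (2*i) \<and> imm D (c i 1) = p (2*i + 1)) \<and>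
        (\<forall>i<n. imm D' (c' i 0) = p (2*i + 1) \<and> imm D' (c' i 1) = p ((2*i + 2) mod (2*n)))) \<and>
     ncomp D' = ncomp D"

text \<open>
  Diagrams are considered up to planar isotopy, so planar isotopies may be inserted anywhere in a
  sequence of moves.  Exchanging the roles of D and D' in an H(n)-move amounts to a
  cyclic renumbering of the points p, so that no converse has to be added for it.
\<close>

definition diagram_step :: "nat \<Rightarrow> vdiagram \<Rightarrow> vdiagram \<Rightarrow> bool" where
  "diagram_step n D D' \<longleftrightarrow>
     planar_isotopic D D' \<or> H_move n D D' \<or> reidemeister_move D D' \<or> reidemeister_move D' D"

end

theory Submission imports Defs
begin

text \<open>
  Why the theorem holds, first for H(2).  Let x be the crossing.  A disk close to x that meets the
  diagram V in one arc of each branch can be placed so that the H(2)-move in it turns the crossing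
  into the crossing of a small curl: going round the knot, it reverses the arc of the circle which
  joins the two strands, so the result is again one closed curve.  The curl is removed by R1 and
  put back by VR1 with a virtual crossing; undoing the H(2)-move then gives V with x virtual.  The
  diagram after the H(2)-move is \<open>flip\<close>, and \<open>flip_uncurl\<close> says that it is a curl away from a
  diagram \<open>smoothed\<close> which does not depend on whether x was classical or virtual.

  For larger n it is enough that H(n+1) realizes H(n) up to curls.  Near the last end point of an
  H(n)-move from D to D', insert in D a curl which enters the disk B once more, and insert in D'
  a curl with the same picture outside B, but with a part of it run through in the opposite
  direction.  Inside B the new diagrams then differ by an H(n+1)-move in the same disk B.  As both
  curls are removed by R1 or VR1, this gives the move from D to D'.  The new pair has an end point
  around which it looks exactly as the old one did (\<open>end_chart\<close>), so the step can be repeated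
  (\<open>add_curls_to_H_config\<close>, \<open>H_config_realizable\<close>).

  What remains is to see that the curves which are written down are diagrams.  A change of a
  diagram always takes place in the image of an explicit plane curve under a chart of the plane
  (\<open>strand_chart\<close>), and \<open>replacement_generic\<close> reduces being immersed and generic to the
  part of the curve that was changed.  By \<open>transverse_criterion\<close> a double point is transverse as
  soon as near it one branch runs injectively in a horizontal line of a chart and the other in a
  vertical line; the homeomorphisms which the definition asks for come from compactness and from
  invariance of domain.
\<close>

section \<open>Transverse double points\<close>

text \<open>The domain of a knot diagram is the single circle {0} \<times> S^1, which is handled through its angle.\<close>

definition pt :: "real \<Rightarrow> nat \<times> complex" where
  "pt t = (0, cis t)"

lemma circles_knot: "ncomp D = 1 \<Longrightarrow> circles D = {0} \<times> sphere 0 1"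
  by (auto simp: circles_def)

lemma compact_circles: "compact (circles D)"
  unfolding circles_def by (intro compact_Times finite_imp_compact compact_sphere) auto

lemma pt_in_circles: "ncomp D = 1 \<Longrightarrow> pt t \<in> circles D"
  by (simp add: circles_knot pt_def)

lemma continuous_pt: "continuous_on S pt"
  unfolding pt_def by (intro continuous_intros)

lemma pt_eq_iff:
  assumes "\<bar>s - t\<bar> < 2 * pi"
  shows "pt s = pt t \<longleftrightarrow> s = t"
proof
  assume "pt s = pt t"
  then have "cis (s - t) = 1"
    by (simp add: pt_def cis_divide [symmetric])
  then obtain n where "s - t = of_int n * (2 * pi)"
    by (auto simp: cis_conv_exp exp_eq_1)
  then have "\<bar>real_of_int n\<bar> * (2 * pi) < 1 * (2 * pi)"
    using assms by (simp add: abs_mult)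
  then have "\<bar>real_of_int n\<bar> < 1"
    using mult_less_cancel_right_pos [of "2 * pi" "\<bar>real_of_int n\<bar>" 1] pi_gt_zero by linarith
  then have "n = 0" by linarith
  then show "s = t" using \<open>s - t = of_int n * (2 * pi)\<close> by simp
qed simp

lemma pt_add_2pi: "pt (t + 2 * pi) = pt t" "pt (t - 2 * pi) = pt t"
  by (auto simp: pt_def complex_eq_iff cos_diff sin_diff)

lemma circles_eq_pt:
  assumes "ncomp D = 1" "x \<in> circles D"
  obtains t where "a \<le> t" "t < a + 2 * pi" "x = pt t"
proof -
  obtain z where z: "x = (0, z)" "norm z = 1"
    using assms by (auto simp: circles_knot)
  define t where "t = a + Arg2pi (z * cis (- a))"
  have "norm (z * cis (- a)) = 1" using z by (simp add: norm_mult)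
  then have "z * cis (- a) = cis (Arg2pi (z * cis (- a)))"
    by (metis Arg2pi_eq cis_conv_exp mult.commute of_real_1 mult.left_neutral)
  then have "z = cis t"
    by (simp add: t_def cis_mult [symmetric]) (metis cis_mult cis_zero mult.assoc mult.commute
        mult.right_neutral add.right_inverse)
  then show ?thesis
    using that [of t] Arg2pi_ge_0 Arg2pi_lt_2pi z by (simp add: t_def pt_def)
qed

lemma openin_arc:
  assumes D: "ncomp D = 1" and "b - a \<le> 2 * pi"
  shows "openin (top_of_set (circles D)) (pt ` {a<..<b})"
proof (cases "a < b")
  case True
  have "pt ` {a<..<b} = circles D - pt ` {b..a + 2 * pi}"
  proof -
    have "pt s \<noteq> pt t" if "a < s" "s < b" "b \<le> t" "t \<le> a + 2 * pi" for s t
      using pt_eq_iff [of s t] that by auto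
    moreover have "x \<in> pt ` {a<..<b}" if x: "x \<in> circles D" "x \<notin> pt ` {b..a + 2 * pi}" for x
    proof -
      obtain t where t: "a \<le> t" "t < a + 2 * pi" "x = pt t"
        using circles_eq_pt [OF D x(1)] by blast
      moreover have "t \<noteq> a"
        using x(2) t assms pt_add_2pi(1) [of a] image_eqI [of x pt "a + 2 * pi" "{b..a+2*pi}"]
        by auto
      ultimately show ?thesis
        using x(2) t by (cases "t < b") auto
    qed
    ultimately show ?thesis
      using pt_in_circles [OF D] by fastforce
  qed
  moreover have "closed (pt ` {b..a + 2 * pi})"
    by (intro compact_imp_closed compact_continuous_image continuous_pt) simp
  ultimately show ?thesis
    by (simp add: Diff_eq openin_open_Int open_Compl)
qed simp

lemma nbhd_contains_arc:
  assumes D: "ncomp D = 1" and A: "openin (top_of_set (circles D)) A" "pt t \<in> A"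
  obtains \<epsilon> where "0 < \<epsilon>" "\<epsilon> < 1" "pt ` {t - \<epsilon>..t + \<epsilon>} \<subseteq> A"
proof -
  obtain T where T: "open T" "A = circles D \<inter> T"
    using A by (auto simp: openin_open)
  have "open (pt -` T)"
    using continuous_pt T open_vimage by blast
  then obtain e where e: "e > 0" "cball t e \<subseteq> pt -` T"
    using A T open_contains_cball by (metis IntD2 vimageI2)
  define d where "d = min e (1/2)"
  have "pt ` {t - d..t + d} \<subseteq> A"
  proof (intro image_subsetI)
    fix s assume "s \<in> {t - d..t + d}"
    then have "s \<in> cball t e" by (auto simp: d_def dist_real_def)
    then show "pt s \<in> A" using e T pt_in_circles [OF D] by blast
  qed
  then show ?thesis using e that [of d] by (simp add: d_def)
qed

text \<open>On an arc around the point the function is monotone, because it is injective and continuous.\<close>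

lemma branch_covers:
  fixes g :: "nat \<times> complex \<Rightarrow> real"
  assumes D: "ncomp D = 1" and A: "openin (top_of_set (circles D)) A" "pt t \<in> A"
    and g: "continuous_on A g" "inj_on g A" "g (pt t) = 0"
  obtains \<epsilon> \<delta> where "0 < \<epsilon>" "\<epsilon> < 1" "0 < \<delta>" "pt ` {t - \<epsilon>..t + \<epsilon>} \<subseteq> A"
    "\<And>r. \<bar>r\<bar> < \<delta> \<Longrightarrow> \<exists>s\<in>{t - \<epsilon><..<t + \<epsilon>}. g (pt s) = r"
proof -
  obtain \<epsilon> where \<epsilon>: "0 < \<epsilon>" "\<epsilon> < 1" "pt ` {t - \<epsilon>..t + \<epsilon>} \<subseteq> A"
    using nbhd_contains_arc [OF D A] by blast
  define f where "f = g \<circ> pt"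
  have f: "continuous_on {t - \<epsilon>..t + \<epsilon>} f"
    unfolding f_def by (intro continuous_on_compose continuous_pt continuous_on_subset [OF g(1)] \<epsilon>)
  have injpt: "inj_on pt {t - \<epsilon>..t + \<epsilon>}"
    using \<epsilon> pi_gt3 by (intro inj_onI) (subst (asm) pt_eq_iff; auto)
  have fi: "inj_on f {t - \<epsilon>..t + \<epsilon>}"
    unfolding f_def by (intro comp_inj_on injpt inj_on_subset [OF g(2)] \<epsilon>)
  have ft: "f t = 0" by (simp add: f_def g)
  have or: "(f (t - \<epsilon>) < 0 \<and> 0 < f (t + \<epsilon>)) \<or> (f (t + \<epsilon>) < 0 \<and> 0 < f (t - \<epsilon>))"
    using continuous_inj_imp_mono [of "t - \<epsilon>" t "t + \<epsilon>" f] \<epsilon> f fi ft by auto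
  define \<delta> where "\<delta> = min \<bar>f (t - \<epsilon>)\<bar> \<bar>f (t + \<epsilon>)\<bar>"
  have "\<exists>s\<in>{t - \<epsilon><..<t + \<epsilon>}. g (pt s) = r" if "\<bar>r\<bar> < \<delta>" for r
  proof -
    have "\<exists>s\<ge>t - \<epsilon>. s \<le> t + \<epsilon> \<and> f s = r"
    proof (cases "f (t - \<epsilon>) < 0")
      case True
      with or that show ?thesis
        unfolding \<delta>_def by (intro IVT' [OF _ _ _ f]) (use \<epsilon> in auto)
    next
      case False
      with or that show ?thesis
        unfolding \<delta>_def by (intro IVT2' [OF _ _ _ f]) (use \<epsilon> in auto)
    qed
    then obtain s where s: "t - \<epsilon> \<le> s" "s \<le> t + \<epsilon>" "f s = r" by blast
    then have "s \<noteq> t - \<epsilon>" "s \<noteq> t + \<epsilon>" using that unfolding \<delta>_def by auto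
    with s show ?thesis by (intro bexI [of _ s]) (auto simp: f_def)
  qed
  with that [of \<epsilon> \<delta>] \<epsilon> or show ?thesis unfolding \<delta>_def by force
qed

text \<open>The inverse is continuous because the closed arc is compact.  With u = 1 and u = \<i> this gives the
  horizontal and the vertical diameter that occur in the definition of transversality.\<close>

lemma branch_homeomorphism:
  fixes f :: "nat \<times> complex \<Rightarrow> complex"
  assumes A: "pt ` {t - \<epsilon>..t + \<epsilon>} \<subseteq> A" "continuous_on A f" "inj_on f A"
    and u: "norm u = 1" and r: "0 < r"
    and line: "\<And>z. z \<in> A \<Longrightarrow> \<exists>s. f z = u * of_real s"
    and cover: "\<And>s. \<bar>s\<bar> < r \<Longrightarrow> \<exists>q\<in>{t - \<epsilon><..<t + \<epsilon>}. f (pt q) = u * of_real s"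
  shows "\<exists>g. homeomorphism {z \<in> pt ` {t - \<epsilon><..<t + \<epsilon>}. norm (f z) < r}
    {w \<in> ball 0 1. \<exists>s. w = u * of_real s} (\<lambda>z. f z / of_real r) g"
proof -
  let ?L = "pt ` {t - \<epsilon>..t + \<epsilon>}" and ?M = "{z \<in> pt ` {t - \<epsilon><..<t + \<epsilon>}. norm (f z) < r}"
  have L: "compact ?L" "?M \<subseteq> ?L"
    by (auto intro!: compact_continuous_image continuous_pt)
  obtain g where g: "homeomorphism ?L (f ` ?L) f g"
    using homeomorphism_compact [OF L(1) continuous_on_subset [OF A(2,1)] refl inj_on_subset [OF A(3,1)]] by blast
  have 1: "homeomorphism ?M (f ` ?M) f g"
    using g L(2) by (elim homeomorphism_of_subsets) auto
  have 2: "homeomorphism (f ` ?M) ((\<lambda>w. w / of_real r) ` f ` ?M) (\<lambda>w. w / of_real r) (\<lambda>w. w * of_real r)"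
    using r by (auto simp: homeomorphism_def image_image intro!: continuous_intros)
  have "(\<lambda>w. w / of_real r) ` f ` ?M = {w \<in> ball 0 1. \<exists>s. w = u * of_real s}"
  proof (intro equalityI subsetI)
    fix w assume "w \<in> (\<lambda>w. w / of_real r) ` f ` ?M"
    then obtain z where z: "z \<in> ?M" "w = f z / of_real r" by blast
    then have "z \<in> A" using L(2) A(1) by blast
    then obtain s where "f z = u * of_real s" using line by blast
    then have "w = u * of_real (s / r)" using z(2) by simp
    moreover have "norm w < 1" using z r by (simp add: norm_divide)
    ultimately show "w \<in> {w \<in> ball 0 1. \<exists>s. w = u * of_real s}" using mem_ball_0 by blast
  next
    fix w assume "w \<in> {w \<in> ball 0 1. \<exists>s. w = u * of_real s}"
    then obtain s where s: "w = u * of_real s" "norm w < 1" by auto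
    then have "\<bar>s\<bar> < 1" using u by (simp add: norm_mult)
    then have sr: "\<bar>s * r\<bar> < r" using r by (simp add: abs_mult)
    then obtain q where q: "q \<in> {t - \<epsilon><..<t + \<epsilon>}" "f (pt q) = u * of_real (s * r)" using cover by blast
    have "norm (f (pt q)) = \<bar>s * r\<bar>" unfolding q(2) norm_mult u norm_of_real by simp
    then have "pt q \<in> ?M" using q(1) sr by simp
    moreover have "w = f (pt q) / of_real r" using s(1) q(2) r by simp
    ultimately show "w \<in> (\<lambda>w. w / of_real r) ` f ` ?M" by blast
  qed
  with homeomorphism_compose [OF 1 2] show ?thesis by (auto simp: comp_def)
qed

text \<open>The definition of transversality wants each branch to fill a whole diameter of a chart which no
  other part of the curve enters.  A small ball around the crossing is such a chart: the rest of the
  curve is compact and misses the crossing, and each branch covers its line near the crossing.\<close>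

lemma transverse_criterion:
  assumes D: "ncomp D = 1" and cont: "continuous_on (circles D) (imm D)"
    and dp: "double_pair D x y"
    and only: "\<And>z. z \<in> circles D \<Longrightarrow> imm D z = imm D x \<Longrightarrow> z = x \<or> z = y"
    and U: "open U" "continuous_on U h" "inj_on h U" "imm D x \<in> U" "h (imm D x) = 0"
    and A: "openin (top_of_set (circles D)) A" "x \<in> A" "inj_on (imm D) A"
      "\<And>z. z \<in> A \<Longrightarrow> imm D z \<in> U \<and> Im (h (imm D z)) = 0"
    and A': "openin (top_of_set (circles D)) A'" "y \<in> A'" "inj_on (imm D) A'"
      "\<And>z. z \<in> A' \<Longrightarrow> imm D z \<in> U \<and> Re (h (imm D z)) = 0"
  shows "transverse_at D x y"
proof -
  have xy: "x \<in> circles D" "y \<in> circles D" "x \<noteq> y" "imm D x = imm D y"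
    using dp by (auto simp: double_pair_def)
  obtain \<xi> where \<xi>: "x = pt \<xi>" using circles_eq_pt [OF D xy(1)] by metis
  obtain \<eta> where \<eta>: "y = pt \<eta>" using circles_eq_pt [OF D xy(2)] by metis
  define f where "f = h \<circ> imm D"
  have sub: "A \<subseteq> circles D" "A' \<subseteq> circles D"
    using A A' openin_imp_subset by blast+
  have finj: "inj_on f A" "inj_on f A'"
    unfolding f_def using A(3,4) A'(3,4) U(3)
    by (auto intro!: comp_inj_on inj_on_subset [OF U(3)])
  have fcont: "continuous_on A f" "continuous_on A' f"
    unfolding f_def comp_def using A(4) A'(4)
    by (intro continuous_on_compose2 [OF U(2)] continuous_on_subset [OF cont] sub; blast)+
  have f0: "f x = 0" "f y = 0" using U xy by (auto simp: f_def)
  obtain V V' where V: "open V" "open V'" "x \<in> V" "y \<in> V'" "V \<inter> V' = {}"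
    using hausdorff [OF xy(3)] by auto
  define B where "B = A \<inter> V"
  define B' where "B' = A' \<inter> V'"
  have B: "openin (top_of_set (circles D)) B" "x \<in> B" "B \<subseteq> A"
    and B': "openin (top_of_set (circles D)) B'" "y \<in> B'" "B' \<subseteq> A'" and BB: "B \<inter> B' = {}"
    using A A' V by (auto simp: B_def B'_def intro: openin_Int_open)
  have "continuous_on B (\<lambda>z. Re (f z))"
    by (intro continuous_intros continuous_on_subset [OF fcont(1)] B)
  moreover have "inj_on (\<lambda>z. Re (f z)) A"
    using finj(1) A(4) unfolding inj_on_def f_def by (simp add: complex_eq_iff)
  then have "inj_on (\<lambda>z. Re (f z)) B"
    using B(3) by (rule inj_on_subset)
  ultimately obtain \<epsilon> \<delta> where \<epsilon>: "0 < \<epsilon>" "\<epsilon> < 1" "0 < \<delta>" "pt ` {\<xi> - \<epsilon>..\<xi> + \<epsilon>} \<subseteq> B"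
    "\<And>r. \<bar>r\<bar> < \<delta> \<Longrightarrow> \<exists>s\<in>{\<xi> - \<epsilon><..<\<xi> + \<epsilon>}. Re (f (pt s)) = r"
    using branch_covers [OF D B(1), of \<xi> "\<lambda>z. Re (f z)"] B f0 \<xi> by auto
  have "continuous_on B' (\<lambda>z. Im (f z))"
    by (intro continuous_intros continuous_on_subset [OF fcont(2)] B')
  moreover have "inj_on (\<lambda>z. Im (f z)) A'"
    using finj(2) A'(4) unfolding inj_on_def f_def by (simp add: complex_eq_iff)
  then have "inj_on (\<lambda>z. Im (f z)) B'"
    using B'(3) by (rule inj_on_subset)
  ultimately obtain \<epsilon>' \<delta>' where \<epsilon>': "0 < \<epsilon>'" "\<epsilon>' < 1" "0 < \<delta>'" "pt ` {\<eta> - \<epsilon>'..\<eta> + \<epsilon>'} \<subseteq> B'"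
    "\<And>r. \<bar>r\<bar> < \<delta>' \<Longrightarrow> \<exists>s\<in>{\<eta> - \<epsilon>'<..<\<eta> + \<epsilon>'}. Im (f (pt s)) = r"
    using branch_covers [OF D B'(1), of \<eta> "\<lambda>z. Im (f z)"] B' f0 \<eta> by auto
  define C where "C = pt ` {\<xi> - \<epsilon><..<\<xi> + \<epsilon>}"
  define C' where "C' = pt ` {\<eta> - \<epsilon>'<..<\<eta> + \<epsilon>'}"
  have oC: "openin (top_of_set (circles D)) C" "openin (top_of_set (circles D)) C'"
    unfolding C_def C'_def using \<epsilon> \<epsilon>' pi_gt3 by (auto intro!: openin_arc [OF D])
  have CB: "C \<subseteq> B" "C' \<subseteq> B'" "x \<in> C" "y \<in> C'"
    using \<epsilon> \<epsilon>' \<xi> \<eta> by (force simp: C_def C'_def)+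
  define K where "K = circles D - (C \<union> C')"
  have "closedin (top_of_set (circles D)) K"
    unfolding K_def using oC by (intro closedin_diff) auto
  then have "compact K"
    using compact_circles closedin_compact by blast
  then have cK: "closed (imm D ` K)"
    by (intro compact_imp_closed compact_continuous_image continuous_on_subset [OF cont])
      (auto simp: K_def)
  have "imm D x \<notin> imm D ` K"
    using only CB by (force simp: K_def)
  define W where "W = U - imm D ` K"
  have W: "open W" "imm D x \<in> W" "W \<subseteq> U"
    unfolding W_def using U cK \<open>imm D x \<notin> imm D ` K\<close> by auto
  have "open (h ` W)"
    using invariance_of_domain [of W h] W U continuous_on_subset inj_on_subset by blast
  moreover have "0 \<in> h ` W" using W U by force
  ultimately obtain r0 where r0: "r0 > 0" "ball 0 r0 \<subseteq> h ` W"
    by (meson openE)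
  define r where "r = min r0 (min \<delta> \<delta>')"
  have r: "r > 0" "r \<le> r0" "r \<le> \<delta>" "r \<le> \<delta>'" using r0 \<epsilon> \<epsilon>' by (auto simp: r_def)
  define U' where "U' = {z \<in> W. h z \<in> ball 0 r}"
  define h' where "h' = (\<lambda>z. h z / of_real r)"
  have hW: "continuous_on W h" "inj_on h W"
    using U W continuous_on_subset inj_on_subset by blast+
  have "open U'"
    using continuous_open_preimage [OF hW(1) W(1), of "ball 0 r"] by (simp add: U'_def Int_def vimage_def)
  have hc: "continuous_on U' h'" "inj_on h' U'"
    using hW r unfolding h'_def U'_def
    by (auto intro!: continuous_intros elim: continuous_on_subset inj_on_subset simp: inj_on_def)
  have him: "h' ` U' = ball 0 1"
  proof -
    have "w \<in> h' ` U'" if "norm w < 1" for w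
    proof -
      have "norm (w * of_real r) < r" using that r by (simp add: norm_mult)
      then have "w * of_real r \<in> h ` W" using r r0(2) by (auto simp: subset_iff)
      then obtain z where "z \<in> W" "h z = w * of_real r" by force
      then show ?thesis
        using that r by (intro image_eqI [of _ _ z]) (auto simp: h'_def U'_def norm_mult)
    qed
    then show ?thesis using r by (auto simp: h'_def U'_def norm_divide)
  qed
  obtain k where k: "homeomorphism U' (ball 0 1) h' k"
    using invariance_of_domain_homeomorphism [OF \<open>open U'\<close> hc(1) _ hc(2)] him by auto
  define M where "M = {z \<in> C. imm D z \<in> U'}"
  define N where "N = {z \<in> C'. imm D z \<in> U'}"
  have pre: "openin (top_of_set (circles D)) {z \<in> circles D. imm D z \<in> U'}"
    using continuous_openin_preimage_gen [OF cont \<open>open U'\<close>] by (simp add: Int_def vimage_def)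
  have CD: "C \<subseteq> circles D" "C' \<subseteq> circles D" using oC openin_imp_subset by auto
  have MN: "openin (top_of_set (circles D)) M" "openin (top_of_set (circles D)) N"
  proof -
    have "M = C \<inter> {z \<in> circles D. imm D z \<in> U'}" "N = C' \<inter> {z \<in> circles D. imm D z \<in> U'}"
      using CD by (auto simp: M_def N_def)
    then show "openin (top_of_set (circles D)) M" "openin (top_of_set (circles D)) N"
      using openin_Int [OF oC(1) pre] openin_Int [OF oC(2) pre] by simp_all
  qed
  have small: "imm D z \<in> U' \<longleftrightarrow> norm (f z) < r" if z: "imm D z \<in> U" for z
  proof
    assume "norm (f z) < r"
    then have "f z \<in> h ` W" using r r0(2) by (auto simp: subset_iff)
    then have "imm D z \<in> W"
      using z U(3) W(3) by (auto simp: f_def inj_on_def)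
    then show "imm D z \<in> U'" using \<open>norm (f z) < r\<close> by (simp add: U'_def f_def)
  qed (simp add: U'_def f_def)
  have f_U': "{z \<in> pt ` {\<xi> - \<epsilon><..<\<xi> + \<epsilon>}. norm (f z) < r} = {z \<in> pt ` {\<xi> - \<epsilon><..<\<xi> + \<epsilon>}. imm D z \<in> U'}"
  proof (rule Collect_cong, rule conj_cong [OF refl])
    fix z assume "z \<in> pt ` {\<xi> - \<epsilon><..<\<xi> + \<epsilon>}"
    then have "z \<in> A" using CB(1) B(3) unfolding C_def by blast
    then show "norm (f z) < r \<longleftrightarrow> imm D z \<in> U'" using small A(4) by blast
  qed
  have f_U'': "{z \<in> pt ` {\<eta> - \<epsilon>'<..<\<eta> + \<epsilon>'}. norm (f z) < r} = {z \<in> pt ` {\<eta> - \<epsilon>'<..<\<eta> + \<epsilon>'}. imm D z \<in> U'}"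
  proof (rule Collect_cong, rule conj_cong [OF refl])
    fix z assume "z \<in> pt ` {\<eta> - \<epsilon>'<..<\<eta> + \<epsilon>'}"
    then have "z \<in> A'" using CB(2) B'(3) unfolding C'_def by blast
    then show "norm (f z) < r \<longleftrightarrow> imm D z \<in> U'" using small A'(4) by blast
  qed
  have h'f: "h' \<circ> imm D = (\<lambda>z. f z / of_real r)" by (auto simp: h'_def f_def)
  have xU: "imm D x \<in> U'" using W U r by (simp add: U'_def)
  have "x \<in> M" "y \<in> N" using CB xU xy by (auto simp: M_def N_def)
  moreover have "M \<inter> N = {}" using CB BB by (auto simp: M_def N_def)
  moreover have "{z \<in> circles D. imm D z \<in> U'} = M \<union> N"
    using CD by (auto simp: M_def N_def U'_def W_def K_def)
  moreover have "\<exists>g. homeomorphism M {w \<in> ball 0 1. Im w = 0} (h' \<circ> imm D) g"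
  proof -
    have "\<exists>g. homeomorphism {z \<in> pt ` {\<xi> - \<epsilon><..<\<xi> + \<epsilon>}. norm (f z) < r}
        {w \<in> ball 0 1. \<exists>s. w = 1 * of_real s} (\<lambda>z. f z / of_real r) g"
    proof (rule branch_homeomorphism [OF subset_trans [OF \<epsilon>(4) B(3)] fcont(1) finj(1) _ r(1)])
      show "\<exists>s. f z = 1 * of_real s" if "z \<in> A" for z
        using A(4) [OF that] by (intro exI [of _ "Re (f z)"]) (simp add: f_def complex_eq_iff)
      show "\<exists>q\<in>{\<xi> - \<epsilon><..<\<xi> + \<epsilon>}. f (pt q) = 1 * of_real s" if s: "\<bar>s\<bar> < r" for s
      proof -
        have "\<bar>s\<bar> < \<delta>" using s r by linarith
        then obtain q where q: "q \<in> {\<xi> - \<epsilon><..<\<xi> + \<epsilon>}" "Re (f (pt q)) = s" using \<epsilon>(5) by blast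
        then have "pt q \<in> A" using \<epsilon>(4) B(3) by fastforce
        then show ?thesis using q A(4) by (intro bexI [of _ q]) (simp_all add: f_def complex_eq_iff)
      qed
    qed simp
    moreover have "{w \<in> ball 0 1. \<exists>s. w = 1 * of_real s} = {w \<in> ball 0 1. Im w = 0}"
      by (auto simp: complex_eq_iff)
    ultimately show ?thesis unfolding M_def C_def f_U' [symmetric] h'f by simp
  qed
  moreover have "\<exists>g. homeomorphism N {w \<in> ball 0 1. Re w = 0} (h' \<circ> imm D) g"
  proof -
    have "\<exists>g. homeomorphism {z \<in> pt ` {\<eta> - \<epsilon>'<..<\<eta> + \<epsilon>'}. norm (f z) < r}
        {w \<in> ball 0 1. \<exists>s. w = \<i> * of_real s} (\<lambda>z. f z / of_real r) g"
    proof (rule branch_homeomorphism [OF subset_trans [OF \<epsilon>'(4) B'(3)] fcont(2) finj(2) _ r(1)])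
      show "\<exists>s. f z = \<i> * of_real s" if "z \<in> A'" for z
        using A'(4) [OF that] by (intro exI [of _ "Im (f z)"]) (simp add: f_def complex_eq_iff)
      show "\<exists>q\<in>{\<eta> - \<epsilon>'<..<\<eta> + \<epsilon>'}. f (pt q) = \<i> * of_real s" if s: "\<bar>s\<bar> < r" for s
      proof -
        have "\<bar>s\<bar> < \<delta>'" using s r by linarith
        then obtain q where q: "q \<in> {\<eta> - \<epsilon>'<..<\<eta> + \<epsilon>'}" "Im (f (pt q)) = s" using \<epsilon>'(5) by blast
        then have "pt q \<in> A'" using \<epsilon>'(4) B'(3) by fastforce
        then show ?thesis using q A'(4) by (intro bexI [of _ q]) (simp_all add: f_def complex_eq_iff)
      qed
    qed simp
    moreover have "{w \<in> ball 0 1. \<exists>s. w = \<i> * of_real s} = {w \<in> ball 0 1. Re w = 0}"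
      by (auto simp: complex_eq_iff)
    ultimately show ?thesis unfolding N_def C'_def f_U'' [symmetric] h'f by simp
  qed
  ultimately show ?thesis
    unfolding transverse_at_def using \<open>open U'\<close> k MN by blast
qed

section \<open>Replacing a part of a diagram\<close>

text \<open>Points of the domain are pairs; splitting their quantifiers only obscures the goals.\<close>

declare split_paired_All [simp del] split_paired_Ex [simp del]

lemma openin_pullback:
  assumes "openin (top_of_set X) A" "continuous_on A \<phi>" "\<phi> ` A \<subseteq> Y" "openin (top_of_set Y) T"
  shows "openin (top_of_set X) {z \<in> A. \<phi> z \<in> T}"
proof -
  have "openin (top_of_set A) (A \<inter> \<phi> -` T)"
    using assms by (intro continuous_openin_preimage [of A \<phi> Y]) auto
  then have "openin (top_of_set X) (A \<inter> \<phi> -` T)"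
    using assms(1) openin_trans by blast
  then show ?thesis by (simp add: Int_def vimage_def)
qed

text \<open>Only the curve near the two preimages matters, and a local reparametrization does not move its image.\<close>

lemma transverse_transfer:
  assumes D1: "ncomp D1 = 1" and cont: "continuous_on (circles D1) (imm D1)"
    and dp: "double_pair D1 x1 y1"
    and only: "\<And>z. z \<in> circles D1 \<Longrightarrow> imm D1 z = imm D1 x1 \<Longrightarrow> z = x1 \<or> z = y1"
    and A: "openin (top_of_set (circles D1)) A" "x1 \<in> A" "y1 \<in> A"
      "continuous_on A \<phi>" "inj_on \<phi> A" "\<phi> ` A \<subseteq> circles D"
      "\<And>z. z \<in> A \<Longrightarrow> imm D1 z = imm D (\<phi> z)"
    and tr: "transverse_at D (\<phi> x1) (\<phi> y1)"
  shows "transverse_at D1 x1 y1"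
proof -
  obtain U h k M N f g where U: "open U" "homeomorphism U (ball (0::complex) 1) h k"
    and M: "openin (top_of_set (circles D)) M" "\<phi> x1 \<in> M"
    and N: "openin (top_of_set (circles D)) N" "\<phi> y1 \<in> N"
    and MN: "{z \<in> circles D. imm D z \<in> U} = M \<union> N"
    and f: "homeomorphism M {w \<in> ball 0 1. Im w = 0} (h \<circ> imm D) f"
    and g: "homeomorphism N {w \<in> ball 0 1. Re w = 0} (h \<circ> imm D) g"
    using tr unfolding transverse_at_def by blast
  have eq: "imm D1 x1 = imm D1 y1" using dp by (simp add: double_pair_def)
  have hU: "continuous_on U h" "inj_on h U"
    using U by (auto simp: homeomorphism_def intro: inj_on_inverseI)
  have op: "openin (top_of_set (circles D1)) {z \<in> A. \<phi> z \<in> T}"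
    if "openin (top_of_set (circles D)) T" for T
    using openin_pullback [OF A(1,4,6) that] .
  have Mp: "imm D z \<in> U \<and> Im (h (imm D z)) = 0" if "z \<in> M" for z
    using that MN f by (auto simp: homeomorphism_def)
  have Np: "imm D z \<in> U \<and> Re (h (imm D z)) = 0" if "z \<in> N" for z
    using that MN g by (auto simp: homeomorphism_def)
  have injM: "inj_on (imm D) M"
  proof (rule inj_onI)
    fix a b assume "a \<in> M" "b \<in> M" "imm D a = imm D b"
    then show "a = b"
      using homeomorphism_apply1 [OF f, of a] homeomorphism_apply1 [OF f, of b] by simp
  qed
  have injN: "inj_on (imm D) N"
  proof (rule inj_onI)
    fix a b assume "a \<in> N" "b \<in> N" "imm D a = imm D b"
    then show "a = b"
      using homeomorphism_apply1 [OF g, of a] homeomorphism_apply1 [OF g, of b] by simp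
  qed
  show ?thesis
  proof (rule transverse_criterion [OF D1 cont dp only \<open>open U\<close> hU])
    show "imm D1 x1 \<in> U" using A M Mp by simp
    show "h (imm D1 x1) = 0" using A M N Mp Np eq by (metis complex_eq_iff zero_complex.simps)
    show "openin (top_of_set (circles D1)) {z \<in> A. \<phi> z \<in> M}"
      "openin (top_of_set (circles D1)) {z \<in> A. \<phi> z \<in> N}" using op M N by auto
    show "x1 \<in> {z \<in> A. \<phi> z \<in> M}" "y1 \<in> {z \<in> A. \<phi> z \<in> N}" using A M N by auto
    show "inj_on (imm D1) {z \<in> A. \<phi> z \<in> M}" "inj_on (imm D1) {z \<in> A. \<phi> z \<in> N}"
      using injM injN A(5,7) by (auto simp: inj_on_def)
  qed (use A Mp Np in auto)
qed

text \<open>Here K is the part of the domain on which the curve has been changed.  Off K the new curve is the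
  old one up to the reparametrization \<open>\<phi>\<close>, which may be different on different components of the
  complement of K; this freedom is what allows an arc of the knot to be reversed.  Since the images of
  K and of its complement are disjoint, no double point involves both.\<close>

lemma replacement_generic:
  assumes D1: "ncomp D1 = 1" and cont: "continuous_on (circles D1) (imm D1)"
    and D: "immersed D" "generic D"
    and K: "closed K" "K \<subseteq> circles D1"
    and \<phi>: "continuous_on (circles D1 - K) \<phi>" "inj_on \<phi> (circles D1 - K)"
      "\<phi> ` (circles D1 - K) \<subseteq> circles D"
      "\<And>x. x \<in> circles D1 - K \<Longrightarrow> imm D1 x = imm D (\<phi> x)"
    and disj: "\<And>x y. x \<in> K \<Longrightarrow> y \<in> circles D1 - K \<Longrightarrow> imm D1 x \<noteq> imm D1 y"
    and K_inj: "\<And>x. x \<in> K \<Longrightarrow> \<exists>N. openin (top_of_set (circles D1)) N \<and> x \<in> N \<and> inj_on (imm D1) N"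
    and K_fin: "finite {x \<in> K. \<exists>y\<in>K. x \<noteq> y \<and> imm D1 x = imm D1 y}"
    and K_uniq: "\<And>x y z. \<lbrakk>x \<in> K; y \<in> K; z \<in> K; x \<noteq> y; x \<noteq> z; imm D1 x = imm D1 y; imm D1 x = imm D1 z\<rbrakk> \<Longrightarrow> y = z"
    and K_trans: "\<And>x y. \<lbrakk>x \<in> K; y \<in> K; double_pair D1 x y\<rbrakk> \<Longrightarrow> transverse_at D1 x y"
  shows "immersed D1 \<and> generic D1"
proof
  have oO: "openin (top_of_set (circles D1)) (circles D1 - K)"
    using K by (simp add: Diff_eq openin_open_Int open_Compl)
  show "immersed D1"
    unfolding immersed_def
  proof (intro conjI cont ballI)
    fix x assume x: "x \<in> circles D1"
    show "\<exists>N. openin (top_of_set (circles D1)) N \<and> x \<in> N \<and> inj_on (imm D1) N"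
    proof (cases "x \<in> K")
      case True then show ?thesis by (rule K_inj)
    next
      case False
      then have x': "x \<in> circles D1 - K" using x by simp
      then obtain N where N: "openin (top_of_set (circles D)) N" "\<phi> x \<in> N" "inj_on (imm D) N"
        using D(1) \<phi>(3) by (auto simp: immersed_def)
      let ?N = "{z \<in> circles D1 - K. \<phi> z \<in> N}"
      have "openin (top_of_set (circles D1)) ?N"
        using openin_pullback [OF oO \<phi>(1,3) N(1)] .
      moreover have "inj_on (imm D1) ?N"
        using \<phi>(2,4) N(3) unfolding inj_on_def by auto
      ultimately show ?thesis using N x' by blast
    qed
  qed
  have dpK: "double_pair D1 x y \<Longrightarrow> x \<in> K \<longleftrightarrow> y \<in> K" for x y
    using disj unfolding double_pair_def by (metis DiffI)
  have dpO: "double_pair D (\<phi> x) (\<phi> y)" if "double_pair D1 x y" "x \<notin> K" for x y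
  proof -
    have "x \<in> circles D1 - K" "y \<in> circles D1 - K" "x \<noteq> y" "imm D1 x = imm D1 y"
      using that dpK [OF that(1)] by (simp_all add: double_pair_def)
    then show ?thesis
      using \<phi>(2,3) \<phi>(4) [of x] \<phi>(4) [of y] unfolding double_pair_def inj_on_def by (metis image_subset_iff)
  qed
  show "generic D1"
    unfolding generic_def
  proof (intro conjI allI impI)
    have "finite ({x \<in> circles D1 - K. \<exists>y. double_pair D (\<phi> x) y})"
    proof (rule finite_imageD)
      show "finite (\<phi> ` {x \<in> circles D1 - K. \<exists>y. double_pair D (\<phi> x) y})"
        by (rule finite_subset [of _ "{x. \<exists>y. double_pair D x y}"]) (use D(2) in \<open>unfold generic_def, blast+\<close>)
      show "inj_on \<phi> {x \<in> circles D1 - K. \<exists>y. double_pair D (\<phi> x) y}"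
        using \<phi>(2) by (rule inj_on_subset) auto
    qed
    with K_fin have fin: "finite ({x \<in> K. \<exists>y\<in>K. x \<noteq> y \<and> imm D1 x = imm D1 y} \<union>
        {x \<in> circles D1 - K. \<exists>y. double_pair D (\<phi> x) y})" (is "finite ?F") by simp
    have "x \<in> ?F" if xy: "double_pair D1 x y" for x y
      using xy dpK [OF xy] dpO [OF xy] by (cases "x \<in> K") (unfold double_pair_def, blast+)
    then show "finite {x. \<exists>y. double_pair D1 x y}"
      by (intro finite_subset [OF _ fin]) blast
  next
    fix x y z assume *: "double_pair D1 x y \<and> double_pair D1 x z"
    show uniq: "y = z"
    proof (cases "x \<in> K")
      case True
      then show ?thesis using * dpK K_uniq unfolding double_pair_def by metis
    next
      case False
      then have "\<phi> y = \<phi> z" using * dpO D(2) unfolding generic_def by blast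
      then show ?thesis
        using * False dpK \<phi>(2) unfolding inj_on_def double_pair_def by (metis DiffI)
    qed
  next
    fix x y assume dp: "double_pair D1 x y"
    show "transverse_at D1 x y"
    proof (cases "x \<in> K")
      case True
      then show ?thesis using dp dpK K_trans by blast
    next
      case False
      have "transverse_at D (\<phi> x) (\<phi> y)"
        using dpO [OF dp False] D(2) by (auto simp: generic_def)
      moreover have "z = x \<or> z = y" if z: "z \<in> circles D1" "imm D1 z = imm D1 x" for z
      proof (rule ccontr)
        assume zxy: "\<not> (z = x \<or> z = y)"
        then have 1: "double_pair D1 x z" using z dp by (auto simp: double_pair_def)
        then have "\<phi> z = \<phi> y" using dp False dpO D(2) unfolding generic_def by blast
        then show False
          using 1 dp zxy False dpK \<phi>(2) unfolding inj_on_def double_pair_def by (metis DiffI)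
      qed
      ultimately show ?thesis
        using transverse_transfer [OF D1 cont dp _ oO _ _ \<phi>(1,2,3,4)] dp False dpK [OF dp]
        by (auto simp: double_pair_def)
    qed
  qed
qed

section \<open>Strands in a chart\<close>

text \<open>Invariance of domain: an injective continuous map of an open set of the plane is a chart.\<close>

lemma chart_open:
  fixes \<kappa> :: "complex \<Rightarrow> complex"
  assumes "continuous_on Q \<kappa>" "inj_on \<kappa> Q" "open S" "S \<subseteq> Q"
  shows "open (\<kappa> ` S)"
  using invariance_of_domain [OF continuous_on_subset [OF assms(1,4)] assms(3) inj_on_subset [OF assms(2,4)]] .

lemma chart_interior:
  fixes \<kappa> :: "complex \<Rightarrow> complex"
  assumes "open Q" "continuous_on Q \<kappa>" "inj_on \<kappa> Q" "S \<subseteq> Q"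
  shows "interior (\<kappa> ` S) = \<kappa> ` interior S"
proof
  have "open (Q \<inter> \<kappa> -` interior (\<kappa> ` S))"
    using continuous_open_preimage [OF assms(2,1) open_interior] .
  moreover have "Q \<inter> \<kappa> -` interior (\<kappa> ` S) \<subseteq> S"
  proof
    fix w assume "w \<in> Q \<inter> \<kappa> -` interior (\<kappa> ` S)"
    then have "w \<in> Q" "\<kappa> w \<in> \<kappa> ` S" using interior_subset [of "\<kappa> ` S"] by auto
    then show "w \<in> S" using assms(3,4) by (meson inj_on_image_mem_iff)
  qed
  ultimately have "Q \<inter> \<kappa> -` interior (\<kappa> ` S) \<subseteq> interior S"
    by (simp add: interior_maximal)
  then show "interior (\<kappa> ` S) \<subseteq> \<kappa> ` interior S"
    using interior_subset [of "\<kappa> ` S"] assms(4) by fastforce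
  show "\<kappa> ` interior S \<subseteq> interior (\<kappa> ` S)"
    using interior_subset [of S] assms
    by (intro interior_maximal image_mono chart_open [of Q]) auto
qed

lemma chart_frontier:
  fixes \<kappa> :: "complex \<Rightarrow> complex"
  assumes "open Q" "continuous_on Q \<kappa>" "inj_on \<kappa> Q" "S \<subseteq> Q" "compact S"
  shows "frontier (\<kappa> ` S) = \<kappa> ` frontier S"
proof -
  have "closed (\<kappa> ` S)"
    using assms by (intro compact_imp_closed compact_continuous_image)
      (auto intro: continuous_on_subset)
  then show ?thesis
    using assms inj_on_image_set_diff [OF assms(3), of S "interior S"] subset_trans [OF interior_subset assms(4)]
      subset_trans [OF Diff_subset assms(4)]
    by (simp add: frontier_def chart_interior closure_closed compact_imp_closed)
qed

text \<open>In the chart \<open>\<kappa>\<close> on Q the diagram consists of one strand, with parameter \<open>\<sigma>\<close> in the domain and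
  with the plane curve \<open>\<Gamma>\<close> as its picture in Q.\<close>

definition strand_chart ::
  "vdiagram \<Rightarrow> (complex \<Rightarrow> complex) \<Rightarrow> complex set \<Rightarrow> (real \<Rightarrow> nat \<times> complex) \<Rightarrow> real set \<Rightarrow>
     (real \<Rightarrow> complex) \<Rightarrow> bool" where
  "strand_chart D \<kappa> Q \<sigma> I \<Gamma> \<longleftrightarrow>
     open Q \<and> continuous_on Q \<kappa> \<and> inj_on \<kappa> Q \<and>
     homeomorphism I (\<sigma> ` I) \<sigma> (inv_into I \<sigma>) \<and>
     {x \<in> circles D. imm D x \<in> \<kappa> ` Q} = \<sigma> ` I \<and>
     (\<forall>s\<in>I. \<Gamma> s \<in> Q \<and> imm D (\<sigma> s) = \<kappa> (\<Gamma> s))"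

lemma strand_chartD:
  assumes "strand_chart D \<kappa> Q \<sigma> I \<Gamma>"
  shows "open Q" "continuous_on Q \<kappa>" "inj_on \<kappa> Q" "continuous_on I \<sigma>" "inj_on \<sigma> I"
    "continuous_on (\<sigma> ` I) (inv_into I \<sigma>)"
    "{x \<in> circles D. imm D x \<in> \<kappa> ` Q} = \<sigma> ` I"
    "\<And>s. s \<in> I \<Longrightarrow> \<Gamma> s \<in> Q" "\<And>s. s \<in> I \<Longrightarrow> imm D (\<sigma> s) = \<kappa> (\<Gamma> s)"
    "\<And>s. s \<in> I \<Longrightarrow> \<sigma> s \<in> circles D"
  using assms unfolding strand_chart_def homeomorphism_def
  by (auto intro: inj_on_inverseI)

lemma strand_chart_open:
  assumes "strand_chart D \<kappa> Q \<sigma> I \<Gamma>" "continuous_on (circles D) (imm D)"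
    and J: "open J" "J \<subseteq> I"
  shows "openin (top_of_set (circles D)) (\<sigma> ` J)"
proof -
  note c = strand_chartD [OF assms(1)]
  have "openin (top_of_set (circles D)) (\<sigma> ` I)"
    using continuous_openin_preimage_gen [OF assms(2) chart_open [OF c(2,3,1)]] c(7)
    by (simp add: Int_def vimage_def)
  moreover have "openin (top_of_set (\<sigma> ` I)) (\<sigma> ` J)"
    using assms(1) open_subset [OF J(2,1)] unfolding strand_chart_def
    by (blast intro: homeomorphism_imp_open_map)
  ultimately show ?thesis using openin_trans by blast
qed

text \<open>A crossing on the strand would be with another point of the same strand, as no other strand enters the chart.\<close>

lemma strand_no_over:
  assumes D: "virtual_knot_diagram D" and sc: "strand_chart D \<kappa> Q \<sigma> I \<Gamma>" and inj: "inj_on \<Gamma> I"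
    and s: "s \<in> I"
  shows "\<sigma> s \<notin> over D"
proof
  note c = strand_chartD [OF sc]
  assume "\<sigma> s \<in> over D"
  then obtain y where y: "double_pair D (\<sigma> s) y"
    using D by (auto simp: virtual_knot_diagram_def virtual_link_diagram_def)
  then have ky: "imm D y = \<kappa> (\<Gamma> s)" "y \<in> circles D"
    using c(9) [OF s] by (simp_all add: double_pair_def)
  then have "y \<in> {x \<in> circles D. imm D x \<in> \<kappa> ` Q}"
    using c(8) [OF s] by simp
  then obtain t where t: "t \<in> I" "y = \<sigma> t" using c(7) by auto
  then have "\<kappa> (\<Gamma> s) = \<kappa> (\<Gamma> t)" using ky c(9) by simp
  then have "\<Gamma> s = \<Gamma> t" using inj_onD [OF c(3)] c(8) s t(1) by blast
  then have "s = t" using inj_onD [OF inj] s t(1) by blast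
  then show False using y t by (simp add: double_pair_def)
qed

lemma continuous_on_openin_Un:
  assumes "openin (top_of_set X) A" "openin (top_of_set X) B" "X \<subseteq> A \<union> B"
    and "continuous_on A f" "continuous_on B f"
  shows "continuous_on X f"
  unfolding continuous_openin_preimage_eq
proof (intro allI impI)
  fix T :: "'b set" assume "open T"
  then have "openin (top_of_set A) (A \<inter> f -` T)" "openin (top_of_set B) (B \<inter> f -` T)"
    using assms(4,5) by (auto simp: continuous_openin_preimage_eq)
  then have "openin (top_of_set X) ((A \<inter> f -` T) \<union> (B \<inter> f -` T))"
    using assms(1,2) openin_trans by blast
  moreover have "A \<subseteq> X" "B \<subseteq> X" using assms(1,2) openin_imp_subset by auto
  then have "(A \<inter> f -` T) \<union> (B \<inter> f -` T) = X \<inter> f -` T" using assms(3) by auto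
  ultimately show "openin (top_of_set X) (X \<inter> f -` T)" by simp
qed

text \<open>The crossings of the old strand disappear, and those of the new strand are virtual; hence the points
  of the strand are taken out of the set of over-crossings.\<close>

definition replace_strand ::
  "vdiagram \<Rightarrow> (complex \<Rightarrow> complex) \<Rightarrow> (real \<Rightarrow> nat \<times> complex) \<Rightarrow> real set \<Rightarrow> (real \<Rightarrow> complex) \<Rightarrow> vdiagram" where
  "replace_strand D \<kappa> \<sigma> I \<Gamma> =
     D\<lparr>imm := \<lambda>x. if x \<in> \<sigma> ` I then \<kappa> (\<Gamma> (inv_into I \<sigma> x)) else imm D x, over := over D - \<sigma> ` I\<rparr>"

lemma replace_strand_simps:
  "ncomp (replace_strand D \<kappa> \<sigma> I \<Gamma>) = ncomp D"
  "circles (replace_strand D \<kappa> \<sigma> I \<Gamma>) = circles D"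
  "over (replace_strand D \<kappa> \<sigma> I \<Gamma>) = over D - \<sigma> ` I"
  "x \<notin> \<sigma> ` I \<Longrightarrow> imm (replace_strand D \<kappa> \<sigma> I \<Gamma>) x = imm D x"
  "inj_on \<sigma> I \<Longrightarrow> s \<in> I \<Longrightarrow> imm (replace_strand D \<kappa> \<sigma> I \<Gamma>) (\<sigma> s) = \<kappa> (\<Gamma> s)"
  by (auto simp: replace_strand_def circles_def)

text \<open>The new strand may cross itself once, at the parameters a and b, in a horizontal and a vertical
  segment.  An embedded strand is the case a = b.\<close>

lemma replace_strand_diagram:
  assumes D: "virtual_knot_diagram D" and sc: "strand_chart D \<kappa> Q \<sigma> I \<Gamma>0" and I: "open I"
    and lr: "{l..r} \<subseteq> I"
    and \<Gamma>: "continuous_on I \<Gamma>" "\<Gamma> ` I \<subseteq> Q" "\<And>s. s \<in> I \<Longrightarrow> s \<notin> {l..r} \<Longrightarrow> \<Gamma> s = \<Gamma>0 s"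
    and cross: "\<And>s t. \<lbrakk>s \<in> I; t \<in> I; s \<noteq> t; \<Gamma> s = \<Gamma> t\<rbrakk> \<Longrightarrow> (s, t) = (a, b) \<or> (s, t) = (b, a)"
    and ab: "a \<in> {l..r}" "b \<in> {l..r}"
    and axis: "\<lbrakk>a \<noteq> b; \<Gamma> a = \<Gamma> b\<rbrakk> \<Longrightarrow> \<exists>\<epsilon>>0. (\<forall>s. \<bar>s - a\<bar> < \<epsilon> \<longrightarrow> Im (\<Gamma> s) = Im (\<Gamma> a)) \<and>
      (\<forall>s. \<bar>s - b\<bar> < \<epsilon> \<longrightarrow> Re (\<Gamma> s) = Re (\<Gamma> b))"
  shows "virtual_knot_diagram (replace_strand D \<kappa> \<sigma> I \<Gamma>) \<and>
    strand_chart (replace_strand D \<kappa> \<sigma> I \<Gamma>) \<kappa> Q \<sigma> I \<Gamma>"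
proof -
  define D1 where "D1 = replace_strand D \<kappa> \<sigma> I \<Gamma>"
  note c = strand_chartD [OF sc]
  have D': "immersed D" "generic D" "ncomp D = 1" "over D \<subseteq> {x. \<exists>y. double_pair D x y}"
    "\<And>x y. double_pair D x y \<Longrightarrow> \<not> (x \<in> over D \<and> y \<in> over D)"
    using D by (auto simp: virtual_knot_diagram_def virtual_link_diagram_def)
  have contD: "continuous_on (circles D) (imm D)" using D'(1) by (simp add: immersed_def)
  have n1: "ncomp D1 = 1" and circ: "circles D1 = circles D" and ov: "over D1 = over D - \<sigma> ` I"
    and out: "\<And>x. x \<notin> \<sigma> ` I \<Longrightarrow> imm D1 x = imm D x"
    and ins: "\<And>s. s \<in> I \<Longrightarrow> imm D1 (\<sigma> s) = \<kappa> (\<Gamma> s)"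
    using D' c(5) by (simp_all add: D1_def replace_strand_simps)
  define K where "K = \<sigma> ` {l..r}"
  have KI: "K \<subseteq> \<sigma> ` I" using lr by (auto simp: K_def)
  have Kc: "closed K"
    unfolding K_def using lr
    by (intro compact_imp_closed compact_continuous_image continuous_on_subset [OF c(4)]) auto
  have Kcirc: "K \<subseteq> circles D" using KI c(10) by auto
  have outK: "imm D1 x = imm D x" if "x \<notin> K" for x
  proof (cases "x \<in> \<sigma> ` I")
    case True
    then obtain s where s: "s \<in> I" "x = \<sigma> s" by blast
    then have "s \<notin> {l..r}" using that by (auto simp: K_def)
    then show ?thesis using s ins c(9) \<Gamma>(3) by simp
  qed (rule out)
  have \<sigma>eq: "\<sigma> s = \<sigma> t \<longleftrightarrow> s = t" if "s \<in> I" "t \<in> I" for s t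
    using c(5) that by (auto simp: inj_on_def)
  have \<kappa>eq: "\<kappa> (\<Gamma> s) = \<kappa> (\<Gamma> t) \<longleftrightarrow> \<Gamma> s = \<Gamma> t" if "s \<in> I" "t \<in> I" for s t
    using c(3) \<Gamma>(2) that by (auto simp: inj_on_def)
  have strand_op: "openin (top_of_set (circles D)) (\<sigma> ` J)" if "open J" "J \<subseteq> I" for J
    using strand_chart_open [OF sc contD that] .
  have contI: "continuous_on (\<sigma> ` I) (imm D1)"
  proof -
    have "continuous_on (\<sigma> ` I) (\<lambda>x. \<kappa> (\<Gamma> (inv_into I \<sigma> x)))"
      using \<Gamma>(2) by (intro continuous_on_compose2 [OF c(2)] continuous_on_compose2 [OF \<Gamma>(1)] c(6))
        (auto simp: inv_into_into)
    then show ?thesis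
      using ins c(5) by (elim continuous_on_eq) auto
  qed
  have contO: "continuous_on (circles D - K) (imm D1)"
    using outK by (intro continuous_on_eq [OF continuous_on_subset [OF contD]]) auto
  have oO: "openin (top_of_set (circles D)) (circles D - K)"
    using Kc by (simp add: Diff_eq openin_open_Int open_Compl)
  have cont: "continuous_on (circles D1) (imm D1)"
    unfolding circ using KI by (intro continuous_on_openin_Un [OF strand_op [OF I] oO _ contI contO]) auto
  have disjK: "imm D1 x \<noteq> imm D1 y" if xy: "x \<in> K" "y \<in> circles D - K" for x y
  proof
    assume eq: "imm D1 x = imm D1 y"
    obtain s where s: "s \<in> {l..r}" "x = \<sigma> s" using xy by (auto simp: K_def)
    then have sI: "s \<in> I" using lr by auto
    then have "imm D1 x \<in> \<kappa> ` Q" using s ins \<Gamma>(2) by auto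
    then have "y \<in> \<sigma> ` I" using c(7) eq outK [of y] xy by auto
    then obtain t where t: "t \<in> I" "y = \<sigma> t" by blast
    then have "t \<notin> {l..r}" using xy by (auto simp: K_def)
    moreover have "\<Gamma> s = \<Gamma> t" using eq ins sI s t \<kappa>eq by simp
    ultimately show False using cross [OF sI t(1)] s ab by auto
  qed
  have inj_strand: "inj_on (imm D1) (\<sigma> ` J)"
    if J: "J \<subseteq> I" "\<And>s t. \<lbrakk>s \<in> J; t \<in> J; s \<noteq> t\<rbrakk> \<Longrightarrow> \<Gamma> s \<noteq> \<Gamma> t" for J
  proof (rule inj_onI)
    fix u v assume "u \<in> \<sigma> ` J" "v \<in> \<sigma> ` J" "imm D1 u = imm D1 v"
    then obtain p q where pq: "p \<in> J" "u = \<sigma> p" "q \<in> J" "v = \<sigma> q" by blast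
    then have "\<Gamma> p = \<Gamma> q" using \<open>imm D1 u = imm D1 v\<close> J(1) ins \<kappa>eq by (simp add: subset_iff)
    then show "u = v" using pq J(2) by metis
  qed
  have Kinj: "\<exists>N. openin (top_of_set (circles D1)) N \<and> x \<in> N \<and> inj_on (imm D1) N" if xK: "x \<in> K" for x
  proof -
    obtain s where s: "s \<in> I" "x = \<sigma> s" using xK KI by auto
    define J where "J = (if s \<noteq> a then I - {a} else if a \<noteq> b then I - {b} else I)"
    have J: "open J" "J \<subseteq> I" "s \<in> J" using I s by (auto simp: J_def open_delete)
    have "inj_on (imm D1) (\<sigma> ` J)"
    proof (rule inj_strand [OF J(2)])
      fix p q assume "p \<in> J" "q \<in> J" "p \<noteq> q"
      then show "\<Gamma> p \<noteq> \<Gamma> q" using cross [of p q] J(2) by (auto simp: J_def split: if_splits)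
    qed
    then show ?thesis using strand_op [OF J(1,2)] J s circ by auto
  qed
  have Kpair: "\<exists>s t. x = \<sigma> s \<and> y = \<sigma> t \<and> ((s, t) = (a, b) \<or> (s, t) = (b, a)) \<and> \<Gamma> s = \<Gamma> t \<and> a \<noteq> b"
    if xy: "x \<in> K" "y \<in> K" "x \<noteq> y" "imm D1 x = imm D1 y" for x y
  proof -
    obtain s t where st: "s \<in> I" "x = \<sigma> s" "t \<in> I" "y = \<sigma> t" using xy KI by blast
    then have "s \<noteq> t" "\<Gamma> s = \<Gamma> t" using xy ins \<kappa>eq by auto
    then show ?thesis using cross [of s t] st by blast
  qed
  have Kfin: "finite {x \<in> K. \<exists>y\<in>K. x \<noteq> y \<and> imm D1 x = imm D1 y}"
    by (rule finite_subset [of _ "{\<sigma> a, \<sigma> b}"]) (use Kpair in blast)+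
  have abI: "a \<in> I" "b \<in> I" using ab lr by auto
  have trans: "transverse_at D1 x y" if xy: "x \<in> K" "y \<in> K" "double_pair D1 x y" for x y
  proof -
    have *: "x \<noteq> y" "imm D1 x = imm D1 y" using xy by (auto simp: double_pair_def)
    obtain s t where st: "x = \<sigma> s" "y = \<sigma> t" "(s, t) = (a, b) \<or> (s, t) = (b, a)" "\<Gamma> s = \<Gamma> t" "a \<noteq> b"
      using Kpair [OF xy(1,2) *] by blast
    then have gab: "\<Gamma> a = \<Gamma> b" by auto
    obtain \<epsilon> where \<epsilon>: "\<epsilon> > 0" "\<And>s. \<bar>s - a\<bar> < \<epsilon> \<Longrightarrow> Im (\<Gamma> s) = Im (\<Gamma> a)"
      "\<And>s. \<bar>s - b\<bar> < \<epsilon> \<Longrightarrow> Re (\<Gamma> s) = Re (\<Gamma> b)"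
      using axis [OF st(5) gab] by blast
    define J where "J = (\<lambda>u v. (I \<inter> ball u \<epsilon>) - {v::real})"
    have J: "open (J u v)" "J u v \<subseteq> I" for u v using I by (auto simp: J_def open_delete)
    have oJ: "openin (top_of_set (circles D1)) (\<sigma> ` J u v)" for u v
      using strand_op [OF J] circ by simp
    have injJ: "inj_on (imm D1) (\<sigma> ` J a b)" "inj_on (imm D1) (\<sigma> ` J b a)"
    proof -
      have "\<Gamma> p \<noteq> \<Gamma> q" if "p \<in> J a b \<and> q \<in> J a b \<or> p \<in> J b a \<and> q \<in> J b a" "p \<noteq> q" for p q
        using cross [of p q] that by (auto simp: J_def)
      then show "inj_on (imm D1) (\<sigma> ` J a b)" "inj_on (imm D1) (\<sigma> ` J b a)"
        by (auto intro!: inj_strand [OF J(2)])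
    qed
    define h where "h = (\<lambda>z. inv_into Q \<kappa> z - \<Gamma> a)"
    define h' where "h' = (\<lambda>z. \<i> * h z)"
    obtain k where k: "homeomorphism Q (\<kappa> ` Q) \<kappa> k"
      using invariance_of_domain_homeomorphism [OF c(1,2) _ c(3)] by auto
    have "continuous_on (\<kappa> ` Q) k" "\<And>w. w \<in> Q \<Longrightarrow> k (\<kappa> w) = w"
      using k by (auto simp: homeomorphism_def)
    then have "continuous_on (\<kappa> ` Q) (inv_into Q \<kappa>)"
      using c(3) by (elim continuous_on_eq) auto
    then have hc: "continuous_on (\<kappa> ` Q) h" "continuous_on (\<kappa> ` Q) h'"
      unfolding h_def h'_def by (auto intro!: continuous_intros)
    have hi: "inj_on h (\<kappa> ` Q)" "inj_on h' (\<kappa> ` Q)"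
      using c(3) by (auto simp: h_def h'_def inj_on_def)
    have hv: "h (imm D1 (\<sigma> s)) = \<Gamma> s - \<Gamma> a" if "s \<in> I" for s
      using that \<Gamma>(2) c(3) ins by (auto simp: h_def)
    have inQ: "imm D1 (\<sigma> s) \<in> \<kappa> ` Q" if "s \<in> I" for s
      using that \<Gamma>(2) ins by auto
    have only: "z = x \<or> z = y" if "z \<in> circles D1" "imm D1 z = imm D1 x" for z
    proof -
      have "z \<in> K" using disjK [OF xy(1), of z] that circ by auto
      then show ?thesis using Kpair [of x z] that xy st \<open>imm D1 z = imm D1 x\<close> by auto
    qed
    have ax: "imm D1 z \<in> \<kappa> ` Q \<and> Im (h (imm D1 z)) = 0" if zJ: "z \<in> \<sigma> ` J a b" for z
    proof -
      obtain p where p: "z = \<sigma> p" "p \<in> I" "\<bar>p - a\<bar> < \<epsilon>"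
        using zJ unfolding J_def dist_real_def mem_ball image_iff by (metis DiffD1 IntD1 IntD2 abs_minus_commute dist_real_def mem_ball)
      then show ?thesis using hv [OF p(2)] inQ [OF p(2)] \<epsilon>(2) [OF p(3)] gab by simp
    qed
    have ay: "imm D1 z \<in> \<kappa> ` Q \<and> Re (h (imm D1 z)) = 0" if zJ: "z \<in> \<sigma> ` J b a" for z
    proof -
      obtain p where p: "z = \<sigma> p" "p \<in> I" "\<bar>p - b\<bar> < \<epsilon>"
        using zJ unfolding J_def dist_real_def mem_ball image_iff by (metis DiffD1 IntD1 IntD2 abs_minus_commute dist_real_def mem_ball)
      then show ?thesis using hv [OF p(2)] inQ [OF p(2)] \<epsilon>(3) [OF p(3)] gab by simp
    qed
    have mem: "\<sigma> a \<in> \<sigma> ` J a b" "\<sigma> b \<in> \<sigma> ` J b a" using abI st(5) \<epsilon>(1) by (auto simp: J_def)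
    note op = chart_open [OF c(2,3,1) subset_refl]
    from st(3) show ?thesis
    proof
      assume "(s, t) = (a, b)"
      then have xy': "x = \<sigma> a" "y = \<sigma> b" using st by auto
      show ?thesis
        by (rule transverse_criterion [OF n1 cont xy(3) only op hc(1) hi(1) _ _ oJ _ injJ(1) ax oJ _ injJ(2) ay])
          (use mem xy' inQ hv abI in auto)
    next
      assume "(s, t) = (b, a)"
      then have xy': "x = \<sigma> b" "y = \<sigma> a" using st by auto
      show ?thesis
        by (rule transverse_criterion [OF n1 cont xy(3) only op hc(2) hi(2) _ _ oJ _ injJ(2) _ oJ _ injJ(1)])
          (use mem xy' inQ hv abI gab ax ay in \<open>auto simp: h'_def\<close>)
    qed
  qed
  have "immersed D1 \<and> generic D1"
  proof (rule replacement_generic [OF n1 cont D'(1,2) Kc, where \<phi> = "\<lambda>x. x"])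
    fix x y z assume *: "x \<in> K" "y \<in> K" "z \<in> K" "x \<noteq> y" "x \<noteq> z" "imm D1 x = imm D1 y" "imm D1 x = imm D1 z"
    show "y = z"
      using Kpair [OF *(1,2,4,6)] Kpair [OF *(1,3,5,7)] \<sigma>eq abI by auto
  qed (use Kcirc circ outK disjK Kinj Kfin trans in auto)
  moreover have dp: "double_pair D1 x y" "y \<notin> \<sigma> ` I" if "double_pair D x y" "x \<notin> \<sigma> ` I" for x y
  proof -
    show y: "y \<notin> \<sigma> ` I"
      using that c(7) unfolding double_pair_def by (metis (mono_tags, lifting) mem_Collect_eq)
    show "double_pair D1 x y" using that y circ out by (simp add: double_pair_def)
  qed
  moreover have "over D1 \<subseteq> {x. \<exists>y. double_pair D1 x y}"
    using dp(1) D'(4) ov by blast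
  moreover have "\<not> (x \<in> over D1 \<and> y \<in> over D1)" if "double_pair D1 x y" for x y
  proof
    assume "x \<in> over D1 \<and> y \<in> over D1"
    then have *: "x \<notin> \<sigma> ` I" "y \<notin> \<sigma> ` I" "x \<in> over D" "y \<in> over D" using ov by auto
    then have "double_pair D x y" using that circ out by (simp add: double_pair_def)
    then show False using D'(5) * by blast
  qed
  ultimately have "virtual_knot_diagram D1"
    unfolding virtual_knot_diagram_def virtual_link_diagram_def using n1 by blast
  moreover have "strand_chart D1 \<kappa> Q \<sigma> I \<Gamma>"
  proof -
    have "{x \<in> circles D1. imm D1 x \<in> \<kappa> ` Q} = \<sigma> ` I"
    proof (intro equalityI subsetI)
      fix x assume x: "x \<in> {x \<in> circles D1. imm D1 x \<in> \<kappa> ` Q}"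
      show "x \<in> \<sigma> ` I"
      proof (rule ccontr)
        assume "x \<notin> \<sigma> ` I"
        then have "x \<in> {x \<in> circles D. imm D x \<in> \<kappa> ` Q}" using x out [of x] circ by simp
        then show False using \<open>x \<notin> \<sigma> ` I\<close> c(7) by simp
      qed
    next
      fix x assume "x \<in> \<sigma> ` I"
      then obtain s where "s \<in> I" "x = \<sigma> s" by blast
      then show "x \<in> {x \<in> circles D1. imm D1 x \<in> \<kappa> ` Q}"
        using c(10) circ ins \<Gamma>(2) by auto
    qed
    then show ?thesis
      using sc \<Gamma>(2) ins unfolding strand_chart_def by auto
  qed
  ultimately show ?thesis by (simp add: D1_def)
qed

section \<open>Curls\<close>

lemma arc_reparam:
  assumes "continuous_on {l..r} \<sigma>" "inj_on \<sigma> {l..r}" "u \<in> {l..r}" "v \<in> {l..r}" "u \<noteq> v"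
  shows "arc (\<lambda>t. \<sigma> (u + t * (v - u)))"
proof -
  have *: "u + t * (v - u) \<in> {l..r}" if "t \<in> {0..1}" for t
  proof -
    have "u + t * (v - u) = (1 - t) * u + t * v" by (simp add: algebra_simps)
    then show ?thesis using that assms convex_bound_le [of u r v "1 - t" t]
      convex_bound_le [of "-u" "-l" "-v" "1 - t" t] by auto
  qed
  have "continuous_on {0..1} (\<lambda>t. \<sigma> (u + t * (v - u)))"
    using * by (intro continuous_on_compose2 [OF assms(1)] continuous_intros) auto
  moreover have "inj_on (\<lambda>t. \<sigma> (u + t * (v - u))) {0..1}"
  proof (rule inj_onI)
    fix s t assume "s \<in> {0..1}" "t \<in> {0..1}" "\<sigma> (u + s * (v - u)) = \<sigma> (u + t * (v - u))"
    then have "u + s * (v - u) = u + t * (v - u)" using inj_onD [OF assms(2)] * by blast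
    then show "s = t" using assms(5) by simp
  qed
  ultimately show ?thesis by (simp add: arc_def path_def)
qed

lemma path_image_reparam:
  assumes "u < v"
  shows "path_image (\<lambda>t. \<sigma> (u + t * (v - u))) = \<sigma> ` {u..v}"
proof -
  have "(\<lambda>t. u + t * (v - u)) ` {0..1} = {u..v}"
  proof (intro equalityI subsetI)
    fix s assume "s \<in> {u..v}"
    then show "s \<in> (\<lambda>t. u + t * (v - u)) ` {0..1}"
      using assms by (intro image_eqI [of _ _ "(s - u) / (v - u)"]) (auto simp: field_simps)
  next
    fix s assume "s \<in> (\<lambda>t. u + t * (v - u)) ` {0..1}"
    then obtain t where t: "0 \<le> t" "t \<le> 1" "s = u + t * (v - u)" by auto
    moreover have "t * (v - u) \<le> v - u" "0 \<le> t * (v - u)"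
      using mult_right_mono [of t 1 "v - u"] t assms by auto
    ultimately show "s \<in> {u..v}" by simp
  qed
  moreover have "path_image (\<lambda>t. \<sigma> (u + t * (v - u))) = \<sigma> ` (\<lambda>t. u + t * (v - u)) ` {0..1}"
    by (simp add: path_image_def image_image)
  ultimately show ?thesis by simp
qed

lemma reparam_bounds:
  fixes u v t :: real
  assumes "u < v" "0 \<le> t" "t \<le> 1"
  shows "u \<le> u + t * (v - u)" "u + t * (v - u) \<le> v"
    "u + t * (v - u) = u \<longleftrightarrow> t = 0" "u + t * (v - u) = v \<longleftrightarrow> t = 1"
proof -
  have "t * (v - u) \<le> v - u" "0 \<le> t * (v - u)"
    using mult_right_mono [of t 1 "v - u"] assms by auto
  then show "u \<le> u + t * (v - u)" "u + t * (v - u) \<le> v" by simp_all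
  show "u + t * (v - u) = u \<longleftrightarrow> t = 0" using assms by simp
  have "u + t * (v - u) = v \<longleftrightarrow> (t - 1) * (v - u) = 0" by (auto simp: algebra_simps)
  then show "u + t * (v - u) = v \<longleftrightarrow> t = 1" using assms by simp
qed

lemma strands_single:
  assumes sc: "strand_chart D \<kappa> Q \<sigma> I \<Gamma>"
    and lr: "l < r" "{l..r} \<subseteq> I"
    and R: "compact R" "R \<subseteq> Q" "\<And>s. s \<in> I \<Longrightarrow> \<Gamma> s \<in> R \<longleftrightarrow> s \<in> {l..r}"
      "\<And>s. s \<in> {l..r} \<Longrightarrow> \<Gamma> s \<in> frontier R \<longleftrightarrow> s = l \<or> s = r"
  shows "strands (\<kappa> ` R) 1 D (\<lambda>i t. \<sigma> (l + t * (r - l)))"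
proof -
  note c = strand_chartD [OF sc]
  have fR: "frontier (\<kappa> ` R) = \<kappa> ` frontier R"
    by (rule chart_frontier [OF c(1,2,3) R(2,1)])
  have fQ: "frontier R \<subseteq> Q" using R(1,2) frontier_subset_eq compact_imp_closed by blast
  have "{x \<in> circles D. imm D x \<in> \<kappa> ` R} = \<sigma> ` {l..r}"
  proof (intro equalityI subsetI)
    fix x assume x: "x \<in> {x \<in> circles D. imm D x \<in> \<kappa> ` R}"
    then have "x \<in> {x \<in> circles D. imm D x \<in> \<kappa> ` Q}" using R(2) by auto
    then obtain s where s: "s \<in> I" "x = \<sigma> s" using c(7) by auto
    then have "\<Gamma> s \<in> R"
      using x c(3) c(8,9) [OF s(1)] R(2) by (auto simp: inj_on_image_mem_iff)
    then show "x \<in> \<sigma> ` {l..r}" using s R(3) by auto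
  next
    fix x assume "x \<in> \<sigma> ` {l..r}"
    then obtain s where s: "s \<in> {l..r}" "x = \<sigma> s" by blast
    then have "s \<in> I" using lr by auto
    then show "x \<in> {x \<in> circles D. imm D x \<in> \<kappa> ` R}"
      using c(9,10) R(3) s by auto
  qed
  moreover have "imm D (\<sigma> (l + t * (r - l))) \<in> frontier (\<kappa> ` R) \<longleftrightarrow> t = 0 \<or> t = 1"
    if "t \<in> {0..1}" for t
  proof -
    define s where "s = l + t * (r - l)"
    have s: "s \<in> {l..r}" "s = l \<longleftrightarrow> t = 0" "s = r \<longleftrightarrow> t = 1"
      using reparam_bounds [OF lr(1), of t] that by (auto simp: s_def)
    then have "s \<in> I" using lr by auto
    then have "imm D (\<sigma> s) \<in> frontier (\<kappa> ` R) \<longleftrightarrow> \<Gamma> s \<in> frontier R"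
      using c(3) c(8,9) fR fQ by (simp add: inj_on_image_mem_iff)
    then show ?thesis using R(4) [OF s(1)] s(2,3) by (simp add: s_def [symmetric])
  qed
  moreover have "arc (\<lambda>t. \<sigma> (l + t * (r - l)))"
    using lr c(4,5) by (intro arc_reparam [of l r]) (auto elim: continuous_on_subset inj_on_subset)
  ultimately show ?thesis
    using lr(1) by (simp add: strands_def path_image_reparam lessThan_Suc)
qed

text \<open>The disk of the move is the image of a convex set R in the chart, which both strands enter and leave
  at the same points.  It is R1 or VR1 according to whether the crossing of the second strand is
  classical.\<close>

lemma curl_move:
  assumes D: "virtual_knot_diagram D" "virtual_knot_diagram D1"
    and sc: "strand_chart D \<kappa> Q \<sigma> I \<Gamma>0" "strand_chart D1 \<kappa> Q \<sigma> I \<Gamma>1"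
    and out: "\<And>x. x \<in> circles D \<Longrightarrow> x \<notin> \<sigma> ` I \<Longrightarrow> imm D1 x = imm D x"
      "\<And>x. x \<in> circles D \<Longrightarrow> x \<notin> \<sigma> ` I \<Longrightarrow> x \<in> over D1 \<longleftrightarrow> x \<in> over D"
    and lr: "l < r" "{l..r} \<subseteq> I" "\<And>s. s \<in> I \<Longrightarrow> s \<notin> {l<..<r} \<Longrightarrow> \<Gamma>1 s = \<Gamma>0 s"
    and R: "compact R" "convex R" "interior R \<noteq> {}" "R \<subseteq> Q"
      "\<And>s. s \<in> I \<Longrightarrow> \<Gamma>0 s \<in> R \<longleftrightarrow> s \<in> {l..r}" "\<And>s. s \<in> I \<Longrightarrow> \<Gamma>1 s \<in> R \<longleftrightarrow> s \<in> {l..r}"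
      "\<And>s. s \<in> {l..r} \<Longrightarrow> \<Gamma>0 s \<in> frontier R \<longleftrightarrow> s = l \<or> s = r"
      "\<And>s. s \<in> {l..r} \<Longrightarrow> \<Gamma>1 s \<in> frontier R \<longleftrightarrow> s = l \<or> s = r"
    and inj: "inj_on \<Gamma>0 I"
    and ab: "l < a" "a < b" "b < r" "\<Gamma>1 a = \<Gamma>1 b"
      "\<And>s t. \<lbrakk>s \<in> I; t \<in> I; s \<noteq> t; \<Gamma>1 s = \<Gamma>1 t\<rbrakk> \<Longrightarrow> (s, t) = (a, b) \<or> (s, t) = (b, a)"
  shows "R1 D D1 \<or> VR1 D D1"
proof -
  note c = strand_chartD [OF sc(1)]
  note c1 = strand_chartD [OF sc(2)]
  define p where "p = (\<lambda>(i::nat) t. \<sigma> (l + t * (r - l)))"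
  have circ: "circles D1 = circles D"
    using D by (simp add: virtual_knot_diagram_def circles_knot)
  have hom: "\<kappa> ` R homeomorphic cball (0::complex) 1"
  proof -
    have "R homeomorphic \<kappa> ` R"
      using c(2,3) R(1,4) by (intro homeomorphic_compact [of R \<kappa>]) (auto elim: continuous_on_subset inj_on_subset)
    moreover have "R homeomorphic cball (0::complex) 1"
      using R by (intro homeomorphic_convex_compact_cball) auto
    ultimately show ?thesis using homeomorphic_sym homeomorphic_trans by blast
  qed
  have st: "strands (\<kappa> ` R) 1 D p" "strands (\<kappa> ` R) 1 D1 p"
    unfolding p_def using strands_single [OF sc(1) lr(1,2) R(1,4,5,7)] strands_single [OF sc(2) lr(1,2) R(1,4,6,8)]
    by auto
  have int: "interior (\<kappa> ` R) = \<kappa> ` interior R" by (rule chart_interior [OF c(1,2,3) R(4)])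
  have same: "imm D1 x = imm D x \<and> x \<notin> \<sigma> ` {l<..<r}"
    if x: "x \<in> circles D" "imm D x \<notin> interior (\<kappa> ` R) \<or> imm D1 x \<notin> interior (\<kappa> ` R)" for x
  proof (cases "x \<in> \<sigma> ` I")
    case True
    then obtain s where s: "s \<in> I" "x = \<sigma> s" by blast
    have "s \<notin> {l<..<r}"
    proof
      assume *: "s \<in> {l<..<r}"
      then have **: "s \<in> {l..r}" "s \<noteq> l" "s \<noteq> r" by auto
      then have "\<Gamma>0 s \<in> interior R" "\<Gamma>1 s \<in> interior R"
        using R(5,6) [OF s(1)] R(7,8) [OF **(1)] by (auto simp: frontier_def closure_closed compact_imp_closed [OF R(1)])
      then show False using x(2) s c(9) c1(9) int by auto
    qed
    then have "imm D1 x = imm D x"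
      using s(2) c(9) [OF s(1)] c1(9) [OF s(1)] lr(3) [OF s(1)] by simp
    moreover have "x \<notin> \<sigma> ` {l<..<r}"
    proof
      assume "x \<in> \<sigma> ` {l<..<r}"
      then obtain t where t: "t \<in> {l<..<r}" "x = \<sigma> t" by blast
      then have "t \<in> I" using lr(2) by auto
      then have "t = s" using inj_onD [OF c(5)] s t(2) by metis
      then show False using t(1) \<open>s \<notin> {l<..<r}\<close> by simp
    qed
    ultimately show ?thesis ..
  next
    case False
    moreover have "{l<..<r} \<subseteq> I" using lr(2) by auto
    ultimately show ?thesis using out(1) [OF x(1)] by blast
  qed
  note ov0 = strand_no_over [OF D(1) sc(1) inj]
  have ov1: "s = a \<or> s = b" if s: "s \<in> I" "\<sigma> s \<in> over D1" for s
  proof -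
    obtain y where y: "double_pair D1 (\<sigma> s) y"
      using D(2) s by (auto simp: virtual_knot_diagram_def virtual_link_diagram_def)
    then have "imm D1 y = \<kappa> (\<Gamma>1 s)" "y \<in> circles D1"
      using c1(9) [OF s(1)] by (simp_all add: double_pair_def)
    then have "y \<in> {x \<in> circles D1. imm D1 x \<in> \<kappa> ` Q}"
      using c1(8) [OF s(1)] by simp
    then obtain t where t: "t \<in> I" "y = \<sigma> t" using c1(7) by auto
    then have "s \<noteq> t" "\<Gamma>1 s = \<Gamma>1 t"
      using y s c(3) c1(8,9) by (auto simp: double_pair_def inj_on_def)
    then show ?thesis using ab(5) s t by blast
  qed
  have agree: "agree_outside (\<kappa> ` R) D D1"
  proof -
    let ?S = "{x \<in> circles D. imm D x \<notin> interior (\<kappa> ` R)}"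
    have S: "{x \<in> circles D1. imm D1 x \<notin> interior (\<kappa> ` R)} = ?S"
    proof (rule Collect_cong)
      fix x show "(x \<in> circles D1 \<and> imm D1 x \<notin> interior (\<kappa> ` R)) \<longleftrightarrow>
          (x \<in> circles D \<and> imm D x \<notin> interior (\<kappa> ` R))"
      proof (cases "x \<in> circles D \<and> (imm D x \<notin> interior (\<kappa> ` R) \<or> imm D1 x \<notin> interior (\<kappa> ` R))")
        case True
        then have "imm D1 x = imm D x" using same [of x] by simp
        then show ?thesis by (simp only: circ)
      next
        case False
        then show ?thesis by (simp only: circ) blast
      qed
    qed
    have "x \<in> over D1 \<longleftrightarrow> x \<in> over D" if x: "x \<in> ?S" for x
    proof (cases "x \<in> \<sigma> ` I")
      case True
      then obtain s where s: "s \<in> I" "x = \<sigma> s" by blast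
      have "x \<notin> \<sigma> ` {l<..<r}" using same [of x] x by blast
      then have "s \<noteq> a" "s \<noteq> b" using s ab(1,2,3) by auto
      then show ?thesis using ov0 ov1 s by blast
    next
      case False then show ?thesis using out(2) x by blast
    qed
    then show ?thesis
      unfolding agree_outside_def S using same
      by (intro exI [of _ "\<lambda>x. x"]) (auto simp: homeomorphism_def)
  qed
  have lc: "local_change (\<kappa> ` R) 1 D p D1 p"
    using D st agree hom by (simp add: local_change_def virtual_knot_diagram_def)
  have \<sigma>eq: "\<sigma> s = \<sigma> t \<longleftrightarrow> s = t" if "s \<in> {l..r}" "t \<in> {l..r}" for s t
    using inj_onD [OF inj_on_subset [OF c(5) lr(2)]] that by blast
  have par: "l + t * (r - l) \<in> {l..r}" "l + t * (r - l) \<in> I" if "t \<in> {0..1}" for t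
  proof -
    show "l + t * (r - l) \<in> {l..r}" using reparam_bounds(1,2) [OF lr(1), of t] that by simp
    then show "l + t * (r - l) \<in> I" using lr(2) by blast
  qed
  have ends: "same_ends 1 D p D1 p"
  proof -
    have "l \<in> I" "r \<in> I" using lr(1,2) by auto
    then show ?thesis using c(9) c1(9) lr(3) by (simp add: same_ends_def p_def)
  qed
  have nc: "no_crossings 1 D p"
  proof -
    have "p 0 s = p 0 t" if "s \<in> {0..1}" "t \<in> {0..1}" "imm D (p 0 s) = imm D (p 0 t)" for s t
    proof -
      have I: "l + s * (r - l) \<in> I" "l + t * (r - l) \<in> I" using par that by auto
      then have "\<kappa> (\<Gamma>0 (l + s * (r - l))) = \<kappa> (\<Gamma>0 (l + t * (r - l)))"
        using that c(9) by (simp add: p_def)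
      then have "\<Gamma>0 (l + s * (r - l)) = \<Gamma>0 (l + t * (r - l))"
        using inj_onD [OF c(3)] c(8) I by blast
      then show ?thesis using inj_onD [OF inj _ I] by (simp only: p_def)
    qed
    then show ?thesis by (auto simp: no_crossings_def crossing_times_def)
  qed
  define \<alpha> where "\<alpha> = (a - l) / (r - l)"
  define \<beta> where "\<beta> = (b - l) / (r - l)"
  have \<alpha>\<beta>: "0 < \<alpha>" "\<alpha> < \<beta>" "\<beta> < 1" "l + \<alpha> * (r - l) = a" "l + \<beta> * (r - l) = b"
    using lr(1) ab(1,2,3) by (auto simp: \<alpha>_def \<beta>_def intro!: divide_strict_right_mono)
  have "crossing_times D1 (p 0) (p 0) = {(\<alpha>, \<beta>), (\<beta>, \<alpha>)}"
  proof (intro equalityI subsetI)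
    fix z assume "z \<in> crossing_times D1 (p 0) (p 0)"
    then obtain s t where z: "z = (s, t)" "s \<in> {0..1}" "t \<in> {0..1}" "p 0 s \<noteq> p 0 t"
      "imm D1 (p 0 s) = imm D1 (p 0 t)" by (auto simp: crossing_times_def)
    let ?s = "l + s * (r - l)" and ?t = "l + t * (r - l)"
    have "?s \<noteq> ?t" using z by (auto simp: p_def)
    moreover have "\<Gamma>1 ?s = \<Gamma>1 ?t"
    proof -
      have I: "?s \<in> I" "?t \<in> I" using par z by auto
      then have "\<kappa> (\<Gamma>1 ?s) = \<kappa> (\<Gamma>1 ?t)" using z c1(9) by (simp add: p_def)
      then show ?thesis using inj_onD [OF c(3)] c1(8) I by blast
    qed
    ultimately have "(?s, ?t) = (a, b) \<or> (?s, ?t) = (b, a)"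
      using ab(5) par z by blast
    then have "s * (r - l) = \<alpha> * (r - l) \<and> t * (r - l) = \<beta> * (r - l) \<or>
        s * (r - l) = \<beta> * (r - l) \<and> t * (r - l) = \<alpha> * (r - l)"
      using \<alpha>\<beta>(4,5) by (smt (verit) prod.inject)
    then show "z \<in> {(\<alpha>, \<beta>), (\<beta>, \<alpha>)}" using z lr(1) by auto
  next
    fix z assume "z \<in> {(\<alpha>, \<beta>), (\<beta>, \<alpha>)}"
    moreover have "a \<in> {l..r}" "b \<in> {l..r}" using ab by auto
    moreover have "a \<in> I" "b \<in> I" using calculation(2,3) lr(2) by blast+
    ultimately show "z \<in> crossing_times D1 (p 0) (p 0)"
      using \<alpha>\<beta> ab(2,4) \<sigma>eq c1(9) by (auto simp: crossing_times_def p_def)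
  qed
  then have "curl D1 p \<alpha> \<beta>" using \<alpha>\<beta> by (simp add: curl_def)
  then show ?thesis
    unfolding R1_def VR1_def using lc ends nc by blast
qed

section \<open>Two polygonal curls\<close>

text \<open>The curves below are to be read with the lower half plane as the disk B of an H(n)-move, and the
  vertical line as a strand through an end point 0 of it.  The first curl leaves B at 0, enters it
  again at 2 and leaves it at 1; the second one leaves B at 2, enters it at 0 and leaves it at 1.
  Outside B they have the same image, but the arc between 0 and 2 is run through in opposite
  directions.  In both cases the crossing is 1 + \<i>, and the strand is vertical near 2, so that 2 can
  play the part of 0 in the next step.\<close>

definition square :: "complex set" where
  "square = {w. \<bar>Re w\<bar> < 8 \<and> \<bar>Im w\<bar> < 8}"

definition curl1 :: "real \<Rightarrow> complex" where
  "curl1 s = (if s \<le> 1 then Complex 0 s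
    else if s \<le> 2 then Complex (2 * (s - 1)) 1
    else if s \<le> 4 then Complex 2 (3 - s)
    else if s \<le> 5 then Complex (6 - s) (s - 5)
    else if s \<le> 6 then Complex 1 (2 * (s - 5))
    else if s \<le> 7 then Complex (7 - s) (5 * s - 28)
    else Complex 0 s)"

definition curl2 :: "real \<Rightarrow> complex" where
  "curl2 s = (if s \<le> - 3 then Complex 0 s
    else if s \<le> - 1 then Complex (s + 3) s
    else if s \<le> 1 then Complex 2 s
    else if s \<le> 2 then Complex (2 * (2 - s)) 1
    else if s \<le> 4 then Complex 0 (3 - s)
    else if s \<le> 5 then Complex (s - 4) (s - 5)
    else if s \<le> 6 then Complex 1 (2 * (s - 5))
    else if s \<le> 7 then Complex (7 - s) (5 * s - 28)
    else Complex 0 s)"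

lemma open_square: "open square"
  unfolding square_def
  by (intro open_Collect_conj open_Collect_less continuous_intros)

lemma continuous_pieces:
  fixes f g :: "real \<Rightarrow> complex"
  assumes "continuous_on UNIV f" "continuous_on UNIV g" "f c = g c"
  shows "continuous_on UNIV (\<lambda>s. if s \<le> c then f s else g s)"
proof -
  have "continuous_on ({..c} \<union> {c..}) (\<lambda>s. if s \<le> c then f s else g s)"
    using assms by (intro continuous_on_cases) (auto elim: continuous_on_subset)
  moreover have "{..c} \<union> {c..} = (UNIV :: real set)" by auto
  ultimately show ?thesis by simp
qed

lemma continuous_on_Complex [continuous_intros]:
  assumes "continuous_on S f" "continuous_on S g"
  shows "continuous_on S (\<lambda>x. Complex (f x) (g x))"
  using assms unfolding Complex_eq by (intro continuous_intros)

lemma continuous_curl1: "continuous_on S curl1"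
proof -
  have "continuous_on UNIV curl1"
    unfolding curl1_def by (intro continuous_pieces continuous_intros) auto
  then show ?thesis by (rule continuous_on_subset) simp
qed

lemma continuous_curl2: "continuous_on S curl2"
proof -
  have "continuous_on UNIV curl2"
    unfolding curl2_def by (intro continuous_pieces continuous_intros) auto
  then show ?thesis by (rule continuous_on_subset) simp
qed

lemma curl1_crossing:
  assumes "curl1 s = curl1 t" "s < t"
  shows "s = 3/2 \<and> t = 11/2"
  using assms unfolding curl1_def
  by (simp split: if_splits)

lemma curl2_crossing:
  assumes "curl2 s = curl2 t" "s < t"
  shows "s = 3/2 \<and> t = 11/2"
  using assms unfolding curl2_def
  by (simp split: if_splits)

definition curl_box :: "complex set" where
  "curl_box = cbox (Complex (- 1) (- 4)) (Complex 3 (15 / 2))"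

lemma interior_curl_box: "interior curl_box = box (Complex (- 1) (- 4)) (Complex 3 (15 / 2))"
  by (simp add: curl_box_def interior_cbox)

lemma curl_box:
  "compact curl_box" "convex curl_box" "interior curl_box \<noteq> {}" "curl_box \<subseteq> square"
proof -
  have "0 \<in> interior curl_box" by (simp add: interior_curl_box in_box_complex_iff)
  then show "interior curl_box \<noteq> {}" by blast
  show "curl_box \<subseteq> square" by (auto simp: curl_box_def square_def in_cbox_complex_iff)
qed (auto simp: curl_box_def)

lemma strand_in_curl_box:
  fixes s :: real
  shows "Complex 0 s \<in> curl_box \<longleftrightarrow> s \<in> {-4..15/2}" "curl1 s \<in> curl_box \<longleftrightarrow> s \<in> {-4..15/2}"
    "curl2 s \<in> curl_box \<longleftrightarrow> s \<in> {-4..15/2}"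
  by (auto simp: curl_box_def in_cbox_complex_iff curl1_def curl2_def)

lemma strand_in_frontier_curl_box:
  fixes s :: real
  assumes "s \<in> {-4..15/2}"
  shows "Complex 0 s \<in> frontier curl_box \<longleftrightarrow> s = -4 \<or> s = 15/2"
    "curl1 s \<in> frontier curl_box \<longleftrightarrow> s = -4 \<or> s = 15/2"
    "curl2 s \<in> frontier curl_box \<longleftrightarrow> s = -4 \<or> s = 15/2"
  using assms
  by (auto simp: curl_box_def frontier_cbox in_cbox_complex_iff in_box_complex_iff curl1_def curl2_def)

lemma curls_in_square:
  assumes "s \<in> {-8<..<8}"
  shows "Complex 0 s \<in> square" "curl1 s \<in> square" "curl2 s \<in> square"
  using assms by (auto simp: square_def curl1_def curl2_def)

lemma curls_outside:
  assumes "s \<notin> {-3<..<7}"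
  shows "curl1 s = Complex 0 s" "curl2 s = Complex 0 s"
  using assms by (auto simp: curl1_def curl2_def)

lemma curls_axis:
  "\<bar>s - 3/2\<bar> < 1/2 \<Longrightarrow> Im (curl1 s) = Im (curl1 (3/2))"
  "\<bar>s - 11/2\<bar> < 1/2 \<Longrightarrow> Re (curl1 s) = Re (curl1 (11/2))"
  "\<bar>s - 3/2\<bar> < 1/2 \<Longrightarrow> Im (curl2 s) = Im (curl2 (3/2))"
  "\<bar>s - 11/2\<bar> < 1/2 \<Longrightarrow> Re (curl2 s) = Re (curl2 (11/2))"
  by (auto simp: curl1_def curl2_def abs_if split: if_splits)

lemma curls_crossing_point: "curl1 (3/2) = curl1 (11/2)" "curl2 (3/2) = curl2 (11/2)"
  by (simp_all add: curl1_def curl2_def)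

lemma curls_half_plane:
  "Im (curl1 s) \<le> 0 \<longleftrightarrow> s \<le> 0 \<or> s \<in> {3..5}" "Im (curl2 s) \<le> 0 \<longleftrightarrow> s \<le> 0 \<or> s \<in> {3..5}"
  "Im (curl1 s) = 0 \<longleftrightarrow> s = 0 \<or> s = 3 \<or> s = 5" "Im (curl2 s) = 0 \<longleftrightarrow> s = 0 \<or> s = 3 \<or> s = 5"
  by (auto simp: curl1_def curl2_def)

lemma curls_agree:
  "s \<in> {0..3} \<Longrightarrow> curl2 (3 - s) = curl1 s" "s \<ge> 5 \<Longrightarrow> curl2 s = curl1 s"
  by (auto simp: curl1_def curl2_def complex_eq_iff)

lemma curls_near_end:
  "(\<exists>w\<in>square. curl1 s = 2 + w / 16) \<longleftrightarrow> s \<in> {5/2<..<7/2}"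
  "(\<exists>w\<in>square. curl2 s = 2 + w / 16) \<longleftrightarrow> s \<in> {-1/2<..<1/2}"
proof -
  have *: "(\<exists>w\<in>square. z = 2 + w / 16) \<longleftrightarrow> \<bar>Re z - 2\<bar> < 1/2 \<and> \<bar>Im z\<bar> < 1/2" for z
  proof
    assume "\<bar>Re z - 2\<bar> < 1/2 \<and> \<bar>Im z\<bar> < 1/2"
    then show "\<exists>w\<in>square. z = 2 + w / 16"
      by (intro bexI [of _ "16 * (z - 2)"]) (auto simp: square_def complex_eq_iff abs_if field_simps split: if_splits)
  qed (auto simp: square_def)
  show "(\<exists>w\<in>square. curl1 s = 2 + w / 16) \<longleftrightarrow> s \<in> {5/2<..<7/2}"
    unfolding * by (auto simp: curl1_def abs_if split: if_splits)
  show "(\<exists>w\<in>square. curl2 s = 2 + w / 16) \<longleftrightarrow> s \<in> {-1/2<..<1/2}"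
    unfolding * by (auto simp: curl2_def abs_if split: if_splits)
qed

lemma curls_vertical:
  "s \<in> {-8<..<8} \<Longrightarrow> curl1 (3 - s / 16) = 2 + Complex 0 s / 16"
  "s \<in> {-8<..<8} \<Longrightarrow> curl2 (s / 16) = 2 + Complex 0 s / 16"
  by (auto simp: curl1_def curl2_def complex_eq_iff)

section \<open>Configurations of H(n)-moves\<close>

lemma homeomorphism_inv_into:
  assumes "homeomorphism S T f g"
  shows "homeomorphism S T f (inv_into S f)"
proof -
  have inj: "inj_on f S" by (rule inj_on_inverseI) (rule homeomorphism_apply1 [OF assms])
  have "inv_into S f y = g y" if y: "y \<in> T" for y
  proof -
    obtain x where "x \<in> S" "y = f x" using y homeomorphism_image1 [OF assms] by blast
    then show ?thesis using inj homeomorphism_apply1 [OF assms] by simp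
  qed
  then show ?thesis by (intro homeomorphism_cong [OF assms]) auto
qed

text \<open>Passing to a smaller chart in which the strand gets a simpler equation.\<close>

lemma strand_chart_rescale:
  fixes g :: "real \<Rightarrow> real"
  assumes sc: "strand_chart D \<kappa> Q \<sigma> I \<Gamma>"
    and f: "open Q'" "continuous_on Q' f" "inj_on f Q'" "f ` Q' \<subseteq> Q"
    and g: "open I'" "continuous_on I' g" "inj_on g I'" "g ` I' \<subseteq> I"
    and pre: "\<And>s. s \<in> I \<Longrightarrow> (\<exists>w\<in>Q'. \<Gamma> s = f w) \<longleftrightarrow> s \<in> g ` I'"
    and \<Gamma>': "\<And>t. t \<in> I' \<Longrightarrow> \<Gamma>' t \<in> Q'" "\<And>t. t \<in> I' \<Longrightarrow> \<Gamma> (g t) = f (\<Gamma>' t)"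
  shows "strand_chart D (\<kappa> \<circ> f) Q' (\<sigma> \<circ> g) I' \<Gamma>'"
proof -
  note c = strand_chartD [OF sc]
  have 1: "continuous_on Q' (\<kappa> \<circ> f)"
    using f(2,4) continuous_on_subset [OF c(2)] by (intro continuous_on_compose) auto
  have 2: "inj_on (\<kappa> \<circ> f) Q'"
    by (intro comp_inj_on f(3) inj_on_subset [OF c(3) f(4)])
  have 3: "homeomorphism I' ((\<sigma> \<circ> g) ` I') (\<sigma> \<circ> g) (inv_into I' (\<sigma> \<circ> g))"
  proof -
    obtain k where "homeomorphism I' (g ` I') g k"
      using invariance_of_domain_homeomorphism [OF g(1,2) _ g(3)] by auto
    moreover have "homeomorphism (g ` I') (\<sigma> ` g ` I') \<sigma> (inv_into I \<sigma>)"
      using sc g(4) unfolding strand_chart_def by (elim conjE homeomorphism_of_subsets) auto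
    ultimately have "homeomorphism I' (\<sigma> ` g ` I') (\<sigma> \<circ> g) (k \<circ> inv_into I \<sigma>)"
      by (rule homeomorphism_compose)
    then show ?thesis by (simp add: homeomorphism_inv_into image_comp)
  qed
  have 4: "{x \<in> circles D. imm D x \<in> (\<kappa> \<circ> f) ` Q'} = (\<sigma> \<circ> g) ` I'"
  proof (intro equalityI subsetI)
    fix x assume x: "x \<in> {x \<in> circles D. imm D x \<in> (\<kappa> \<circ> f) ` Q'}"
    then obtain w where w: "w \<in> Q'" "imm D x = \<kappa> (f w)" by auto
    then have "x \<in> {x \<in> circles D. imm D x \<in> \<kappa> ` Q}" using x f(4) by auto
    then obtain s where s: "s \<in> I" "x = \<sigma> s" using c(7) by auto
    have "\<kappa> (\<Gamma> s) = \<kappa> (f w)" using s c(9) w by simp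
    moreover have "\<Gamma> s \<in> Q" "f w \<in> Q" using c(8) s w f(4) by auto
    ultimately have "\<Gamma> s = f w" using inj_onD [OF c(3)] by blast
    then have "s \<in> g ` I'" using pre [OF s(1)] w by blast
    then show "x \<in> (\<sigma> \<circ> g) ` I'" using s by auto
  next
    fix x assume "x \<in> (\<sigma> \<circ> g) ` I'"
    then obtain t where t: "t \<in> I'" "x = \<sigma> (g t)" by auto
    then have "g t \<in> I" using g(4) by auto
    then show "x \<in> {x \<in> circles D. imm D x \<in> (\<kappa> \<circ> f) ` Q'}"
      using c(9,10) t \<Gamma>' by auto
  qed
  show ?thesis
    unfolding strand_chart_def using f(1) 1 2 3 4 g(4) c(9) \<Gamma>' by auto
qed

text \<open>The data of an H(n)-move between knot diagrams.  That there are no crossings in B is expressed by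
  injectivity over B, which is easier to carry along than a statement about pairs of strands.\<close>

definition H_config ::
  "nat \<Rightarrow> vdiagram \<Rightarrow> vdiagram \<Rightarrow> complex set \<Rightarrow> (nat \<Rightarrow> real \<Rightarrow> nat \<times> complex) \<Rightarrow>
     (nat \<Rightarrow> real \<Rightarrow> nat \<times> complex) \<Rightarrow> (complex \<Rightarrow> complex) \<Rightarrow> (nat \<Rightarrow> real) \<Rightarrow> bool" where
  "H_config n D D' B c c' e \<theta> \<longleftrightarrow>
     virtual_knot_diagram D \<and> virtual_knot_diagram D' \<and>
     strands B n D c \<and> strands B n D' c' \<and> agree_outside B D D' \<and>
     inj_on (imm D) {x \<in> circles D. imm D x \<in> B} \<and> inj_on (imm D') {x \<in> circles D'. imm D' x \<in> B} \<and>
     (\<exists>e'. homeomorphism (cball 0 1) B e e') \<and>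
     (\<forall>j<2*n. 0 \<le> \<theta> j \<and> \<theta> j < 2 * pi) \<and> (\<forall>j<2*n. \<forall>k<j. \<theta> k < \<theta> j) \<and>
     (\<forall>i<n. imm D (c i 0) = e (cis (\<theta> (2*i))) \<and> imm D (c i 1) = e (cis (\<theta> (2*i + 1)))) \<and>
     (\<forall>i<n. imm D' (c' i 0) = e (cis (\<theta> (2*i + 1))) \<and>
            imm D' (c' i 1) = e (cis (\<theta> ((2*i + 2) mod (2*n)))))"

text \<open>A chart around the last end point p, of index 2n-1, in which B is the lower half plane and both
  diagrams are the vertical line.  The boundary of B runs along the real axis, and \<open>\<tau>\<close> is the angle of
  its points: positive numbers lie on the boundary arc from p to the end point of index 0, where the
  two further end points of an H(n+1)-move find their place.\<close>

definition end_chart ::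
  "nat \<Rightarrow> vdiagram \<Rightarrow> vdiagram \<Rightarrow> complex set \<Rightarrow> (complex \<Rightarrow> complex) \<Rightarrow> (nat \<Rightarrow> real) \<Rightarrow>
     (complex \<Rightarrow> complex) \<Rightarrow> (real \<Rightarrow> nat \<times> complex) \<Rightarrow> (real \<Rightarrow> nat \<times> complex) \<Rightarrow> (real \<Rightarrow> real) \<Rightarrow> bool" where
  "end_chart n D D' B e \<theta> \<kappa> \<sigma> \<sigma>' \<tau> \<longleftrightarrow>
     strand_chart D \<kappa> square \<sigma> {-8<..<8} (Complex 0) \<and>
     strand_chart D' \<kappa> square \<sigma>' {-8<..<8} (Complex 0) \<and>
     (\<forall>w\<in>square. \<kappa> w \<in> B \<longleftrightarrow> Im w \<le> 0) \<and>
     (\<forall>x\<in>{0..<8}. \<kappa> (of_real x) = e (cis (\<tau> x)) \<and> \<tau> x < 2 * pi) \<and>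
     strict_mono_on {0..<8} \<tau> \<and> \<tau> 0 = \<theta> (2 * n - 1)"

lemma no_crossings_inj:
  assumes "strands B n D c" "inj_on (imm D) {x \<in> circles D. imm D x \<in> B}"
  shows "no_crossings n D c"
proof -
  have "c i s = c j t"
    if "i < n" "j < n" "s \<in> {0..1}" "t \<in> {0..1}" "imm D (c i s) = imm D (c j t)" for i j s t
  proof -
    have "c i s \<in> (\<Union>i<n. path_image (c i))" "c j t \<in> (\<Union>i<n. path_image (c i))"
      using that(1-4) unfolding path_image_def by blast+
    then have "c i s \<in> {x \<in> circles D. imm D x \<in> B}" "c j t \<in> {x \<in> circles D. imm D x \<in> B}"
      using assms(1) by (auto simp: strands_def)
    then show ?thesis using inj_onD [OF assms(2)] that(5) by blast
  qed
  then show ?thesis by (auto simp: no_crossings_def crossing_times_def)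
qed

lemma H_config_disk:
  assumes "H_config n D D' B c c' e \<theta>"
  shows "B homeomorphic cball (0::complex) 1" "compact B"
proof -
  obtain e' where e': "homeomorphism (cball 0 1) B e e'"
    using assms by (auto simp: H_config_def)
  have "homeomorphism B (cball 0 1) e' e" by (rule homeomorphism_symD [OF e'])
  then show "B homeomorphic cball (0::complex) 1" unfolding homeomorphic_def by (intro exI)
  have "compact (e ` cball 0 1)"
    using homeomorphism_cont1 [OF e'] by (intro compact_continuous_image) auto
  then show "compact B" using homeomorphism_image1 [OF e'] by simp
qed

lemma H_config_move:
  assumes "H_config n D D' B c c' e \<theta>"
  shows "H_move n D D'"
proof -
  have *: "local_change B n D c D' c'" "no_crossings n D c" "no_crossings n D' c'" "ncomp D' = ncomp D"
    using assms H_config_disk [OF assms] no_crossings_inj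
    by (auto simp: H_config_def local_change_def virtual_knot_diagram_def)
  obtain e' where "homeomorphism (cball 0 1) B e e'"
    using assms by (auto simp: H_config_def)
  with * assms show ?thesis
    unfolding H_move_def H_config_def
    by (intro conjI exI [of _ B] exI [of _ c] exI [of _ c'] exI [of _ e] exI [of _ e'] exI [of _ \<theta>]
        exI [of _ "\<lambda>j. e (cis (\<theta> j))"]) auto
qed

lemma agree_outside_sym: "agree_outside B D D' \<Longrightarrow> agree_outside B D' D"
proof -
  assume "agree_outside B D D'"
  then obtain \<phi> \<psi> where h: "homeomorphism {x \<in> circles D. imm D x \<notin> interior B}
      {x \<in> circles D'. imm D' x \<notin> interior B} \<phi> \<psi>"
    and \<phi>: "\<forall>x\<in>circles D. imm D x \<notin> interior B \<longrightarrow>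
       imm D' (\<phi> x) = imm D x \<and> (\<phi> x \<in> over D' \<longleftrightarrow> x \<in> over D)"
    unfolding agree_outside_def by blast
  have "imm D (\<psi> y) = imm D' y \<and> (\<psi> y \<in> over D \<longleftrightarrow> y \<in> over D')"
    if "y \<in> circles D'" "imm D' y \<notin> interior B" for y
  proof -
    have "\<phi> (\<psi> y) = y" using homeomorphism_apply2 [OF h] that by simp
    moreover have "\<psi> y \<in> {x \<in> circles D. imm D x \<notin> interior B}"
      using homeomorphism_image2 [OF h] that by blast
    ultimately show ?thesis using \<phi> by force
  qed
  then show "agree_outside B D' D"
    unfolding agree_outside_def using homeomorphism_symD [OF h] by blast
qed

text \<open>The end points are renumbered by one, so that the old end point 1 becomes the new end point 0; to keep
  the angles in the range from 0 to 2 pi, the unit circle is rotated accordingly.\<close>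

lemma H_config_sym:
  assumes H: "H_config n D D' B c c' e \<theta>" and n: "n \<ge> 1"
  shows "H_move n D' D"
proof -
  obtain e' where e': "homeomorphism (cball 0 1) B e e'"
    using H by (auto simp: H_config_def)
  define \<omega> where "\<omega> = \<theta> 1"
  define r where "r = (\<lambda>z. cis \<omega> * z)"
  have r: "homeomorphism (cball 0 1) (cball 0 1) r (\<lambda>z. cis (- \<omega>) * z)"
  proof (rule homeomorphismI)
    show "cis (- \<omega>) * r z = z" "r (cis (- \<omega>) * z) = z" for z
      by (simp_all add: r_def mult.assoc [symmetric] cis_mult)
  qed (auto simp: r_def norm_mult intro!: continuous_intros)
  have hom: "homeomorphism (cball 0 1) B (e \<circ> r) ((\<lambda>z. cis (- \<omega>) * z) \<circ> e')"
    by (rule homeomorphism_compose [OF r e'])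
  define \<theta>' where "\<theta>' = (\<lambda>j. if j = 2 * n - 1 then \<theta> 0 + 2 * pi - \<omega> else \<theta> (Suc j) - \<omega>)"
  define d where "d = (\<lambda>i. c (Suc i mod n))"
  have \<theta>: "0 \<le> \<theta> j" "\<theta> j < 2 * pi" "k < j \<Longrightarrow> \<theta> k < \<theta> j" if "j < 2 * n" for j k
    using H that by (auto simp: H_config_def)
  have p: "(e \<circ> r) (cis (\<theta>' j)) = e (cis (\<theta> (Suc j mod (2 * n))))" if "j < 2 * n" for j
  proof -
    have "\<omega> + \<theta>' j = \<theta> (Suc j mod (2 * n)) + (if j = 2 * n - 1 then 2 * pi else 0)"
      using that n by (auto simp: \<theta>'_def)
    then have "cis (\<omega> + \<theta>' j) = cis (\<theta> (Suc j mod (2 * n)))"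
      by (simp add: complex_eq_iff cos_add sin_add)
    then show ?thesis by (simp add: r_def cis_mult)
  qed
  have \<theta>': "0 \<le> \<theta>' j \<and> \<theta>' j < 2 * pi" "k < j \<Longrightarrow> \<theta>' k < \<theta>' j" if j: "j < 2 * n" for j k
  proof -
    have w: "\<omega> < 2 * pi" "\<theta> 0 < \<omega>" "0 \<le> \<theta> 0" "0 \<le> \<omega>" using \<theta> n by (auto simp: \<omega>_def)
    have A: "\<omega> \<le> \<theta> (Suc j)" "\<theta> (Suc j) < 2 * pi" if "j < 2 * n - 1" for j
      using \<theta>(2) [of "Suc j"] \<theta>(3) [of "Suc j" 1] that by (cases j; force simp: \<omega>_def)+
    show "0 \<le> \<theta>' j \<and> \<theta>' j < 2 * pi"     proof (cases "j = 2 * n - 1")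
      case False
      then have "j < 2 * n - 1" using j by linarith
      then show ?thesis using A [of j] w False by (simp add: \<theta>'_def)
    qed (use w in \<open>simp add: \<theta>'_def\<close>)
    assume k: "k < j"
    show "\<theta>' k < \<theta>' j"
    proof (cases "j = 2 * n - 1")
      case True
      then show ?thesis using A [of k] w j k by (auto simp: \<theta>'_def)
    next
      case False
      then have "Suc j < 2 * n" using j by linarith
      then show ?thesis using \<theta>(3) [of "Suc j" "Suc k"] k by (auto simp: \<theta>'_def)
    qed
  qed
  have D: "virtual_knot_diagram D" "virtual_knot_diagram D'" and st: "strands B n D c" "strands B n D' c'"
    and ag: "agree_outside B D D'"
    and inj: "inj_on (imm D) {x \<in> circles D. imm D x \<in> B}" "inj_on (imm D') {x \<in> circles D'. imm D' x \<in> B}"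
    using H by (auto simp: H_config_def)
  have bij: "bij_betw (\<lambda>i. Suc i mod n) {..<n} {..<n}"
  proof (rule bij_betwI [where g = "\<lambda>i. (i + n - 1) mod n"])
    show "(Suc i mod n + n - 1) mod n = i" if "i \<in> {..<n}" for i
      using that n by (cases "Suc i = n") auto
    show "Suc ((i + n - 1) mod n) mod n = i" if "i \<in> {..<n}" for i
      using that n by (cases i) (auto simp: mod_Suc)
  qed (use n in auto)
  have st': "strands B n D d"
  proof -
    have lt: "Suc i mod n < n" for i using n by simp
    have "(\<Union>i<n. path_image (d i)) = (\<Union>i\<in>(\<lambda>i. Suc i mod n) ` {..<n}. path_image (c i))"
      by (simp add: d_def)
    also have "\<dots> = (\<Union>i<n. path_image (c i))" using bij by (simp add: bij_betw_def)
    finally have U: "(\<Union>i<n. path_image (d i)) = (\<Union>i<n. path_image (c i))" .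
    have ne: "Suc i mod n \<noteq> Suc j mod n" if "i < n" "j < n" "i \<noteq> j" for i j
      using inj_onD [OF bij_betw_imp_inj_on [OF bij], of i j] that by auto
    show ?thesis
      unfolding strands_def U
    proof (intro conjI allI impI)
      show "arc (d i)" for i using st(1) lt by (simp add: strands_def d_def)
      show "path_image (d i) \<inter> path_image (d j) = {}" if "i < n" "j < n" "i \<noteq> j" for i j
        using st(1) lt ne [OF that] by (simp add: strands_def d_def)
      show "(\<Union>i<n. path_image (c i)) = {x \<in> circles D. imm D x \<in> B}"
        using st(1) by (simp add: strands_def)
    qed (use st(1) lt in \<open>simp add: strands_def d_def\<close>)
  qed
  have ends: "imm D' (c' i 0) = (e \<circ> r) (cis (\<theta>' (2 * i)))"
    "imm D' (c' i 1) = (e \<circ> r) (cis (\<theta>' (2 * i + 1)))" if "i < n" for i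
    using H that p [of "2 * i"] p [of "2 * i + 1"] by (auto simp: H_config_def)
  have ends': "imm D (d i 0) = (e \<circ> r) (cis (\<theta>' (2 * i + 1)))"
    "imm D (d i 1) = (e \<circ> r) (cis (\<theta>' ((2 * i + 2) mod (2 * n))))" if "i < n" for i
  proof -
    have lt: "Suc i mod n < n" using n by simp
    have m: "(2 * i + 2) mod (2 * n) = 2 * (Suc i mod n)" by (simp add: mult_mod_right)
    have "2 * (Suc i mod n) + 1 < 2 * n" using lt by simp
    then have m': "Suc (2 * (Suc i mod n)) mod (2 * n) = 2 * (Suc i mod n) + 1" by simp
    show "imm D (d i 0) = (e \<circ> r) (cis (\<theta>' (2 * i + 1)))"
      using H lt p [of "2 * i + 1"] that m by (auto simp: H_config_def d_def)
    show "imm D (d i 1) = (e \<circ> r) (cis (\<theta>' ((2 * i + 2) mod (2 * n))))"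
      using H lt p [of "2 * (Suc i mod n)"] m m' by (auto simp: H_config_def d_def)
  qed
  have "H_config n D' D B c' d (e \<circ> r) \<theta>'"
    unfolding H_config_def
    using D st(2) st' agree_outside_sym [OF ag] inj hom \<theta>' ends ends' by blast
  then show ?thesis by (rule H_config_move)
qed

section \<open>From H(n) to H(n+1)\<close>

abbreviation span :: "real set" where "span \<equiv> {-8<..<8}"

text \<open>The box and the crossing parameters 3/2 and 11/2 serve both curls.\<close>

lemma add_curl:
  assumes D: "virtual_knot_diagram D" and sc: "strand_chart D \<kappa> square \<sigma> span (Complex 0)"
    and \<Gamma>: "\<Gamma> = curl1 \<or> \<Gamma> = curl2"
    and D1: "D1 = replace_strand D \<kappa> \<sigma> span \<Gamma>"
  shows "virtual_knot_diagram D1" "strand_chart D1 \<kappa> square \<sigma> span \<Gamma>" "R1 D D1 \<or> VR1 D D1"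
    "over D1 = over D"
proof -
  note c = strand_chartD [OF sc]
  have cont: "continuous_on span \<Gamma>" using \<Gamma> continuous_curl1 continuous_curl2 by auto
  have im: "\<Gamma> ` span \<subseteq> square" using \<Gamma> curls_in_square by auto
  have out: "\<Gamma> s = Complex 0 s" if "s \<notin> {-4<..<15/2}" for s
    using \<Gamma> curls_outside [of s] that by auto
  have cross: "(s, t) = (3/2, 11/2) \<or> (s, t) = (11/2, 3/2)" if "s \<noteq> t" "\<Gamma> s = \<Gamma> t" for s t
    using curl1_crossing [of s t] curl1_crossing [of t s] curl2_crossing [of s t] curl2_crossing [of t s] \<Gamma> that
    by (metis linorder_neqE)
  have pt: "\<Gamma> (3/2) = \<Gamma> (11/2)" using \<Gamma> curls_crossing_point by auto
  have axis: "\<exists>\<epsilon>>0. (\<forall>s. \<bar>s - 3/2\<bar> < \<epsilon> \<longrightarrow> Im (\<Gamma> s) = Im (\<Gamma> (3/2))) \<and>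
      (\<forall>s. \<bar>s - 11/2\<bar> < \<epsilon> \<longrightarrow> Re (\<Gamma> s) = Re (\<Gamma> (11/2)))"
    using \<Gamma> curls_axis by (intro exI [of _ "1/2"]) auto
  have "virtual_knot_diagram D1 \<and> strand_chart D1 \<kappa> square \<sigma> span \<Gamma>"
    unfolding D1
    by (rule replace_strand_diagram [OF D sc _ _ cont im, where l = "-4" and r = "15/2" and a = "3/2" and b = "11/2"])
      (use out cross axis in auto)
  then show 1: "virtual_knot_diagram D1" "strand_chart D1 \<kappa> square \<sigma> span \<Gamma>" by auto
  have inj0: "inj_on (Complex 0) span" by (auto simp: inj_on_def)
  show ov: "over D1 = over D"
    using strand_no_over [OF D sc inj0] by (auto simp: D1 replace_strand_simps)
  show "R1 D D1 \<or> VR1 D D1"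
  proof (rule curl_move [OF D 1(1) sc 1(2), where R = curl_box and l = "-4" and r = "15/2" and a = "3/2" and b = "11/2"])
    show "imm D1 x = imm D x" if "x \<notin> \<sigma> ` span" for x
      using that by (simp add: D1 replace_strand_simps)
    show "\<Gamma> s \<in> curl_box \<longleftrightarrow> s \<in> {-4..15/2}" for s
      using strand_in_curl_box [of s] \<Gamma> by auto
    show "\<Gamma> s \<in> frontier curl_box \<longleftrightarrow> s = -4 \<or> s = 15/2" if "s \<in> {-4..15/2}" for s
      using strand_in_frontier_curl_box [OF that] \<Gamma> by auto
  qed (use ov out curl_box strand_in_curl_box(1) strand_in_frontier_curl_box(1) inj0 cross pt in auto)
qed

lemma half_plane_chart:
  fixes \<kappa> :: "complex \<Rightarrow> complex"
  assumes \<kappa>: "continuous_on square \<kappa>" "inj_on \<kappa> square" and "closed B"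
    and B: "\<And>w. w \<in> square \<Longrightarrow> \<kappa> w \<in> B \<longleftrightarrow> Im w \<le> 0" and w: "w \<in> square"
  shows "\<kappa> w \<in> interior B \<longleftrightarrow> Im w < 0" "\<kappa> w \<in> frontier B \<longleftrightarrow> Im w = 0"
proof -
  have "\<kappa> w \<in> interior B" if "Im w < 0"
  proof (rule interiorI)
    have "open {w \<in> square. Im w < 0}"
      using open_Int [OF open_square open_halfspace_Im_lt [of 0]] by (simp add: Int_def)
    then show "open (\<kappa> ` {w \<in> square. Im w < 0})"
      by (intro chart_open [OF \<kappa>]) auto
  qed (use B w that in auto)
  moreover have "Im w < 0" if *: "\<kappa> w \<in> interior B"
  proof -
    have le: "Im w \<le> 0" using * interior_subset B [OF w] by blast
    have "open (square \<inter> \<kappa> -` interior B)"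
      by (intro continuous_open_preimage \<kappa> open_square open_interior)
    then obtain \<epsilon> where \<epsilon>: "\<epsilon> > 0" "cball w \<epsilon> \<subseteq> square \<inter> \<kappa> -` interior B"
      using * w open_contains_cball by (metis IntI vimageI)
    have "w + \<epsilon> * \<i> \<in> cball w \<epsilon>" using \<epsilon> by (simp add: dist_norm norm_mult)
    then have "w + \<epsilon> * \<i> \<in> square" "\<kappa> (w + \<epsilon> * \<i>) \<in> B"
      using \<epsilon> interior_subset [of B] by auto
    then have "Im w + \<epsilon> \<le> 0" using B by fastforce
    then show ?thesis using \<epsilon> by simp
  qed
  ultimately show 1: "\<kappa> w \<in> interior B \<longleftrightarrow> Im w < 0" by blast
  show "\<kappa> w \<in> frontier B \<longleftrightarrow> Im w = 0"
    using 1 B [OF w] \<open>closed B\<close> by (auto simp: frontier_def closure_closed)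
qed

text \<open>Inside B the curl adds one strand, with the parameters from 3 to 5.  The old strands keep their
  parameters, even where the second curl moves their image.\<close>

lemma curl_in_disk:
  assumes D: "virtual_knot_diagram D" and sc: "strand_chart D \<kappa> square \<sigma> span (Complex 0)"
    and \<Gamma>: "\<Gamma> = curl1 \<or> \<Gamma> = curl2"
    and D1: "D1 = replace_strand D \<kappa> \<sigma> span \<Gamma>"
    and "closed B" and B: "\<And>w. w \<in> square \<Longrightarrow> \<kappa> w \<in> B \<longleftrightarrow> Im w \<le> 0"
    and inj: "inj_on (imm D) {x \<in> circles D. imm D x \<in> B}"
  shows "{x \<in> circles D1. imm D1 x \<in> B} = {x \<in> circles D. imm D x \<in> B} \<union> \<sigma> ` {3..5}"
    "{x \<in> circles D. imm D x \<in> B} \<inter> \<sigma> ` {3..5} = {}"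
    "inj_on (imm D1) {x \<in> circles D1. imm D1 x \<in> B}"
    "\<And>x. x \<in> circles D \<Longrightarrow> imm D x \<in> B \<Longrightarrow> imm D1 x \<in> frontier B \<longleftrightarrow> imm D x \<in> frontier B"
    "\<And>s. s \<in> {3..5} \<Longrightarrow> imm D1 (\<sigma> s) \<in> frontier B \<longleftrightarrow> s = 3 \<or> s = 5"
proof -
  note c = strand_chartD [OF sc]
  note c1 = strand_chartD [OF add_curl(2) [OF D sc \<Gamma> D1]]
  have hp: "\<kappa> w \<in> frontier B \<longleftrightarrow> Im w = 0" if "w \<in> square" for w
    by (rule half_plane_chart(2) [OF c(2,3) \<open>closed B\<close> _ that]) (rule B)
  have circ: "circles D1 = circles D" and out: "\<And>x. x \<notin> \<sigma> ` span \<Longrightarrow> imm D1 x = imm D x"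
    by (simp_all add: D1 replace_strand_simps)
  have ImG: "Im (\<Gamma> s) \<le> 0 \<longleftrightarrow> s \<le> 0 \<or> s \<in> {3..5}" "Im (\<Gamma> s) = 0 \<longleftrightarrow> s = 0 \<or> s = 3 \<or> s = 5" for s
    using \<Gamma> curls_half_plane [of s] by auto
  have inB: "imm D (\<sigma> s) \<in> B \<longleftrightarrow> s \<le> 0" "imm D1 (\<sigma> s) \<in> B \<longleftrightarrow> s \<le> 0 \<or> s \<in> {3..5}" if "s \<in> span" for s
    using c(8,9) [OF that] c1(8,9) [OF that] B ImG by auto
  have sub: "{3..5} \<subseteq> span" by auto
  have mem: "x \<in> circles D1 \<and> imm D1 x \<in> B \<longleftrightarrow> x \<in> circles D \<and> imm D x \<in> B \<or> x \<in> \<sigma> ` {3..5}" for x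
  proof (cases "x \<in> \<sigma> ` span")
    case True
    then obtain s where s: "s \<in> span" "x = \<sigma> s" by blast
    have "\<sigma> s \<in> \<sigma> ` {3..5} \<longleftrightarrow> s \<in> {3..5}"
      using inj_on_image_mem_iff [OF c(5) s(1) sub] .
    then show ?thesis using inB [OF s(1)] s c(10) circ by auto
  next
    case False
    then have "x \<notin> \<sigma> ` {3..5}" using sub by blast
    with False show ?thesis using out circ by auto
  qed
  show *: "{x \<in> circles D1. imm D1 x \<in> B} = {x \<in> circles D. imm D x \<in> B} \<union> \<sigma> ` {3..5}"
    using mem by auto
  show "{x \<in> circles D. imm D x \<in> B} \<inter> \<sigma> ` {3..5} = {}"
  proof -
    have "imm D (\<sigma> s) \<notin> B" if "s \<in> {3..5}" for s
      using inB(1) [of s] that by auto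
    then show ?thesis by auto
  qed
  show "imm D1 x \<in> frontier B \<longleftrightarrow> imm D x \<in> frontier B" if x: "x \<in> circles D" "imm D x \<in> B" for x
  proof (cases "x \<in> \<sigma> ` span")
    case True
    then obtain s where s: "s \<in> span" "x = \<sigma> s" by blast
    then have "s \<le> 0" using inB x by auto
    then show ?thesis
      using s c(9) [OF s(1)] c1(9) [OF s(1)] hp [OF c(8) [OF s(1)]] hp [OF c1(8) [OF s(1)]] ImG [of s]
      by auto
  qed (use out in simp)
  show "imm D1 (\<sigma> s) \<in> frontier B \<longleftrightarrow> s = 3 \<or> s = 5" if "s \<in> {3..5}" for s
  proof -
    have "s \<in> span" using that by auto
    then show ?thesis
      using c1(9) [of s] hp [OF c1(8) [of s]] ImG [of s] that by auto
  qed
  show "inj_on (imm D1) {x \<in> circles D1. imm D1 x \<in> B}"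
  proof (rule inj_onI)
    fix x y assume x: "x \<in> {x \<in> circles D1. imm D1 x \<in> B}" and y: "y \<in> {x \<in> circles D1. imm D1 x \<in> B}"
      and eq: "imm D1 x = imm D1 y"
    have iff: "z \<in> \<sigma> ` span \<longleftrightarrow> imm D1 z \<in> \<kappa> ` square" if "z \<in> circles D1" for z
      using c1(7) that by blast
    show "x = y"
    proof (cases "x \<in> \<sigma> ` span")
      case True
      then have "y \<in> \<sigma> ` span" using iff [of x] iff [of y] x y eq by simp
      then obtain s t where st: "s \<in> span" "x = \<sigma> s" "t \<in> span" "y = \<sigma> t" using True by blast
      have "\<kappa> (\<Gamma> s) = \<kappa> (\<Gamma> t)" using eq st c1(9) by simp
      then have "\<Gamma> s = \<Gamma> t" using inj_onD [OF c(3)] c1(8) st by blast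
      moreover have "s \<le> 0 \<or> s \<in> {3..5}" "t \<le> 0 \<or> t \<in> {3..5}"
        using inB(2) [OF st(1)] inB(2) [OF st(3)] x y st by auto
      moreover have False if "u < v" "\<Gamma> u = \<Gamma> v" "u \<le> 0 \<or> u \<in> {3..5}" for u v
      proof -
        have "u = 3/2" using curl1_crossing [of u v] curl2_crossing [of u v] \<Gamma> that(1,2) by auto
        then show False using that(3) by auto
      qed
      ultimately have "s = t" by (metis linorder_neqE)
      then show ?thesis using st by simp
    next
      case False
      then have "y \<notin> \<sigma> ` span" using iff [of x] iff [of y] x y eq by simp
      with False have "imm D x = imm D y" "x \<in> {x \<in> circles D. imm D x \<in> B}" "y \<in> {x \<in> circles D. imm D x \<in> B}"
        using x y eq out [OF False] out [OF \<open>y \<notin> \<sigma> ` span\<close>] circ by simp_all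
      then show ?thesis using inj_onD [OF inj] by blast
    qed
  qed
qed

text \<open>The new strand g gets the number k, and the later ones move up by one.\<close>

lemma strands_insert:
  assumes st: "strands B n D c" and k: "k \<le> n"
    and pre: "{x \<in> circles D1. imm D1 x \<in> B} = {x \<in> circles D. imm D x \<in> B} \<union> path_image g"
    and disj: "{x \<in> circles D. imm D x \<in> B} \<inter> path_image g = {}"
    and fr: "\<And>x. x \<in> circles D \<Longrightarrow> imm D x \<in> B \<Longrightarrow> imm D1 x \<in> frontier B \<longleftrightarrow> imm D x \<in> frontier B"
    and g: "arc g" "\<And>t. t \<in> {0..1} \<Longrightarrow> imm D1 (g t) \<in> frontier B \<longleftrightarrow> t = 0 \<or> t = 1"
  shows "strands B (Suc n) D1 (\<lambda>i. if i < k then c i else if i = k then g else c (i - 1))"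
proof -
  define d where "d = (\<lambda>i. if i < k then c i else if i = k then g else c (i - 1))"
  have U: "(\<Union>i<n. path_image (c i)) = {x \<in> circles D. imm D x \<in> B}"
    and arc: "\<And>i. i < n \<Longrightarrow> arc (c i)"
    and dis: "\<And>i j. i < n \<Longrightarrow> j < n \<Longrightarrow> i \<noteq> j \<Longrightarrow> path_image (c i) \<inter> path_image (c j) = {}"
    and frc: "\<And>i t. i < n \<Longrightarrow> t \<in> {0..1} \<Longrightarrow> imm D (c i t) \<in> frontier B \<longleftrightarrow> t = 0 \<or> t = 1"
    using st by (auto simp: strands_def)
  define f where "f = (\<lambda>i. if i < k then i else i - 1)"
  have d: "d i = (if i = k then g else c (f i))" for i by (auto simp: d_def f_def)
  have fn: "f i < n" if "i < Suc n" "i \<noteq> k" for i using that k by (auto simp: f_def)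
  have finj: "f i \<noteq> f j" if "i \<noteq> j" "i \<noteq> k" "j \<noteq> k" for i j using that by (auto simp: f_def)
  have fsur: "\<exists>j<Suc n. j \<noteq> k \<and> f j = i" if "i < n" for i
    using that by (intro exI [of _ "if i < k then i else Suc i"]) (auto simp: f_def)
  have cg: "path_image (c i) \<inter> path_image g = {}" if "i < n" for i using that U disj by blast
  have UN: "(\<Union>i<Suc n. path_image (d i)) = (\<Union>i<n. path_image (c i)) \<union> path_image g"
  proof (intro equalityI subsetI)
    fix x assume "x \<in> (\<Union>i<n. path_image (c i)) \<union> path_image g"
    then consider i where "i < n" "x \<in> path_image (c i)" | "x \<in> path_image g" by blast
    then show "x \<in> (\<Union>i<Suc n. path_image (d i))"
    proof cases
      case 1
      then obtain j where "j < Suc n" "j \<noteq> k" "f j = i" using fsur by blast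
      then show ?thesis using 1 d by (intro UN_I [of j]) auto
    next
      case 2
      then show ?thesis using k d by (intro UN_I [of k]) auto
    qed
  qed (use d fn in \<open>auto split: if_splits\<close>)
  have "strands B (Suc n) D1 d"
    unfolding strands_def
  proof (intro conjI allI impI ballI)
    show "arc (d i)" if "i < Suc n" for i using d g(1) arc fn that by simp
    show "path_image (d i) \<inter> path_image (d j) = {}" if "i < Suc n" "j < Suc n" "i \<noteq> j" for i j
    proof (cases "i = k \<or> j = k")
      case True
      then show ?thesis using that cg [OF fn [OF that(1)]] cg [OF fn [OF that(2)]] d by auto
    next
      case False
      then have "i \<noteq> k" "j \<noteq> k" by auto
      then show ?thesis using dis [OF fn fn finj] that d by simp
    qed
    show "(\<Union>i<Suc n. path_image (d i)) = {x \<in> circles D1. imm D1 x \<in> B}"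
      using UN U pre by simp
    show "imm D1 (d i t) \<in> frontier B \<longleftrightarrow> t = 0 \<or> t = 1" if "i < Suc n" "t \<in> {0..1}" for i t
    proof (cases "i = k")
      case True then show ?thesis using g(2) [OF that(2)] d by simp
    next
      case False
      then have "c (f i) t \<in> (\<Union>i<n. path_image (c i))"
        using fn [OF that(1)] that(2) unfolding path_image_def by blast
      then have "c (f i) t \<in> circles D" "imm D (c (f i) t) \<in> B" using U by auto
      then show ?thesis using False d fr frc [OF fn [OF that(1) False] that(2)] by simp
    qed
  qed
  then show ?thesis by (simp add: d_def)
qed

text \<open>The homeomorphism between the outer parts is the old one, except that it reverses the arc with the
  parameters from 0 to 3, on which the two curls run in opposite directions.\<close>

lemma curl_agree_outside:
  assumes D: "virtual_knot_diagram D" "virtual_knot_diagram D'"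
    and sc: "strand_chart D \<kappa> square \<sigma> span (Complex 0)" "strand_chart D' \<kappa> square \<sigma>' span (Complex 0)"
    and D1: "D1 = replace_strand D \<kappa> \<sigma> span curl1" "D1' = replace_strand D' \<kappa> \<sigma>' span curl2"
    and "closed B" and B: "\<And>w. w \<in> square \<Longrightarrow> \<kappa> w \<in> B \<longleftrightarrow> Im w \<le> 0"
    and ag: "agree_outside B D D'"
  shows "agree_outside B D1 D1'"
proof -
  note c = strand_chartD [OF sc(1)]
  note c' = strand_chartD [OF sc(2)]
  note a = add_curl [OF D(1) sc(1) disjI1 [OF refl] D1(1)]
  note a' = add_curl [OF D(2) sc(2) disjI2 [OF refl] D1(2)]
  note c1 = strand_chartD [OF a(2)]
  note c1' = strand_chartD [OF a'(2)]
  have hp: "\<kappa> w \<in> interior B \<longleftrightarrow> Im w < 0" if "w \<in> square" for w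
    by (rule half_plane_chart(1) [OF c(2,3) \<open>closed B\<close> _ that]) (rule B)
  have circ: "circles D1 = circles D" "circles D1' = circles D'"
    and out: "\<And>x. x \<notin> \<sigma> ` span \<Longrightarrow> imm D1 x = imm D x" "\<And>x. x \<notin> \<sigma>' ` span \<Longrightarrow> imm D1' x = imm D' x"
    by (simp_all add: D1 replace_strand_simps)
  obtain \<phi> \<psi> where h: "homeomorphism {x \<in> circles D. imm D x \<notin> interior B}
      {x \<in> circles D'. imm D' x \<notin> interior B} \<phi> \<psi>"
    and \<phi>: "\<And>x. x \<in> circles D \<Longrightarrow> imm D x \<notin> interior B \<Longrightarrow>
       imm D' (\<phi> x) = imm D x \<and> (\<phi> x \<in> over D' \<longleftrightarrow> x \<in> over D)"
    using ag unfolding agree_outside_def by blast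
  define P where "P = {x \<in> circles D. imm D x \<notin> interior B}"
  define P' where "P' = {x \<in> circles D'. imm D' x \<notin> interior B}"
  define P1 where "P1 = {x \<in> circles D1. imm D1 x \<notin> interior B}"
  define P1' where "P1' = {x \<in> circles D1'. imm D1' x \<notin> interior B}"
  have h: "homeomorphism P P' \<phi> \<psi>" using h by (simp add: P_def P'_def)
  have inO: "\<sigma> s \<in> P \<longleftrightarrow> s \<ge> 0" "\<sigma>' s \<in> P' \<longleftrightarrow> s \<ge> 0" if "s \<in> span" for s
    using c(8,9,10) [OF that] c'(8,9,10) [OF that] hp by (auto simp: P_def P'_def)
  have G: "Im (curl1 s) \<ge> 0 \<longleftrightarrow> s \<in> {0..3} \<or> s \<ge> 5" "Im (curl2 s) \<ge> 0 \<longleftrightarrow> s \<in> {0..3} \<or> s \<ge> 5" for s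
    using curls_half_plane [of s] by fastforce+
  have inO1: "\<sigma> s \<in> P1 \<longleftrightarrow> s \<in> {0..3} \<or> s \<ge> 5" "\<sigma>' s \<in> P1' \<longleftrightarrow> s \<in> {0..3} \<or> s \<ge> 5" if "s \<in> span" for s
    using c1(8,9,10) [OF that] c1'(8,9,10) [OF that] hp G [of s] by (auto simp: P1_def P1'_def)
  have \<phi>\<sigma>: "\<phi> (\<sigma> s) = \<sigma>' s" if s: "s \<in> span" "s \<ge> 0" for s
  proof -
    have P: "\<sigma> s \<in> P" using inO s by simp
    then have "\<phi> (\<sigma> s) \<in> P'" using homeomorphism_image1 [OF h] by blast
    moreover have im: "imm D' (\<phi> (\<sigma> s)) = \<kappa> (Complex 0 s)" using \<phi> P c(9) [OF s(1)] by (simp add: P_def)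
    ultimately have "\<phi> (\<sigma> s) \<in> {x \<in> circles D'. imm D' x \<in> \<kappa> ` square}"
      using c(8) [OF s(1)] by (simp add: P'_def)
    then obtain t where t: "t \<in> span" "\<phi> (\<sigma> s) = \<sigma>' t" using c'(7) by auto
    then have "\<kappa> (Complex 0 t) = \<kappa> (Complex 0 s)" using im c'(9) by simp
    then have "Complex 0 t = Complex 0 s" using inj_onD [OF c(3)] c(8) s(1) t(1) by blast
    then show ?thesis using t by simp
  qed
  have \<phi>out: "\<phi> x \<in> \<sigma>' ` span \<longleftrightarrow> x \<in> \<sigma> ` span" if x: "x \<in> P" for x
  proof -
    have "\<phi> x \<in> P'" "imm D' (\<phi> x) = imm D x"
      using \<phi> x homeomorphism_image1 [OF h] by (auto simp: P_def)
    then have "x \<in> {x \<in> circles D. imm D x \<in> \<kappa> ` square} \<longleftrightarrow> \<phi> x \<in> {x \<in> circles D'. imm D' x \<in> \<kappa> ` square}"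
      using x by (simp add: P_def P'_def)
    then show ?thesis using c(7) c'(7) by simp
  qed
  define J where "J = \<sigma> ` {-8<..<5}"
  define J' where "J' = \<sigma>' ` {-8<..<5}"
  define L where "L = \<sigma> ` {0..3}"
  have sub: "{0..3} \<subseteq> span" "{-8<..<5} \<subseteq> span" by auto
  have memJ: "\<sigma> s \<in> J \<longleftrightarrow> s < 5" "\<sigma>' s \<in> J' \<longleftrightarrow> s < 5" "\<sigma> s \<in> L \<longleftrightarrow> s \<in> {0..3}"
    "\<sigma>' s \<in> \<sigma>' ` {0..3} \<longleftrightarrow> s \<in> {0..3}" if "s \<in> span" for s
    using inj_on_image_mem_iff [OF c(5) that sub(2)] inj_on_image_mem_iff [OF c'(5) that sub(2)]
      inj_on_image_mem_iff [OF c(5) that sub(1)] inj_on_image_mem_iff [OF c'(5) that sub(1)] that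
    by (auto simp: J_def J'_def L_def)
  have JI: "J \<subseteq> \<sigma> ` span" "J' \<subseteq> \<sigma>' ` span" "L \<subseteq> J" "\<sigma>' ` {0..3} \<subseteq> J'"
    using sub by (auto simp: J_def J'_def L_def)
  have split: "P1 = L \<union> (P - J)" "P1' = \<sigma>' ` {0..3} \<union> (P' - J')"
  proof -
    have "x \<in> P1 \<longleftrightarrow> x \<in> L \<union> (P - J)" for x
    proof (cases "x \<in> \<sigma> ` span")
      case True
      then obtain s where s: "s \<in> span" "x = \<sigma> s" by blast
      then show ?thesis using inO1(1) [OF s(1)] inO(1) [OF s(1)] memJ(1,3) [OF s(1)] by auto
    next
      case False
      then show ?thesis using JI out(1) [OF False] circ by (auto simp: P1_def P_def)
    qed
    then show "P1 = L \<union> (P - J)" by blast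
    have "x \<in> P1' \<longleftrightarrow> x \<in> \<sigma>' ` {0..3} \<union> (P' - J')" for x
    proof (cases "x \<in> \<sigma>' ` span")
      case True
      then obtain s where s: "s \<in> span" "x = \<sigma>' s" by blast
      then show ?thesis using inO1(2) [OF s(1)] inO(2) [OF s(1)] memJ(2,4) [OF s(1)] by auto
    next
      case False
      then show ?thesis using JI out(2) [OF False] circ by (auto simp: P1'_def P'_def)
    qed
    then show "P1' = \<sigma>' ` {0..3} \<union> (P' - J')" by blast
  qed
  define \<phi>1 where "\<phi>1 = (\<lambda>x. if x \<in> L then \<sigma>' (3 - inv_into span \<sigma> x) else \<phi> x)"
  have \<phi>1L: "\<phi>1 (\<sigma> s) = \<sigma>' (3 - s)" if "s \<in> {0..3}" for s
  proof -
    have "s \<in> span" "\<sigma> s \<in> L" using that sub by (auto simp: L_def)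
    then show ?thesis using c(5) by (simp add: \<phi>1_def)
  qed
  have \<phi>1O: "\<phi>1 x = \<phi> x" if "x \<in> P - J" for x using that JI by (auto simp: \<phi>1_def)
  have immcont: "continuous_on (circles D1) (imm D1)"
    using a(1) by (simp add: virtual_knot_diagram_def virtual_link_diagram_def immersed_def)
  have immcontD: "continuous_on (circles D) (imm D)"
    using D(1) by (simp add: virtual_knot_diagram_def virtual_link_diagram_def immersed_def)
  have cO1: "compact P1" 
  proof -
    have "closedin (top_of_set (circles D1)) (circles D1 \<inter> imm D1 -` (- interior B))"
      by (intro continuous_closedin_preimage immcont) auto
    moreover have "circles D1 \<inter> imm D1 -` (- interior B) = P1" by (auto simp: P1_def)
    ultimately show ?thesis using closedin_compact [OF compact_circles] by metis
  qed
  have cOJ: "compact (P - J)"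
  proof -
    have "closedin (top_of_set (circles D)) (circles D \<inter> imm D -` (- interior B))"
      by (intro continuous_closedin_preimage immcontD) auto
    moreover have "circles D \<inter> imm D -` (- interior B) = P" by (auto simp: P_def)
    moreover have "openin (top_of_set (circles D)) J"
      unfolding J_def by (rule strand_chart_open [OF sc(1) immcontD]) auto
    ultimately have "closedin (top_of_set (circles D)) (P - J)" by (simp add: closedin_diff)
    then show ?thesis using closedin_compact [OF compact_circles] by blast
  qed
  have cL: "compact L"
    unfolding L_def by (intro compact_continuous_image continuous_on_subset [OF c(4) sub(1)]) auto
  have cont: "continuous_on P1 \<phi>1"
    unfolding split(1)
  proof (rule continuous_on_closed_Un)
    have "continuous_on L (\<lambda>x. \<sigma>' (3 - inv_into span \<sigma> x))"
    proof (rule continuous_on_compose2 [OF c'(4)])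
      show "continuous_on L (\<lambda>x. 3 - inv_into span \<sigma> x)"
        using continuous_on_subset [OF c(6), of L] sub by (auto simp: L_def intro!: continuous_intros)
      show "(\<lambda>x. 3 - inv_into span \<sigma> x) ` L \<subseteq> span"
        using c(5) sub by (auto simp: L_def subset_iff)
    qed
    then show "continuous_on L \<phi>1" by (elim continuous_on_eq) (simp add: \<phi>1_def)
    show "continuous_on (P - J) \<phi>1"
      using \<phi>1O by (intro continuous_on_eq [OF continuous_on_subset [OF homeomorphism_cont1 [OF h]], of "P - J" \<phi>1]) auto
  qed (use cL cOJ compact_imp_closed in auto)
  have \<phi>J: "\<phi> x \<in> P' - J'" if x: "x \<in> P - J" for x
  proof -
    have "\<phi> x \<in> P'" using x homeomorphism_image1 [OF h] by blast
    moreover have "\<phi> x \<notin> J'"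
    proof (cases "x \<in> \<sigma> ` span")
      case True
      then obtain s where s: "s \<in> span" "x = \<sigma> s" by blast
      then have "\<not> s < 5" using memJ(1) [OF s(1)] x by auto
      then show ?thesis using \<phi>\<sigma> s memJ(2) [OF s(1)] by auto
    next
      case False
      then have "\<phi> x \<notin> \<sigma>' ` span" using \<phi>out [of x] x by simp
      then show ?thesis using JI(2) by blast
    qed
    ultimately show ?thesis by blast
  qed
  have img: "\<phi>1 ` P1 = P1'"
  proof (intro equalityI subsetI)
    fix y assume "y \<in> \<phi>1 ` P1"
    then consider s where "s \<in> {0..3}" "y = \<phi>1 (\<sigma> s)" | x where "x \<in> P - J" "y = \<phi>1 x"
      using split(1) unfolding L_def by blast
    then show "y \<in> P1'"
    proof cases
      case 1
      then show ?thesis using \<phi>1L split(2) by auto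
    next
      case 2
      then show ?thesis using \<phi>1O \<phi>J split(2) by auto
    qed
  next
    fix y assume "y \<in> P1'"
    then consider s where "s \<in> {0..3}" "y = \<sigma>' s" | "y \<in> P' - J'" using split(2) by blast
    then show "y \<in> \<phi>1 ` P1"
    proof cases
      case 1
      then have "y = \<phi>1 (\<sigma> (3 - s))" "\<sigma> (3 - s) \<in> P1" using \<phi>1L [of "3 - s"] split(1) by (auto simp: L_def)
      then show ?thesis by blast
    next
      case 2
      then obtain x where x: "x \<in> P" "y = \<phi> x" using homeomorphism_image1 [OF h] by blast
      have "x \<notin> J"
      proof
        assume "x \<in> J"
        then obtain s where s: "s \<in> {-8<..<5}" "x = \<sigma> s" by (auto simp: J_def)
        then have sp: "s \<in> span" by auto
        then have "s \<ge> 0" using inO(1) x s by auto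
        then have "y \<in> J'" using \<phi>\<sigma> sp s x memJ(2) [OF sp] by auto
        then show False using 2 by blast
      qed
      then have "y = \<phi>1 x" "x \<in> P1" using x \<phi>1O [of x] split(1) by simp_all
      then show ?thesis by blast
    qed
  qed
  have \<phi>inj: "inj_on \<phi> P"
    by (rule inj_on_inverseI) (rule homeomorphism_apply1 [OF h])
  have inj: "inj_on \<phi>1 P1"
    unfolding split(1)
  proof (subst inj_on_Un, intro conjI)
    show "inj_on \<phi>1 L"
    proof (rule inj_onI)
      fix x y assume "x \<in> L" "y \<in> L" and eq: "\<phi>1 x = \<phi>1 y"
      then obtain s t where st: "s \<in> {0..3}" "x = \<sigma> s" "t \<in> {0..3}" "y = \<sigma> t" by (auto simp: L_def)
      then have "\<sigma>' (3 - s) = \<sigma>' (3 - t)" using eq \<phi>1L by simp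
      then have "3 - s = 3 - t" by (rule inj_onD [OF c'(5)]) (use st in auto)
      then show "x = y" using st by simp
    qed
    show "inj_on \<phi>1 (P - J)"
      using inj_on_subset [OF \<phi>inj, of "P - J"] \<phi>1O by (subst inj_on_cong [of _ \<phi>1 \<phi>]) auto
    have "\<phi>1 ` L \<subseteq> J'" using \<phi>1L JI(4) by (auto simp: L_def)
    moreover have "\<phi>1 ` (P - J) \<inter> J' = {}" using \<phi>1O \<phi>J by auto
    ultimately show "\<phi>1 ` (L - (P - J)) \<inter> \<phi>1 ` (P - J - L) = {}" by blast
  qed
  obtain \<psi>1 where hom: "homeomorphism P1 P1' \<phi>1 \<psi>1"
    using homeomorphism_compact [OF cO1 cont img inj] by blast
  have no: "\<sigma> s \<notin> over D1" "\<sigma>' s \<notin> over D1'" if "s \<in> span" for s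
    using that by (auto simp: D1 replace_strand_simps)
  have "imm D1' (\<phi>1 x) = imm D1 x \<and> (\<phi>1 x \<in> over D1' \<longleftrightarrow> x \<in> over D1)" if "x \<in> P1" for x
  proof (cases "x \<in> L")
    case True
    then obtain s where s: "s \<in> {0..3}" "x = \<sigma> s" by (auto simp: L_def)
    then have sp: "s \<in> span" "3 - s \<in> span" by auto
    have "imm D1' (\<sigma>' (3 - s)) = imm D1 (\<sigma> s)"
      using c1(9) [OF sp(1)] c1'(9) [OF sp(2)] curls_agree(1) [OF s(1)] by simp
    then show ?thesis using s no sp \<phi>1L by simp
  next
    case False
    then have x: "x \<in> P - J" using that split(1) by blast
    show ?thesis
    proof (cases "x \<in> \<sigma> ` span")
      case True
      then obtain s where s: "s \<in> span" "x = \<sigma> s" by blast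
      then have "s \<ge> 5" using x memJ(1) [OF s(1)] by auto
      then have "\<phi>1 x = \<sigma>' s" using \<phi>1O [OF x] \<phi>\<sigma> s by simp
      moreover have "imm D1' (\<sigma>' s) = imm D1 (\<sigma> s)"
        using c1(9) [OF s(1)] c1'(9) [OF s(1)] curls_agree(2) [OF \<open>s \<ge> 5\<close>] by simp
      ultimately show ?thesis using no s by simp
    next
      case False
      then have F: "\<phi> x \<notin> \<sigma>' ` span" using \<phi>out [of x] x by simp
      show ?thesis
        using \<phi> [of x] x \<phi>1O [OF x] out(1) [OF False] out(2) [OF F] a(4) a'(4) by (simp add: P_def)
    qed
  qed
  then show ?thesis
    unfolding agree_outside_def using hom by (auto simp: P1_def P1'_def)
qed

text \<open>The new end points are those with the coordinates 1 and 2 in the chart.  In D the additional strand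
  joins them, from 1 to 2.  In D' the additional strand joins 0 to 1, and the strand
  which led from 0 to the first end point now starts at 2.\<close>

lemma add_curls_to_H_config:
  assumes H: "H_config n D D' B c c' e \<theta>" and E: "end_chart n D D' B e \<theta> \<kappa> \<sigma> \<sigma>' \<tau>" and n: "n \<ge> 1"
    and D1: "D1 = replace_strand D \<kappa> \<sigma> span curl1" "D1' = replace_strand D' \<kappa> \<sigma>' span curl2"
  shows "\<exists>d d' \<theta>1 \<kappa>1 \<sigma>1 \<sigma>1' \<tau>1. H_config (Suc n) D1 D1' B d d' e \<theta>1 \<and>
    end_chart (Suc n) D1 D1' B e \<theta>1 \<kappa>1 \<sigma>1 \<sigma>1' \<tau>1"
proof -
  have D: "virtual_knot_diagram D" "virtual_knot_diagram D'" and st: "strands B n D c" "strands B n D' c'"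
    and ag: "agree_outside B D D'"
    and inj: "inj_on (imm D) {x \<in> circles D. imm D x \<in> B}" "inj_on (imm D') {x \<in> circles D'. imm D' x \<in> B}"
    and \<theta>: "\<And>j. j < 2 * n \<Longrightarrow> 0 \<le> \<theta> j \<and> \<theta> j < 2 * pi" "\<And>j k. j < 2 * n \<Longrightarrow> k < j \<Longrightarrow> \<theta> k < \<theta> j"
    and ends: "\<And>i. i < n \<Longrightarrow> imm D (c i 0) = e (cis (\<theta> (2*i)))"
      "\<And>i. i < n \<Longrightarrow> imm D (c i 1) = e (cis (\<theta> (2*i + 1)))"
      "\<And>i. i < n \<Longrightarrow> imm D' (c' i 0) = e (cis (\<theta> (2*i + 1)))"
      "\<And>i. i < n \<Longrightarrow> imm D' (c' i 1) = e (cis (\<theta> ((2*i + 2) mod (2*n))))"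
    using H by (auto simp: H_config_def)
  obtain e' where e': "homeomorphism (cball 0 1) B e e'" using H by (auto simp: H_config_def)
  have sc: "strand_chart D \<kappa> square \<sigma> span (Complex 0)" "strand_chart D' \<kappa> square \<sigma>' span (Complex 0)"
    and B: "\<And>w. w \<in> square \<Longrightarrow> \<kappa> w \<in> B \<longleftrightarrow> Im w \<le> 0"
    and \<tau>: "\<And>x. x \<in> {0..<8} \<Longrightarrow> \<kappa> (of_real x) = e (cis (\<tau> x)) \<and> \<tau> x < 2 * pi"
      "strict_mono_on {0..<8} \<tau>" "\<tau> 0 = \<theta> (2 * n - 1)"
    using E by (auto simp: end_chart_def)
  have clB: "closed B" using H_config_disk(2) [OF H] compact_imp_closed by blast
  note a = add_curl [OF D(1) sc(1) disjI1 [OF refl] D1(1)]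
  note a' = add_curl [OF D(2) sc(2) disjI2 [OF refl] D1(2)]
  note s = strand_chartD [OF sc(1)]
  note s' = strand_chartD [OF sc(2)]
  note s1 = strand_chartD [OF a(2)]
  note s1' = strand_chartD [OF a'(2)]
  have k: "{x \<in> circles D1. imm D1 x \<in> B} = {x \<in> circles D. imm D x \<in> B} \<union> \<sigma> ` {3..5}"
    "{x \<in> circles D. imm D x \<in> B} \<inter> \<sigma> ` {3..5} = {}"
    "inj_on (imm D1) {x \<in> circles D1. imm D1 x \<in> B}"
    "\<And>x. x \<in> circles D \<Longrightarrow> imm D x \<in> B \<Longrightarrow> imm D1 x \<in> frontier B \<longleftrightarrow> imm D x \<in> frontier B"
    "\<And>s. s \<in> {3..5} \<Longrightarrow> imm D1 (\<sigma> s) \<in> frontier B \<longleftrightarrow> s = 3 \<or> s = 5"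
    by (rule curl_in_disk [OF D(1) sc(1) disjI1 [OF refl] D1(1) clB _ inj(1)]; (rule B)?; assumption?)+
  have k': "{x \<in> circles D1'. imm D1' x \<in> B} = {x \<in> circles D'. imm D' x \<in> B} \<union> \<sigma>' ` {3..5}"
    "{x \<in> circles D'. imm D' x \<in> B} \<inter> \<sigma>' ` {3..5} = {}"
    "inj_on (imm D1') {x \<in> circles D1'. imm D1' x \<in> B}"
    "\<And>x. x \<in> circles D' \<Longrightarrow> imm D' x \<in> B \<Longrightarrow> imm D1' x \<in> frontier B \<longleftrightarrow> imm D' x \<in> frontier B"
    "\<And>s. s \<in> {3..5} \<Longrightarrow> imm D1' (\<sigma>' s) \<in> frontier B \<longleftrightarrow> s = 3 \<or> s = 5"
    by (rule curl_in_disk [OF D(2) sc(2) disjI2 [OF refl] D1(2) clB _ inj(2)]; (rule B)?; assumption?)+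
  have out: "\<And>x. x \<notin> \<sigma> ` span \<Longrightarrow> imm D1 x = imm D x" "\<And>x. x \<notin> \<sigma>' ` span \<Longrightarrow> imm D1' x = imm D' x"
    by (simp_all add: D1 replace_strand_simps)
  have sub: "{3..5} \<subseteq> span" by auto
  have cx: "Complex 0 0 = complex_of_real 0" "curl1 5 = complex_of_real 1" "curl1 3 = complex_of_real 2"
    "curl2 3 = complex_of_real 0" "curl2 5 = complex_of_real 1" "curl2 0 = complex_of_real 2"
    by (simp_all add: curl1_def curl2_def complex_eq_iff)
  define g where "g = (\<lambda>t::real. \<sigma> (5 + t * (3 - 5)))"
  define g' where "g' = (\<lambda>t::real. \<sigma>' (3 + t * (5 - 3)))"
  have pg: "path_image g = \<sigma> ` {3..5}" "path_image g' = \<sigma>' ` {3..5}"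
  proof -
    have "g = reversepath (\<lambda>t. \<sigma> (3 + t * (5 - 3)))" by (auto simp: g_def reversepath_def algebra_simps)
    then show "path_image g = \<sigma> ` {3..5}" using path_image_reparam [of 3 5 \<sigma>] by simp
    show "path_image g' = \<sigma>' ` {3..5}" unfolding g'_def by (rule path_image_reparam) simp
  qed
  have arcs: "arc g" "arc g'"
    unfolding g_def g'_def
    by (rule arc_reparam [OF continuous_on_subset [OF s(4) sub] inj_on_subset [OF s(5) sub]]; simp)
      (rule arc_reparam [OF continuous_on_subset [OF s'(4) sub] inj_on_subset [OF s'(5) sub]]; simp)
  have gf: "imm D1 (g t) \<in> frontier B \<longleftrightarrow> t = 0 \<or> t = 1" "imm D1' (g' t) \<in> frontier B \<longleftrightarrow> t = 0 \<or> t = 1"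
    if "t \<in> {0..1}" for t
    using k(5) [of "5 + t * (3 - 5)"] k'(5) [of "3 + t * (5 - 3)"] that by (auto simp: g_def g'_def)
  define d where "d = (\<lambda>i. if i < n then c i else if i = n then g else c (i - 1))"
  define d' where "d' = (\<lambda>i. if i < n - 1 then c' i else if i = n - 1 then g' else c' (i - 1))"
  have st1: "strands B (Suc n) D1 d"
    unfolding d_def by (rule strands_insert [OF st(1)]) (use k pg arcs gf in auto)
  have st1': "strands B (Suc n) D1' d'"
    unfolding d'_def by (rule strands_insert [OF st(2)]) (use k' pg arcs gf in auto)
  define \<theta>1 where "\<theta>1 = (\<lambda>j. if j < 2 * n then \<theta> j else if j = 2 * n then \<tau> 1 else \<tau> 2)"
  have tt: "\<theta> (2 * n - 1) < \<tau> 1" "\<tau> 1 < \<tau> 2" "\<tau> 2 < 2 * pi"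
    using \<tau>(1) [of 2] \<tau>(3) strict_mono_onD [OF \<tau>(2), of 0 1] strict_mono_onD [OF \<tau>(2), of 1 2] by auto
  have low: "\<theta> j \<le> \<theta> (2 * n - 1)" if "j < 2 * n" for j
  proof (cases "j = 2 * n - 1")
    case False
    then have "j < 2 * n - 1" using that by linarith
    then show ?thesis using \<theta>(2) [of "2 * n - 1" j] n by simp
  qed simp
  have pos: "0 \<le> \<theta> (2 * n - 1)" using \<theta>(1) [of "2 * n - 1"] n by simp
  have \<theta>1: "0 \<le> \<theta>1 j \<and> \<theta>1 j < 2 * pi" "k < j \<Longrightarrow> \<theta>1 k < \<theta>1 j" if j: "j < 2 * Suc n" for j k
  proof -
    have "j < 2 * n \<or> j = 2 * n \<or> j = 2 * n + 1" using j by auto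
    then have cases: thesis if "j < 2 * n \<Longrightarrow> thesis" "j = 2 * n \<Longrightarrow> thesis" "j = 2 * n + 1 \<Longrightarrow> thesis" for thesis
      using that by blast
    show "0 \<le> \<theta>1 j \<and> \<theta>1 j < 2 * pi"
      by (rule cases) (use \<theta>(1) [of j] tt pos in \<open>auto simp: \<theta>1_def\<close>)
    assume kj: "k < j"
    show "\<theta>1 k < \<theta>1 j"
    proof (rule cases)
      assume 1: "j < 2 * n" then show ?thesis using \<theta>(2) kj by (simp add: \<theta>1_def)
    next
      assume 2: "j = 2 * n" then show ?thesis using low [of k] tt kj by (simp add: \<theta>1_def)
    next
      assume 3: "j = 2 * n + 1"
      then have "k < 2 * n \<or> k = 2 * n" using kj by linarith
      then show ?thesis using low [of k] tt 3 by (auto simp: \<theta>1_def)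
    qed
  qed
  have mem: "c i t \<in> circles D" "imm D (c i t) \<in> B" "c' i t \<in> circles D'" "imm D' (c' i t) \<in> B"
    if "i < n" "t \<in> {0..1}" for i t
  proof -
    have "c i t \<in> (\<Union>i<n. path_image (c i))" "c' i t \<in> (\<Union>i<n. path_image (c' i))"
      using that unfolding path_image_def by blast+
    then show "c i t \<in> circles D" "imm D (c i t) \<in> B" "c' i t \<in> circles D'" "imm D' (c' i t) \<in> B"
      using st by (auto simp: strands_def)
  qed
  have cD1: "imm D1 (c i t) = imm D (c i t)" if "i < n" "t \<in> {0..1}" for i t
  proof (cases "c i t \<in> \<sigma> ` span")
    case True
    then obtain u where u: "u \<in> span" "c i t = \<sigma> u" by blast
    then have "u \<le> 0" using mem(2) [OF that] s(8,9) [OF u(1)] B by auto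
    then have "curl1 u = Complex 0 u" by (simp add: curl1_def)
    then show ?thesis using u s(9) s1(9) by simp
  qed (rule out)
  have \<kappa>pt: "\<kappa> (complex_of_real 0) = e (cis (\<theta> (2 * n - 1)))" "\<kappa> (complex_of_real 1) = e (cis (\<theta>1 (2 * n)))"
    "\<kappa> (complex_of_real 2) = e (cis (\<theta>1 (2 * n + 1)))"
    using \<tau>(1) [of 0] \<tau>(1) [of 1] \<tau>(1) [of 2] \<tau>(3) by (simp_all add: \<theta>1_def)
  have z8: "0 \<in> span" "3 \<in> span" "5 \<in> span" by auto
  have einj: "inj_on e (cball 0 1)" by (rule inj_on_inverseI) (rule homeomorphism_apply1 [OF e'])
  have other: "e (cis (\<theta> j)) \<noteq> \<kappa> (complex_of_real 0)" if "j < 2 * n - 1" for j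
  proof
    assume "e (cis (\<theta> j)) = \<kappa> (complex_of_real 0)"
    then have "cis (\<theta> j) = cis (\<theta> (2 * n - 1))"
      using \<kappa>pt inj_onD [OF einj] by simp
    then have "pt (\<theta> j) = pt (\<theta> (2 * n - 1))" by (simp add: pt_def)
    moreover have "\<bar>\<theta> j - \<theta> (2 * n - 1)\<bar> < 2 * pi"
    proof -
      have "j < 2 * n" "2 * n - 1 < 2 * n" using that by linarith+
      from \<theta>(1) [OF this(1)] \<theta>(1) [OF this(2)] show ?thesis by linarith
    qed
    ultimately have "\<theta> j = \<theta> (2 * n - 1)" using pt_eq_iff by blast
    then show False using \<theta>(2) [of "2 * n - 1" j] that by auto
  qed
  have cD1': "imm D1' (c' i t) = imm D' (c' i t)"
    if i: "i < n" "t = 0 \<or> t = 1" "imm D' (c' i t) \<noteq> \<kappa> (complex_of_real 0)" for i t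
  proof (cases "c' i t \<in> \<sigma>' ` span")
    case True
    then obtain u where u: "u \<in> span" "c' i t = \<sigma>' u" by blast
    have "imm D' (c' i t) \<in> frontier B" using st(2) i(1,2) by (auto simp: strands_def)
    then have "\<kappa> (Complex 0 u) \<in> frontier B" using u s'(9) by simp
    then have "u = 0"
      using half_plane_chart(2) [OF s(2,3) clB _ s(8) [OF u(1)]] B by simp
    then show ?thesis using i(3) u s'(9) [OF u(1)] cx by simp
  qed (rule out)
  have last: "c' (n - 1) 0 = \<sigma>' 0"
  proof -
    have "Suc (2 * (n - 1)) = 2 * n - 1" using n by simp
    then have im: "imm D' (c' (n - 1) 0) = \<kappa> (complex_of_real 0)" using ends(3) [of "n - 1"] n \<kappa>pt by simp
    then have "c' (n - 1) 0 \<in> {x \<in> circles D'. imm D' x \<in> \<kappa> ` square}"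
      using mem(3) [of "n - 1" 0] n s(8) [OF z8(1)] cx by auto
    then obtain u where u: "u \<in> span" "c' (n - 1) 0 = \<sigma>' u" using s'(7) by auto
    then have "\<kappa> (Complex 0 u) = \<kappa> (Complex 0 0)" using im s'(9) cx by simp
    then have "Complex 0 u = Complex 0 0" using inj_onD [OF s(3)] s(8) u(1) z8 by blast
    then show ?thesis using u by simp
  qed
  have ends1: "imm D1 (d i 0) = e (cis (\<theta>1 (2 * i)))" "imm D1 (d i 1) = e (cis (\<theta>1 (2 * i + 1)))"
    if "i < Suc n" for i
  proof -
    have "i < n \<or> i = n" using that by auto
    then have "imm D1 (d i 0) = e (cis (\<theta>1 (2 * i))) \<and> imm D1 (d i 1) = e (cis (\<theta>1 (2 * i + 1)))"
    proof
      assume "i < n"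
      then show ?thesis using cD1 [of i] ends(1,2) by (simp add: d_def \<theta>1_def)
    next
      assume "i = n"
      then show ?thesis using s1(9) z8 cx \<kappa>pt by (simp add: d_def g_def)
    qed
    then show "imm D1 (d i 0) = e (cis (\<theta>1 (2 * i)))" "imm D1 (d i 1) = e (cis (\<theta>1 (2 * i + 1)))"
      by auto
  qed
  have ends1': "imm D1' (d' i 0) = e (cis (\<theta>1 (2 * i + 1)))"
    "imm D1' (d' i 1) = e (cis (\<theta>1 ((2 * i + 2) mod (2 * Suc n))))"
    if iS: "i < Suc n" for i
  proof -
    have "i < n - 1 \<or> i = n - 1 \<or> i = n" using iS n by auto
    then consider "i < n - 1" | "i = n - 1" | "i = n" by blast
    then have "imm D1' (d' i 0) = e (cis (\<theta>1 (2 * i + 1))) \<and>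
      imm D1' (d' i 1) = e (cis (\<theta>1 ((2 * i + 2) mod (2 * Suc n))))"
    proof cases
      case 1
      then have i: "i < n" "2 * i + 1 < 2 * n - 1" "2 * i + 2 < 2 * n - 1" "2 * i + 2 < 2 * n" by auto
      have "imm D' (c' i 0) \<noteq> \<kappa> (complex_of_real 0)" "imm D' (c' i 1) \<noteq> \<kappa> (complex_of_real 0)"
        using ends(3,4) [OF i(1)] other [OF i(2)] other [OF i(3)] i(4) by simp_all
      then have "imm D1' (c' i 0) = imm D' (c' i 0)" "imm D1' (c' i 1) = imm D' (c' i 1)"
        using cD1' i(1) by blast+
      moreover have "d' i = c' i" using 1 by (simp add: d'_def)
      moreover have "\<theta>1 (2 * i + 1) = \<theta> (2 * i + 1)" "\<theta>1 (2 * i + 2) = \<theta> (2 * i + 2)"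
        using i by (simp_all add: \<theta>1_def)
      ultimately show ?thesis using ends(3,4) [OF i(1)] i(4) by simp
    next
      case 2
      then have "d' i = g'" "2 * i + 1 = 2 * n - 1" "2 * i + 2 = 2 * n" using n by (auto simp: d'_def)
      moreover have "imm D1' (g' 0) = \<kappa> (complex_of_real 0)" "imm D1' (g' 1) = \<kappa> (complex_of_real 1)"
        using s1'(9) z8 cx by (simp_all add: g'_def)
      moreover have "\<theta>1 (2 * n - 1) = \<theta> (2 * n - 1)" using n by (simp add: \<theta>1_def)
      ultimately show ?thesis using \<kappa>pt by simp
    next
      case 3
      then have "\<not> i < n - 1" "i \<noteq> n - 1" using n by auto
      then have "d' i = c' (n - 1)" using 3 by (simp add: d'_def)
      moreover have "imm D1' (c' (n - 1) 0) = \<kappa> (complex_of_real 2)"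
        using last s1'(9) z8 cx by simp
      moreover have "imm D1' (c' (n - 1) 1) = e (cis (\<theta> 0))"
      proof -
        have "(2 * (n - 1) + 2) mod (2 * n) = 0" using n by (cases n) auto
        then have *: "imm D' (c' (n - 1) 1) = e (cis (\<theta> 0))" using ends(4) [of "n - 1"] n by simp
        show ?thesis using cD1' [of "n - 1" 1] * other [of 0] n by simp
      qed
      moreover have "\<theta>1 0 = \<theta> 0" using n by (simp add: \<theta>1_def)
      ultimately show ?thesis using 3 \<kappa>pt by simp
    qed
    then show "imm D1' (d' i 0) = e (cis (\<theta>1 (2 * i + 1)))"
      "imm D1' (d' i 1) = e (cis (\<theta>1 ((2 * i + 2) mod (2 * Suc n))))" by auto
  qed
  have ag1: "agree_outside B D1 D1'"
    by (rule curl_agree_outside [OF D sc D1 clB _ ag]) (rule B)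
  have H1: "H_config (Suc n) D1 D1' B d d' e \<theta>1"
    unfolding H_config_def using a(1) a'(1) st1 st1' ag1 k(3) k'(3) e' \<theta>1 ends1 ends1' by blast
  define f where "f = (\<lambda>w::complex. 2 + w / 16)"
  have f: "continuous_on square f" "inj_on f square" "f ` square \<subseteq> square"
    by (auto simp: f_def inj_on_def square_def abs_if split: if_splits intro!: continuous_intros)
  have sc1: "strand_chart D1 (\<kappa> \<circ> f) square (\<sigma> \<circ> (\<lambda>s. 3 - s / 16)) span (Complex 0)"
  proof (rule strand_chart_rescale [OF a(2) open_square f])
    fix u :: real
    have "(\<lambda>s. 3 - s / 16) ` span = {5/2<..<7/2}"
    proof (intro equalityI subsetI)
      fix x :: real assume "x \<in> {5/2<..<7/2}"
      then show "x \<in> (\<lambda>s. 3 - s / 16) ` span" by (intro image_eqI [of _ _ "16 * (3 - x)"]) (auto simp: field_simps)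
    qed auto
    then show "(\<exists>w\<in>square. curl1 u = f w) \<longleftrightarrow> u \<in> (\<lambda>s. 3 - s / 16) ` span"
      using curls_near_end(1) by (simp add: f_def)
  qed (use s(8) curls_vertical in \<open>auto simp: f_def inj_on_def intro!: continuous_intros\<close>)
  have sc1': "strand_chart D1' (\<kappa> \<circ> f) square (\<sigma>' \<circ> (\<lambda>s. s / 16)) span (Complex 0)"
  proof (rule strand_chart_rescale [OF a'(2) open_square f])
    fix u :: real
    have "(\<lambda>s. s / 16) ` span = {-1/2<..<1/2}"
    proof (intro equalityI subsetI)
      fix x :: real assume "x \<in> {-1/2<..<1/2}"
      then show "x \<in> (\<lambda>s. s / 16) ` span" by (intro image_eqI [of _ _ "16 * x"]) auto
    qed auto
    then show "(\<exists>w\<in>square. curl2 u = f w) \<longleftrightarrow> u \<in> (\<lambda>s. s / 16) ` span"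
      using curls_near_end(2) by (simp add: f_def)
  qed (use s(8) curls_vertical in \<open>auto simp: f_def inj_on_def intro!: continuous_intros\<close>)
  have "end_chart (Suc n) D1 D1' B e \<theta>1 (\<kappa> \<circ> f) (\<sigma> \<circ> (\<lambda>s. 3 - s / 16)) (\<sigma>' \<circ> (\<lambda>s. s / 16)) (\<lambda>x. \<tau> (2 + x / 16))"
    unfolding end_chart_def
  proof (intro conjI sc1 sc1' ballI)
    show "(\<kappa> \<circ> f) w \<in> B \<longleftrightarrow> Im w \<le> 0" if "w \<in> square" for w
      using B [of "f w"] f(3) that by (auto simp: f_def)
    show "strict_mono_on {0..<8} (\<lambda>x. \<tau> (2 + x / 16))"
      using strict_mono_onD [OF \<tau>(2)] by (intro strict_mono_onI) auto
    show "\<tau> (2 + 0 / 16) = \<theta>1 (2 * Suc n - 1)" by (simp add: \<theta>1_def)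
    fix x :: real assume "x \<in> {0..<8}"
    then have "2 + x / 16 \<in> {0..<8}" by auto
    from \<tau>(1) [OF this] show "(\<kappa> \<circ> f) (complex_of_real x) = e (cis (\<tau> (2 + x / 16)))" "\<tau> (2 + x / 16) < 2 * pi"
      by (simp_all add: f_def)
  qed
  with H1 show ?thesis by blast
qed

lemma curl_steps:
  assumes "R1 D D1 \<or> VR1 D D1"
  shows "diagram_step n D D1" "diagram_step n D1 D"
  using assms by (auto simp: diagram_step_def reidemeister_move_def)

text \<open>Both directions are proved together, since the H(2)-move at a crossing has to be undone later on.\<close>

lemma H_config_realizable:
  assumes "H_config n D D' B c c' e \<theta>" "end_chart n D D' B e \<theta> \<kappa> \<sigma> \<sigma>' \<tau>" "n \<ge> 1"
  shows "(diagram_step (n + k))\<^sup>*\<^sup>* D D' \<and> (diagram_step (n + k))\<^sup>*\<^sup>* D' D"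
  using assms
proof (induction k arbitrary: n D D' c c' \<theta> \<kappa> \<sigma> \<sigma>' \<tau>)
  case 0
  then show ?case
    using H_config_move [OF 0(1)] H_config_sym [OF 0(1,3)] by (auto simp: diagram_step_def)
next
  case (Suc k)
  define D1 where "D1 = replace_strand D \<kappa> \<sigma> span curl1"
  define D1' where "D1' = replace_strand D' \<kappa> \<sigma>' span curl2"
  have v: "virtual_knot_diagram D" "virtual_knot_diagram D'" using Suc.prems(1) by (auto simp: H_config_def)
  have sc: "strand_chart D \<kappa> square \<sigma> span (Complex 0)" "strand_chart D' \<kappa> square \<sigma>' span (Complex 0)"
    using Suc.prems(2) by (auto simp: end_chart_def)
  note curl = curl_steps [OF add_curl(3) [OF v(1) sc(1) disjI1 [OF refl] D1_def]]
    curl_steps [OF add_curl(3) [OF v(2) sc(2) disjI2 [OF refl] D1'_def]]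
  obtain d d' \<theta>1 \<kappa>1 \<sigma>1 \<sigma>1' \<tau>1 where
    "H_config (Suc n) D1 D1' B d d' e \<theta>1" "end_chart (Suc n) D1 D1' B e \<theta>1 \<kappa>1 \<sigma>1 \<sigma>1' \<tau>1"
    using add_curls_to_H_config [OF Suc.prems D1_def D1'_def] by blast
  then have "(diagram_step (Suc n + k))\<^sup>*\<^sup>* D1 D1' \<and> (diagram_step (Suc n + k))\<^sup>*\<^sup>* D1' D1"
    by (rule Suc.IH) simp
  then have *: "(diagram_step (n + Suc k))\<^sup>*\<^sup>* D1 D1'" "(diagram_step (n + Suc k))\<^sup>*\<^sup>* D1' D1" by simp_all
  show ?case
    using converse_rtranclp_into_rtranclp [OF curl(1) rtranclp.rtrancl_into_rtrancl [OF *(1) curl(4)]]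
      converse_rtranclp_into_rtranclp [OF curl(3) rtranclp.rtrancl_into_rtrancl [OF *(2) curl(2)]]
    by blast
qed

section \<open>A chart around a crossing\<close>

text \<open>A branch that avoids one point of the circle has a continuous angle.\<close>

lemma arg_lift:
  assumes z: "continuous_on S z" "\<And>t. t \<in> S \<Longrightarrow> z t \<in> {0} \<times> sphere 0 1 - {pt \<eta>}"
  obtains a where "continuous_on S a" "\<And>t. t \<in> S \<Longrightarrow> a t \<in> {\<eta><..<\<eta> + 2 * pi}" "\<And>t. t \<in> S \<Longrightarrow> pt (a t) = z t"
proof
  define a where "a = (\<lambda>t. \<eta> + Arg2pi (snd (z t) * cis (- \<eta>)))"
  have *: "snd (z t) = cis (a t) \<and> a t \<in> {\<eta><..<\<eta> + 2 * pi} \<and> snd (z t) * cis (- \<eta>) \<notin> \<real>\<^sub>\<ge>\<^sub>0" if t: "t \<in> S" for t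
  proof -
    define w where "w = snd (z t) * cis (- \<eta>)"
    have zt: "z t = (0, snd (z t))" "norm (snd (z t)) = 1" "z t \<noteq> pt \<eta>"
      using z(2) [OF t] by (cases "z t"; simp)+
    have "norm w = 1" by (simp add: w_def norm_mult zt(2))
    then have w: "w = cis (Arg2pi w)" using Arg2pi_eq [of w] by (simp add: cis_conv_exp)
    have "snd (z t) = w * cis \<eta>" by (simp add: w_def mult.assoc cis_mult)
    also have "\<dots> = cis (a t)" by (subst w) (simp add: cis_mult a_def w_def add.commute)
    finally have 1: "snd (z t) = cis (a t)" .
    have "Arg2pi w \<noteq> 0"
    proof
      assume "Arg2pi w = 0"
      then have "a t = \<eta>" by (simp add: a_def w_def)
      then have "(0, snd (z t)) = pt \<eta>" using 1 by (simp add: pt_def)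
      with zt(1) have "z t = pt \<eta>" by (rule trans)
      with zt(3) show False by contradiction
    qed
    then have "0 < Arg2pi w" using Arg2pi_ge_0 [of w] by linarith
    then have 2: "a t \<in> {\<eta><..<\<eta> + 2 * pi}" using Arg2pi_lt_2pi [of w] by (simp add: a_def w_def)
    have "w \<notin> \<real>\<^sub>\<ge>\<^sub>0" using \<open>Arg2pi w \<noteq> 0\<close> unfolding Arg2pi_eq_0 by (auto simp: complex_nonneg_Reals_iff complex_is_Real_iff)
    then show ?thesis using 1 2 by (simp add: w_def)
  qed
  show "continuous_on S a"
  proof -
    have "continuous_on S (\<lambda>t. Arg2pi (snd (z t) * cis (- \<eta>)))"
    proof (rule continuous_on_compose2 [of "- \<real>\<^sub>\<ge>\<^sub>0" Arg2pi])
      show "continuous_on (- \<real>\<^sub>\<ge>\<^sub>0) Arg2pi"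
        by (intro continuous_at_imp_continuous_on ballI continuous_at_Arg2pi) auto
      show "continuous_on S (\<lambda>t. snd (z t) * cis (- \<eta>))" by (intro continuous_intros z(1))
      show "(\<lambda>t. snd (z t) * cis (- \<eta>)) ` S \<subseteq> - \<real>\<^sub>\<ge>\<^sub>0" using * by blast
    qed
    then show ?thesis unfolding a_def by (intro continuous_intros)
  qed
  show "a t \<in> {\<eta><..<\<eta> + 2 * pi}" if "t \<in> S" for t using *[OF that] by blast
  show "pt (a t) = z t" if "t \<in> S" for t
    using *[OF that] z(2) [OF that] by (cases "z t") (simp add: pt_def)
qed

text \<open>Reflecting the chart in a coordinate axis reverses the parameter of one branch.\<close>

lemma orient_branch:
  fixes a :: "real \<Rightarrow> real"
  assumes "continuous_on {-1<..<1} a" "inj_on a {-1<..<1}"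
  obtains \<epsilon> where "\<epsilon> = 1 \<or> \<epsilon> = -1" "strict_mono_on {-1<..<1} (\<lambda>t. a (\<epsilon> * t))"
proof -
  have "strict_mono_on {-1<..<1} a \<or> strict_antimono_on {-1<..<1} a"
    using injective_eq_monotone_map [of "{-1<..<1}" a] assms by (simp add: is_interval_oo)
  then show thesis
  proof
    assume "strict_mono_on {-1<..<1} a"
    then show thesis using that [of 1] by simp
  next
    assume a: "strict_antimono_on {-1<..<1} a"
    have "strict_mono_on {-1<..<1} (\<lambda>t. a (- 1 * t))"
      by (rule strict_mono_onI) (use a in \<open>auto simp: monotone_on_def\<close>)
    then show thesis using that [of "-1"] by simp
  qed
qed

text \<open>Coordinates near a crossing, adapted to the H(2)-move in the unit disk: the crossing is at -2\<i>, the
  branch \<open>\<beta>\<close> of y is the imaginary axis, and the branch \<open>\<alpha>\<close> of x is the line through -2\<i> and 1, which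
  meets the unit circle in (3 - 4\<i>)/5 and 1.  The imaginary axis is a diameter of the unit disk, so
  that it is orthogonal to the boundary at the end point -\<i>; this gives the chart there.
  The inequalities between the angles \<open>\<alpha>\<close> and \<open>\<beta>\<close> in \<open>crossing_chart\<close> mean that along the knot
  all of the first branch comes before all of the second one.\<close>

definition window :: "complex set" where
  "window = {w. \<bar>Re w\<bar> < 2 \<and> -3 < Im w \<and> Im w < 2}"

definition crossing_chart ::
  "vdiagram \<Rightarrow> nat \<times> complex \<Rightarrow> nat \<times> complex \<Rightarrow> (complex \<Rightarrow> complex) \<Rightarrow> (real \<Rightarrow> real) \<Rightarrow> (real \<Rightarrow> real) \<Rightarrow> bool" where
  "crossing_chart D x y \<kappa> \<alpha> \<beta> \<longleftrightarrow>
     continuous_on window \<kappa> \<and> inj_on \<kappa> window \<and>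
     continuous_on {-1/2<..<2} \<alpha> \<and> strict_mono_on {-1/2<..<2} \<alpha> \<and>
     continuous_on {-1<..<4} \<beta> \<and> strict_mono_on {-1<..<4} \<beta> \<and>
     (\<forall>s\<in>{-1/2<..<2}. \<forall>t\<in>{-1<..<4}. \<alpha> s < \<beta> t \<and> (\<forall>u\<in>{-1/2<..<2}. \<beta> t < \<alpha> u + 2 * pi)) \<and>
     x = pt (\<alpha> 0) \<and> y = pt (\<beta> 0) \<and>
     (\<forall>s\<in>{-1/2<..<2}. imm D (pt (\<alpha> s)) = \<kappa> (Complex s (2 * s - 2))) \<and>
     (\<forall>t\<in>{-1<..<4}. imm D (pt (\<beta> t)) = \<kappa> (Complex 0 (t - 2))) \<and>
     {z \<in> circles D. imm D z \<in> \<kappa> ` window} = pt ` \<alpha> ` {-1/2<..<2} \<union> pt ` \<beta> ` {-1<..<4}"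

lemma crossing_chart_exists:
  assumes D: "ncomp D = 1" and tr: "transverse_at D x y" and xy: "imm D x = imm D y"
  obtains \<kappa> \<alpha> \<beta> where "crossing_chart D x y \<kappa> \<alpha> \<beta>"
proof -
  obtain U h k M N f g where U: "open U" "homeomorphism U (ball (0::complex) 1) h k"
    and M: "openin (top_of_set (circles D)) M" "x \<in> M"
    and N: "openin (top_of_set (circles D)) N" "y \<in> N" and MN: "M \<inter> N = {}"
    and pre: "{z \<in> circles D. imm D z \<in> U} = M \<union> N"
    and f: "homeomorphism M {w \<in> ball 0 1. Im w = 0} (h \<circ> imm D) f"
    and g: "homeomorphism N {w \<in> ball 0 1. Re w = 0} (h \<circ> imm D) g"
    using tr unfolding transverse_at_def by blast
  have circ: "circles D = {0} \<times> sphere 0 1" by (rule circles_knot [OF D])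
  have Mc: "M \<subseteq> circles D" "N \<subseteq> circles D" using M N openin_imp_subset by blast+
  have inM: "imm D z \<in> U" if "z \<in> M" for z using that pre by blast
  have inN: "imm D z \<in> U" if "z \<in> N" for z using that pre by blast
  have "Im (h (imm D x)) = 0" using homeomorphism_image1 [OF f] M by auto
  moreover have "Re (h (imm D y)) = 0" using homeomorphism_image1 [OF g] N by auto
  ultimately have "h (imm D x) = 0" using xy by (simp add: complex_eq_iff [of _ 0])
  then have h0: "h (imm D x) = 0" "h (imm D y) = 0" using xy by simp_all
  have f0: "f 0 = x" using homeomorphism_apply1 [OF f M(2)] h0 by simp
  have g0: "g 0 = y" using homeomorphism_apply1 [OF g N(2)] h0 by simp
  define m where "m = (\<lambda>t::real. f (of_real t))"
  define m' where "m' = (\<lambda>t::real. g (\<i> * of_real t))"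
  have axisM: "complex_of_real t \<in> {w \<in> ball 0 1. Im w = 0}" if "t \<in> {-1<..<1}" for t using that by auto
  have axisN: "\<i> * complex_of_real t \<in> {w \<in> ball 0 1. Re w = 0}" if "t \<in> {-1<..<1}" for t
    using that by (auto simp: norm_mult)
  have mM: "m t \<in> M" "h (imm D (m t)) = of_real t" if "t \<in> {-1<..<1}" for t
    using homeomorphism_image2 [OF f] homeomorphism_apply2 [OF f axisM [OF that]] axisM [OF that]
    by (auto simp: m_def)
  have mN: "m' t \<in> N" "h (imm D (m' t)) = \<i> * of_real t" if "t \<in> {-1<..<1}" for t
    using homeomorphism_image2 [OF g] homeomorphism_apply2 [OF g axisN [OF that]] axisN [OF that]
    by (auto simp: m'_def)
  have imM: "imm D (m t) = k (of_real t)" if "t \<in> {-1<..<1}" for t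
    using homeomorphism_apply1 [OF U(2) inM [OF mM(1) [OF that]]] mM(2) [OF that] by simp
  have imN: "imm D (m' t) = k (\<i> * of_real t)" if "t \<in> {-1<..<1}" for t
    using homeomorphism_apply1 [OF U(2) inN [OF mN(1) [OF that]]] mN(2) [OF that] by simp
  have mcont: "continuous_on {-1<..<1} m" "continuous_on {-1<..<1} m'"
    unfolding m_def m'_def using axisM axisN
    by (auto intro!: continuous_on_compose2 [OF homeomorphism_cont2 [OF f]] continuous_on_compose2 [OF homeomorphism_cont2 [OF g]] continuous_intros)
  have msurj: "z \<in> m ` {-1<..<1}" if "z \<in> M" for z
  proof -
    have w: "h (imm D z) \<in> {w \<in> ball 0 1. Im w = 0}" using homeomorphism_image1 [OF f] that by auto
    then have "h (imm D z) = of_real (Re (h (imm D z)))" by (simp add: complex_eq_iff)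
    moreover have "f (h (imm D z)) = z" using homeomorphism_apply1 [OF f that] by simp
    moreover have "\<bar>Re (h (imm D z))\<bar> < 1" using w abs_Re_le_cmod [of "h (imm D z)"] by auto
    ultimately show ?thesis by (intro image_eqI [of _ _ "Re (h (imm D z))"]) (auto simp: m_def)
  qed
  have m'surj: "z \<in> m' ` {-1<..<1}" if "z \<in> N" for z
  proof -
    have w: "h (imm D z) \<in> {w \<in> ball 0 1. Re w = 0}" using homeomorphism_image1 [OF g] that by auto
    then have "h (imm D z) = \<i> * of_real (Im (h (imm D z)))" by (simp add: complex_eq_iff)
    moreover have "g (h (imm D z)) = z" using homeomorphism_apply1 [OF g that] by simp
    moreover have "\<bar>Im (h (imm D z))\<bar> < 1" using w abs_Im_le_cmod [of "h (imm D z)"] by auto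
    ultimately show ?thesis by (intro image_eqI [of _ _ "Im (h (imm D z))"]) (auto simp: m'_def)
  qed
  obtain \<eta>0 where \<eta>0: "y = pt \<eta>0" using circles_eq_pt [OF D] N Mc by blast
  define \<eta> where "\<eta> = \<eta>0 - 2 * pi"
  have \<eta>: "y = pt \<eta>" "y = pt (\<eta> + 2 * pi)" using \<eta>0 by (simp_all add: \<eta>_def pt_add_2pi)
  have avoid: "m t \<in> {0} \<times> sphere 0 1 - {pt \<eta>}" if "t \<in> {-1<..<1}" for t
  proof -
    have "m t \<in> M" by (rule mM(1) [OF that])
    then have "m t \<in> circles D" "m t \<noteq> y" using Mc(1) MN N(2) by auto
    then show ?thesis using circ \<eta>(1) by simp
  qed
  obtain a where a: "continuous_on {-1<..<1} a" "\<And>t. t \<in> {-1<..<1} \<Longrightarrow> a t \<in> {\<eta><..<\<eta> + 2 * pi}"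
    "\<And>t. t \<in> {-1<..<1} \<Longrightarrow> pt (a t) = m t"
    by (rule arg_lift [OF mcont(1) avoid]) auto
  have z1: "(0::real) \<in> {-1<..<1}" by simp
  have xa: "x = pt (a 0)" using a(3) [OF z1] f0 by (simp add: m_def)
  have avoid': "m' t \<in> {0} \<times> sphere 0 1 - {pt (a 0)}" if "t \<in> {-1<..<1}" for t
  proof -
    have "m' t \<in> N" by (rule mN(1) [OF that])
    then have "m' t \<in> circles D" "m' t \<noteq> x" using Mc(2) MN M(2) by auto
    then show ?thesis using circ xa by simp
  qed
  obtain b where b: "continuous_on {-1<..<1} b" "\<And>t. t \<in> {-1<..<1} \<Longrightarrow> b t \<in> {a 0<..<a 0 + 2 * pi}"
    "\<And>t. t \<in> {-1<..<1} \<Longrightarrow> pt (b t) = m' t"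
    by (rule arg_lift [OF mcont(2) avoid']) auto
  have a0: "a 0 \<in> {\<eta><..<\<eta> + 2 * pi}" "b 0 \<in> {a 0<..<a 0 + 2 * pi}" using a(2) b(2) z1 by blast+
  have "pt (b 0) = pt (\<eta> + 2 * pi)" using b(3) [OF z1] g0 \<eta>(2) by (simp add: m'_def)
  then have b0: "b 0 = \<eta> + 2 * pi"
    using a0 pt_eq_iff [of "b 0" "\<eta> + 2 * pi"] by (auto simp: abs_less_iff)
  have injab: "inj_on a {-1<..<1}" "inj_on b {-1<..<1}"
  proof -
    have "s = t" if st: "s \<in> {-1<..<1}" "t \<in> {-1<..<1}" "a s = a t" for s t
    proof -
      have "m s = m t" by (simp only: a(3) [OF st(1), symmetric] a(3) [OF st(2), symmetric] st(3))
      then have "complex_of_real s = of_real t"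
        by (simp only: mM(2) [OF st(1), symmetric] mM(2) [OF st(2), symmetric])
      then show ?thesis by simp
    qed
    then show "inj_on a {-1<..<1}" by (rule inj_onI)
    have "s = t" if st: "s \<in> {-1<..<1}" "t \<in> {-1<..<1}" "b s = b t" for s t
    proof -
      have "m' s = m' t" by (simp only: b(3) [OF st(1), symmetric] b(3) [OF st(2), symmetric] st(3))
      then have "\<i> * complex_of_real s = \<i> * of_real t"
        by (simp only: mN(2) [OF st(1), symmetric] mN(2) [OF st(2), symmetric])
      then show ?thesis by simp
    qed
    then show "inj_on b {-1<..<1}" by (rule inj_onI)
  qed
  have ne: "pt (a s) \<noteq> pt (b t)" if "s \<in> {-1<..<1}" "t \<in> {-1<..<1}" for s t
  proof
    assume "pt (a s) = pt (b t)"
    then have "m s = m' t" by (simp only: a(3) [OF that(1)] b(3) [OF that(2)])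
    then have "m s \<in> M \<inter> N" using mM(1) [OF that(1)] mN(1) [OF that(2)] by simp
    then show False using MN by simp
  qed
  have conn: "connected ({-1<..<1} \<times> {-1<..<1} :: (real \<times> real) set)"
    by (intro connected_Times) auto
  have dcont: "continuous_on ({-1<..<1} \<times> {-1<..<1}) (\<lambda>p. b (snd p) - a (fst p))"
    by (intro continuous_intros continuous_on_compose2 [OF a(1)] continuous_on_compose2 [OF b(1)]) auto
  have ival: "is_interval ((\<lambda>p. b (snd p) - a (fst p)) ` ({-1<..<1} \<times> {-1<..<1}))"
    using connected_continuous_image [OF dcont conn] is_interval_connected_1 by blast
  have sep: "a s < b t \<and> b t < a s + 2 * pi" if st: "s \<in> {-1<..<1}" "t \<in> {-1<..<1}" for s t
  proof -
    let ?S = "(\<lambda>p. b (snd p) - a (fst p)) ` ({-1<..<1} \<times> {-1<..<1})"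
    have S: "b t - a s \<in> ?S" "b 0 - a 0 \<in> ?S"
      by (rule image_eqI [of _ _ "(s, t)"]; use st in simp) (rule image_eqI [of _ _ "(0, 0)"]; simp)
    have "0 \<notin> ?S" "2 * pi \<notin> ?S"
    proof -
      have "b v - a u \<noteq> 0 \<and> b v - a u \<noteq> 2 * pi" if "u \<in> {-1<..<1}" "v \<in> {-1<..<1}" for u v
      proof -
        have "b v \<noteq> a u" using ne [OF that] by auto
        moreover have "b v \<noteq> a u + 2 * pi" using ne [OF that] pt_add_2pi(1) [of "a u"] by metis
        ultimately show ?thesis by auto
      qed
      then show "0 \<notin> ?S" "2 * pi \<notin> ?S" by fastforce+
    qed
    moreover have "0 < b 0 - a 0" "b 0 - a 0 < 2 * pi" using a0 b0 by auto
    ultimately have "0 < b t - a s" "b t - a s < 2 * pi"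
      using S ival unfolding is_interval_1 by (meson less_imp_le not_le)+
    then show ?thesis by auto
  qed
  obtain \<epsilon> where \<epsilon>: "\<epsilon> = 1 \<or> \<epsilon> = -1" "strict_mono_on {-1<..<1} (\<lambda>t. a (\<epsilon> * t))"
    using orient_branch [OF a(1) injab(1)] by blast
  obtain \<delta> where \<delta>: "\<delta> = 1 \<or> \<delta> = -1" "strict_mono_on {-1<..<1} (\<lambda>t. b (\<delta> * t))"
    using orient_branch [OF b(1) injab(2)] by blast
  \<comment> \<open>The affine map carries the line through Complex 0 (- 2) with slope 2 to the real axis and the
    imaginary axis to itself; the signs make both angles increase, and the factor 1/10 keeps the
    window inside the unit ball.\<close>
  define L where "L = (\<lambda>w. Complex (\<epsilon> * (Re w / 10)) (\<delta> * ((Im w + 2 - 2 * Re w) / 10)))"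
  have LQ: "L w \<in> ball 0 1" if w: "w \<in> window" for w
  proof -
    have "\<bar>Re w\<bar> < 2" "\<bar>Im w + 2 - 2 * Re w\<bar> < 8" using w by (auto simp: window_def abs_if split: if_splits)
    then have "\<bar>Re (L w)\<bar> < 1/5" "\<bar>Im (L w)\<bar> < 4/5" using \<epsilon>(1) \<delta>(1) by (auto simp: L_def abs_mult)
    then have "norm (L w) < 1" using cmod_le [of "L w"] by linarith
    then show ?thesis by simp
  qed
  have Lcont: "continuous_on window L" unfolding L_def by (intro continuous_intros) auto
  have Linj: "inj_on L window" using \<epsilon>(1) \<delta>(1) by (auto simp: L_def inj_on_def complex_eq_iff)
  have kinj: "inj_on k (ball 0 1)" by (rule inj_on_inverseI) (rule homeomorphism_apply2 [OF U(2)])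
  define \<kappa> where "\<kappa> = k \<circ> L"
  define \<alpha> where "\<alpha> = (\<lambda>t. a (\<epsilon> * (t / 10)))"
  define \<beta> where "\<beta> = (\<lambda>t. b (\<delta> * (t / 10)))"
  have ein: "\<epsilon> * (s / 10) \<in> {-1<..<1}" "\<delta> * (s / 10) \<in> {-1<..<1}" if "-8 < s" "s < 8" for s
    using \<epsilon>(1) \<delta>(1) that by auto
  have "crossing_chart D x y \<kappa> \<alpha> \<beta>"
    unfolding crossing_chart_def
  proof (intro conjI ballI)
    show "continuous_on window \<kappa>"
      unfolding \<kappa>_def using LQ by (intro continuous_on_compose Lcont continuous_on_subset [OF homeomorphism_cont2 [OF U(2)]]) auto
    show "inj_on \<kappa> window"
      unfolding \<kappa>_def using LQ by (intro comp_inj_on Linj inj_on_subset [OF kinj]) auto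
    show "continuous_on {-1/2<..<2} \<alpha>"
      unfolding \<alpha>_def using ein by (intro continuous_on_compose2 [OF a(1)] continuous_intros) auto
    show "continuous_on {-1<..<4} \<beta>"
      unfolding \<beta>_def using ein by (intro continuous_on_compose2 [OF b(1)] continuous_intros) auto
    show "strict_mono_on {-1/2<..<2} \<alpha>"
      unfolding \<alpha>_def by (intro strict_mono_onI strict_mono_onD [OF \<epsilon>(2)]) auto
    show "strict_mono_on {-1<..<4} \<beta>"
      unfolding \<beta>_def by (intro strict_mono_onI strict_mono_onD [OF \<delta>(2)]) auto
    show "x = pt (\<alpha> 0)" using xa by (simp add: \<alpha>_def)
    show "y = pt (\<beta> 0)" using b0 \<eta> by (simp add: \<beta>_def)
    show "\<alpha> s < \<beta> t" if "s \<in> {-1/2<..<2}" "t \<in> {-1<..<4}" for s t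
      unfolding \<alpha>_def \<beta>_def using sep ein(1) [of s] ein(2) [of t] that by auto
    show "\<beta> t < \<alpha> u + 2 * pi" if "u \<in> {-1/2<..<2}" "t \<in> {-1<..<4}" for u t
      unfolding \<alpha>_def \<beta>_def using sep ein(1) [of u] ein(2) [of t] that by auto
    show im1: "imm D (pt (\<alpha> s)) = \<kappa> (Complex s (2 * s - 2))" if "s \<in> {-1/2<..<2}" for s
    proof -
      have e: "\<epsilon> * (s / 10) \<in> {-1<..<1}" using ein(1) [of s] that by auto
      have "L (Complex s (2 * s - 2)) = of_real (\<epsilon> * (s / 10))" by (simp add: L_def complex_eq_iff)
      then show ?thesis
        unfolding \<alpha>_def \<kappa>_def comp_apply by (simp only: a(3) [OF e] imM [OF e])
    qed
    show im2: "imm D (pt (\<beta> t)) = \<kappa> (Complex 0 (t - 2))" if "t \<in> {-1<..<4}" for t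
    proof -
      have e: "\<delta> * (t / 10) \<in> {-1<..<1}" using ein(2) [of t] that by auto
      have "L (Complex 0 (t - 2)) = \<i> * of_real (\<delta> * (t / 10))" by (simp add: L_def complex_eq_iff)
      then show ?thesis
        unfolding \<beta>_def \<kappa>_def comp_apply by (simp only: b(3) [OF e] imN [OF e])
    qed
    show "{z \<in> circles D. imm D z \<in> \<kappa> ` window} = pt ` \<alpha> ` {-1/2<..<2} \<union> pt ` \<beta> ` {-1<..<4}"
    proof (intro equalityI subsetI)
      fix z assume "z \<in> {z \<in> circles D. imm D z \<in> \<kappa> ` window}"
      then obtain w where w: "z \<in> circles D" "w \<in> window" "imm D z = k (L w)" by (auto simp: \<kappa>_def)
      then have "z \<in> M \<union> N" using pre homeomorphism_image2 [OF U(2)] LQ [OF w(2)] by blast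
      then consider u where "u \<in> {-1<..<1}" "z = m u" | u where "u \<in> {-1<..<1}" "z = m' u"
        using msurj m'surj by blast
      then show "z \<in> pt ` \<alpha> ` {-1/2<..<2} \<union> pt ` \<beta> ` {-1<..<4}"
      proof cases
        case 1
        then have "k (L w) = k (of_real u)" using imM w by simp
        moreover have "complex_of_real u \<in> ball 0 1" using axisM [OF 1(1)] by simp
        ultimately have "L w = of_real u" using inj_onD [OF kinj] LQ [OF w(2)] by blast
        then have *: "\<epsilon> * (Re w / 10) = u" "Im w = 2 * Re w - 2"
          using \<delta>(1) by (auto simp: L_def complex_eq_iff)
        then have "Re w \<in> {-1/2<..<2}" using w(2) by (auto simp: window_def)
        moreover have "z = pt (\<alpha> (Re w))" using 1 a(3) [OF 1(1)] * by (simp add: \<alpha>_def)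
        ultimately show ?thesis by blast
      next
        case 2
        then have "k (L w) = k (\<i> * of_real u)" using imN w by simp
        moreover have "\<i> * complex_of_real u \<in> ball 0 1" using axisN [OF 2(1)] by simp
        ultimately have "L w = \<i> * of_real u" using inj_onD [OF kinj] LQ [OF w(2)] by blast
        then have *: "\<delta> * ((Im w + 2) / 10) = u" "Re w = 0"
          using \<epsilon>(1) by (auto simp: L_def complex_eq_iff)
        then have "Im w + 2 \<in> {-1<..<4}" using w(2) by (auto simp: window_def)
        moreover have "z = pt (\<beta> (Im w + 2))" using 2 b(3) [OF 2(1)] * by (simp add: \<beta>_def)
        ultimately show ?thesis by blast
      qed
    next
      fix z assume "z \<in> pt ` \<alpha> ` {-1/2<..<2} \<union> pt ` \<beta> ` {-1<..<4}"
      then consider s where "s \<in> {-1/2<..<2}" "z = pt (\<alpha> s)" | t where "t \<in> {-1<..<4}" "z = pt (\<beta> t)" by blast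
      then show "z \<in> {z \<in> circles D. imm D z \<in> \<kappa> ` window}"
      proof cases
        case 1
        then have "Complex s (2 * s - 2) \<in> window" by (auto simp: window_def)
        then show ?thesis using 1 im1 pt_in_circles [OF D] by simp
      next
        case 2
        then have "Complex 0 (t - 2) \<in> window" by (auto simp: window_def)
        then show ?thesis using 2 im2 pt_in_circles [OF D] by simp
      qed
    qed
  qed
  then show thesis by (rule that)
qed

section \<open>The H(2)-move at a crossing\<close>

text \<open>The two strands near the crossing after the H(2)-move.  The first comes along the branch of x, turns
  in the unit disk from (3 - 4\<i>)/5 to -\<i>, and goes back along the branch of y; it crosses itself at -2\<i>.
  The second comes back along the branch of x to 1 and goes over to the branch of y at \<i>.  Finally,
  \<open>corner\<close> is the first strand with its curl cut off below the crossing.\<close>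

definition kink :: "real \<Rightarrow> complex" where
  "kink u = (if u \<le> 3/5 then Complex u (2 * u - 2)
    else if u \<le> 4/5 then Complex (12/5 - 3 * u) (- 4/5) else Complex 0 (- u))"

definition cap :: "real \<Rightarrow> complex" where
  "cap u = (if u \<le> 1 then Complex (2 - u) (2 - 2 * u)
    else if u \<le> 3 then Complex ((3 - u) / 2) ((u - 1) / 2) else Complex 0 (u - 2))"

definition corner :: "real \<Rightarrow> complex" where
  "corner u = (if u \<le> - 1/8 then Complex u (2 * u - 2)
    else if u \<le> 9/4 then Complex (- 1/8 + (u + 1/8) / 19) (- 9/4) else Complex 0 (- u))"

lemma continuous_kink: "continuous_on S kink"
proof -
  have "continuous_on UNIV kink"
    unfolding kink_def by (intro continuous_pieces continuous_intros) auto
  then show ?thesis by (rule continuous_on_subset) simp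
qed

lemma continuous_cap: "continuous_on S cap"
proof -
  have "continuous_on UNIV cap"
    unfolding cap_def by (intro continuous_pieces continuous_intros) auto
  then show ?thesis by (rule continuous_on_subset) simp
qed

lemma continuous_corner: "continuous_on S corner"
proof -
  have "continuous_on UNIV corner"
    unfolding corner_def by (intro continuous_pieces continuous_intros) auto
  then show ?thesis by (rule continuous_on_subset) simp
qed

lemma kink_crossing:
  assumes "kink u = kink v" "u < v"
  shows "u = 0 \<and> v = 2"
  using assms unfolding kink_def by (simp split: if_splits)

lemma inj_cap: "inj cap"
  unfolding inj_on_def cap_def by (simp split: if_splits)

lemma inj_corner: "inj corner"
  unfolding inj_on_def corner_def by (simp split: if_splits)

lemma kink_cap: "kink u \<noteq> cap v"
  unfolding kink_def cap_def by (simp split: if_splits)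

lemma norm_Complex_le: "norm (Complex a b) \<le> 1 \<longleftrightarrow> a\<^sup>2 + b\<^sup>2 \<le> 1"
  and norm_Complex_less: "norm (Complex a b) < 1 \<longleftrightarrow> a\<^sup>2 + b\<^sup>2 < 1"
  by (simp_all add: cmod_def)

lemma oblique_line_in_disk:
  "norm (Complex s (2 * s - 2)) \<le> 1 \<longleftrightarrow> s \<in> {3/5..1}"
  "norm (Complex s (2 * s - 2)) < 1 \<longleftrightarrow> s \<in> {3/5<..<1}"
proof -
  have eq: "s\<^sup>2 + (2 * s - 2)\<^sup>2 - 1 = (5 * s - 3) * (s - 1)" by (simp add: power2_eq_square algebra_simps)
  have "norm (Complex s (2 * s - 2)) \<le> 1 \<longleftrightarrow> (5 * s - 3) * (s - 1) \<le> 0"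
    unfolding norm_Complex_le eq [symmetric] by auto
  then show "norm (Complex s (2 * s - 2)) \<le> 1 \<longleftrightarrow> s \<in> {3/5..1}" by (auto simp: mult_le_0_iff)
  have "norm (Complex s (2 * s - 2)) < 1 \<longleftrightarrow> (5 * s - 3) * (s - 1) < 0"
    unfolding norm_Complex_less eq [symmetric] by auto
  then show "norm (Complex s (2 * s - 2)) < 1 \<longleftrightarrow> s \<in> {3/5<..<1}" by (auto simp: mult_less_0_iff)
qed

lemma vertical_line_in_disk:
  "norm (Complex 0 s) \<le> 1 \<longleftrightarrow> \<bar>s\<bar> \<le> 1" "norm (Complex 0 s) < 1 \<longleftrightarrow> \<bar>s\<bar> < 1"
  by (simp_all add: cmod_def)

lemma kink_in_disk:
  assumes "u \<in> {3/5..1}"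
  shows "norm (kink u) \<le> 1" "norm (kink u) < 1 \<longleftrightarrow> u \<in> {3/5<..<1}"
proof -
  have eq: "(12/5 - 3 * u)\<^sup>2 + (- 4/5)\<^sup>2 - 1 = 9 * ((u - 3/5) * (u - 1))"
    by (simp add: power2_eq_square field_simps)
  consider "u = 3/5" | "u \<in> {3/5<..4/5}" | "u \<in> {4/5<..1}" using assms by fastforce
  then have "norm (kink u) \<le> 1 \<and> (norm (kink u) < 1 \<longleftrightarrow> u \<in> {3/5<..<1})"
  proof cases
    case 1
    then show ?thesis using oblique_line_in_disk [of u] by (simp add: kink_def)
  next
    case 2
    then have "(u - 3/5) * (u - 1) < 0" by (simp add: mult_less_0_iff)
    then have "(12/5 - 3 * u)\<^sup>2 + (- 4/5)\<^sup>2 < 1" using eq by linarith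
    then have "norm (kink u) < 1" using 2 by (simp add: kink_def norm_Complex_less)
    then show ?thesis using 2 by auto
  next
    case 3
    then show ?thesis using vertical_line_in_disk [of "- u"] by (auto simp: kink_def)
  qed
  then show "norm (kink u) \<le> 1" "norm (kink u) < 1 \<longleftrightarrow> u \<in> {3/5<..<1}" by auto
qed

lemma cap_in_disk:
  assumes "u \<in> {1..3}"
  shows "norm (cap u) \<le> 1" "norm (cap u) < 1 \<longleftrightarrow> u \<in> {1<..<3}"
proof -
  have c: "cap u = Complex ((3 - u) / 2) ((u - 1) / 2)" using assms by (auto simp: cap_def)
  have eq: "((3 - u) / 2)\<^sup>2 + ((u - 1) / 2)\<^sup>2 - 1 = ((u - 1) * (u - 3)) / 2"
    by (simp add: power2_eq_square field_simps)
  have "norm (cap u) \<le> 1 \<longleftrightarrow> (u - 1) * (u - 3) \<le> 0" unfolding c norm_Complex_le using eq by linarith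
  then show "norm (cap u) \<le> 1" using assms by (simp add: mult_le_0_iff)
  have "norm (cap u) < 1 \<longleftrightarrow> (u - 1) * (u - 3) < 0" unfolding c norm_Complex_less using eq by linarith
  then show "norm (cap u) < 1 \<longleftrightarrow> u \<in> {1<..<3}" by (auto simp: mult_less_0_iff)
qed

lemma kink_in_window: "u \<in> {-1/2<..<3} \<Longrightarrow> kink u \<in> window"
  by (auto simp: kink_def window_def abs_if split: if_splits)

lemma cap_in_window: "u \<in> {0<..<4} \<Longrightarrow> cap u \<in> window"
  by (auto simp: cap_def window_def abs_if field_simps split: if_splits)

lemma open_window: "open window"
  unfolding window_def by (intro open_Collect_conj open_Collect_less continuous_intros)

lemma disk_in_window: "cball 0 1 \<subseteq> window"
proof
  fix w :: complex assume "w \<in> cball 0 1"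
  then have "\<bar>Re w\<bar> \<le> 1" "\<bar>Im w\<bar> \<le> 1"
    using abs_Re_le_cmod [of w] abs_Im_le_cmod [of w] by auto
  then show "w \<in> window" by (auto simp: window_def)
qed

lemma strict_mono_interval_image:
  fixes f :: "real \<Rightarrow> real"
  assumes "continuous_on S f" "strict_mono_on S f" "{u..v} \<subseteq> S" "u \<le> v"
  shows "f ` {u..v} = {f u..f v}"
proof (intro equalityI subsetI)
  fix r assume "r \<in> {f u..f v}"
  then show "r \<in> f ` {u..v}"
    using IVT' [of f u r v] continuous_on_subset [OF assms(1,3)] assms(4) by fastforce
next
  fix r assume "r \<in> f ` {u..v}"
  then obtain s where s: "s \<in> {u..v}" "r = f s" by blast
  moreover have "u \<in> S" "v \<in> S" "s \<in> S" using assms(3,4) s(1) by auto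
  ultimately show "r \<in> {f u..f v}"
    using strict_mono_on_leD [OF assms(2)] by auto
qed

lemma strict_mono_inverse_continuous:
  fixes f :: "real \<Rightarrow> real"
  assumes "continuous_on S f" "strict_mono_on S f" "open S"
  shows "continuous_on (f ` S) (inv_into S f)"
proof -
  have "inj_on f S" using assms(2) by (rule strict_mono_on_imp_inj_on)
  then obtain k where "homeomorphism S (f ` S) f k"
    using invariance_of_domain_homeomorphism [OF assms(3,1)] by auto
  then show ?thesis by (rule homeomorphism_cont2 [OF homeomorphism_inv_into])
qed

text \<open>The circle is a quotient of the interval: the angular parametrization maps closed sets to closed sets.\<close>

lemma continuous_on_circle:
  fixes G :: "nat \<times> complex \<Rightarrow> 'b :: topological_space"
  assumes "continuous_on {a..a + 2 * pi} G'" "\<And>t. t \<in> {a..a + 2 * pi} \<Longrightarrow> G (pt t) = G' t"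
    and D: "ncomp D = 1"
  shows "continuous_on (circles D) G"
  unfolding continuous_on_closed_invariant
proof (intro allI impI)
  fix B :: "'b set" assume "closed B"
  then have "compact ({a..a + 2 * pi} \<inter> G' -` B)"
    using continuous_closed_preimage [OF assms(1)] compact_Int_closed [of "{a..a+2*pi}"]
    by (metis Int_left_absorb closed_atLeastAtMost compact_Icc)
  then have "closed (pt ` ({a..a + 2 * pi} \<inter> G' -` B))"
    by (intro compact_imp_closed compact_continuous_image continuous_pt)
  moreover have "pt ` ({a..a + 2 * pi} \<inter> G' -` B) \<inter> circles D = G -` B \<inter> circles D"
  proof (intro equalityI subsetI)
    fix z assume z: "z \<in> G -` B \<inter> circles D"
    then obtain t where "a \<le> t" "t < a + 2 * pi" "z = pt t"
      using circles_eq_pt [OF D, of z a] by blast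
    then show "z \<in> pt ` ({a..a + 2 * pi} \<inter> G' -` B) \<inter> circles D"
      using z assms(2) by auto
  qed (use assms(2) in auto)
  ultimately show "\<exists>A. closed A \<and> A \<inter> circles D = G -` B \<inter> circles D" by blast
qed

lemma continuous_on_if_interval:
  fixes f g :: "real \<Rightarrow> 'b :: topological_space"
  assumes "continuous_on {a..c} f" "continuous_on {c..b} g" "f c = g c" "a \<le> c" "c \<le> b"
  shows "continuous_on {a..b} (\<lambda>s. if s \<le> c then f s else g s)"
proof -
  have "continuous_on ({a..c} \<union> {c..b}) (\<lambda>s. if s \<le> c then f s else g s)"
    using assms by (intro continuous_on_cases) auto
  moreover have "{a..c} \<union> {c..b} = {a..b}" using assms by auto
  ultimately show ?thesis by simp
qed

text \<open>In this locale the arc of the knot from the end of one strand in the unit disk to the end of the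
  other is reversed.  Its angles are those between \<open>\<alpha> 1\<close> and \<open>\<beta> 1\<close>, and the strands in the unit disk
  have the angles from \<open>\<alpha> (3/5)\<close> to \<open>\<alpha> 1\<close> and from \<open>\<beta> 1\<close> to \<open>\<beta> 3\<close>.\<close>

locale crossing_flip =
  fixes V :: vdiagram and x y :: "nat \<times> complex" and \<kappa> :: "complex \<Rightarrow> complex" and \<alpha> \<beta> :: "real \<Rightarrow> real"
  assumes knot: "virtual_knot_diagram V" and chart: "crossing_chart V x y \<kappa> \<alpha> \<beta>"
begin

abbreviation "dom_\<alpha> \<equiv> {-1/2<..<2 :: real}"
abbreviation "dom_\<beta> \<equiv> {-1<..<4 :: real}"

lemma chart_facts:
  "continuous_on window \<kappa>" "inj_on \<kappa> window"
  "continuous_on dom_\<alpha> \<alpha>" "strict_mono_on dom_\<alpha> \<alpha>" "continuous_on dom_\<beta> \<beta>" "strict_mono_on dom_\<beta> \<beta>"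
  "\<And>s t. s \<in> dom_\<alpha> \<Longrightarrow> t \<in> dom_\<beta> \<Longrightarrow> \<alpha> s < \<beta> t"
  "\<And>s t. s \<in> dom_\<alpha> \<Longrightarrow> t \<in> dom_\<beta> \<Longrightarrow> \<beta> t < \<alpha> s + 2 * pi"
  "x = pt (\<alpha> 0)" "y = pt (\<beta> 0)"
  "\<And>s. s \<in> dom_\<alpha> \<Longrightarrow> imm V (pt (\<alpha> s)) = \<kappa> (Complex s (2 * s - 2))"
  "\<And>t. t \<in> dom_\<beta> \<Longrightarrow> imm V (pt (\<beta> t)) = \<kappa> (Complex 0 (t - 2))"
  "{z \<in> circles V. imm V z \<in> \<kappa> ` window} = pt ` \<alpha> ` dom_\<alpha> \<union> pt ` \<beta> ` dom_\<beta>"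
  using chart unfolding crossing_chart_def by blast+

lemma V1: "ncomp V = 1" and V_cont: "continuous_on (circles V) (imm V)" and V_imm: "immersed V" and V_gen: "generic V"
  using knot by (auto simp: virtual_knot_diagram_def virtual_link_diagram_def immersed_def)

lemma \<alpha>_less: "\<lbrakk>s \<in> dom_\<alpha>; t \<in> dom_\<alpha>\<rbrakk> \<Longrightarrow> \<alpha> s < \<alpha> t \<longleftrightarrow> s < t"
  and \<beta>_less: "\<lbrakk>s \<in> dom_\<beta>; t \<in> dom_\<beta>\<rbrakk> \<Longrightarrow> \<beta> s < \<beta> t \<longleftrightarrow> s < t"
  and \<alpha>_le: "\<lbrakk>s \<in> dom_\<alpha>; t \<in> dom_\<alpha>\<rbrakk> \<Longrightarrow> \<alpha> s \<le> \<alpha> t \<longleftrightarrow> s \<le> t"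
  and \<beta>_le: "\<lbrakk>s \<in> dom_\<beta>; t \<in> dom_\<beta>\<rbrakk> \<Longrightarrow> \<beta> s \<le> \<beta> t \<longleftrightarrow> s \<le> t"
  using strict_mono_on_less [OF chart_facts(4)] strict_mono_on_less [OF chart_facts(6)]
    strict_mono_on_less_eq [OF chart_facts(4)] strict_mono_on_less_eq [OF chart_facts(6)] by blast+

text \<open>The knot is cut open just before the first branch; both branches then lie inside one period of the angle.\<close>

definition start :: real where "start = Inf (\<alpha> ` dom_\<alpha>)"

lemma \<alpha>_bounds: "s \<in> dom_\<alpha> \<Longrightarrow> start < \<alpha> s" "s \<in> dom_\<alpha> \<Longrightarrow> \<alpha> s < start + 2 * pi"
  and \<beta>_bounds: "t \<in> dom_\<beta> \<Longrightarrow> start < \<beta> t" "t \<in> dom_\<beta> \<Longrightarrow> \<beta> t < start + 2 * pi"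
proof -
  have bdd: "bdd_below (\<alpha> ` dom_\<alpha>)"
    by (rule bdd_belowI [of _ "\<beta> 0 - 2 * pi"]) (use chart_facts(8) [of _ 0] in \<open>auto simp: less_imp_le algebra_simps\<close>)
  show 1: "start < \<alpha> s" if s: "s \<in> dom_\<alpha>" for s
  proof -
    define s' where "s' = (s - 1/2) / 2"
    have s': "s' \<in> dom_\<alpha>" "s' < s" using s by (auto simp: s'_def)
    have "start \<le> \<alpha> s'" unfolding start_def using s' by (intro cInf_lower bdd) auto
    then show ?thesis using \<alpha>_less [OF s'(1) s] s'(2) by linarith
  qed
  show 2: "\<beta> t < start + 2 * pi" if t: "t \<in> dom_\<beta>" for t
  proof -
    define t' where "t' = (t + 4) / 2"
    have t': "t' \<in> dom_\<beta>" "t < t'" using t by (auto simp: t'_def)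
    have "\<beta> t' - 2 * pi \<le> start"
      unfolding start_def
    proof (rule cInf_greatest)
      fix u assume "u \<in> \<alpha> ` dom_\<alpha>"
      then obtain s where "s \<in> dom_\<alpha>" "u = \<alpha> s" by blast
      then show "\<beta> t' - 2 * pi \<le> u" using chart_facts(8) [of s t'] t' by linarith
    qed auto
    then show ?thesis using \<beta>_less [OF t t'(1)] t'(2) by linarith
  qed
  show "\<alpha> s < start + 2 * pi" if "s \<in> dom_\<alpha>" for s
    using chart_facts(7) [OF that, of 0] 2 [of 0] by auto
  show "start < \<beta> t" if "t \<in> dom_\<beta>" for t
    using chart_facts(7) [of 0 t] 1 [of 0] that by auto
qed

definition ang :: "nat \<times> complex \<Rightarrow> real" where
  "ang z = (SOME t. start \<le> t \<and> t < start + 2 * pi \<and> pt t = z)"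

lemma ang_pt: "start \<le> t \<Longrightarrow> t < start + 2 * pi \<Longrightarrow> ang (pt t) = t"
  unfolding ang_def by (rule some_equality) (use pt_eq_iff in \<open>auto simp: abs_less_iff\<close>)

lemma ang:
  assumes "z \<in> circles V"
  shows "start \<le> ang z" "ang z < start + 2 * pi" "pt (ang z) = z"
proof -
  obtain t where "start \<le> t" "t < start + 2 * pi" "z = pt t"
    using circles_eq_pt [OF V1 assms] by blast
  then show "start \<le> ang z" "ang z < start + 2 * pi" "pt (ang z) = z" using ang_pt by auto
qed

lemma ang_\<alpha>: "s \<in> dom_\<alpha> \<Longrightarrow> ang (pt (\<alpha> s)) = \<alpha> s"
  and ang_\<beta>: "t \<in> dom_\<beta> \<Longrightarrow> ang (pt (\<beta> t)) = \<beta> t"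
  using ang_pt \<alpha>_bounds \<beta>_bounds less_imp_le by blast+

text \<open>The map t \<mapsto> turn - t reverses the interval of angles from \<open>\<alpha> 1\<close> to \<open>\<beta> 1\<close>.\<close>

definition turn :: real where "turn = \<alpha> 1 + \<beta> 1"

lemma order: "\<alpha> (3/5) < \<alpha> 1" "\<alpha> 1 < \<beta> 1" "\<beta> 1 < \<beta> 3" "start < \<alpha> (3/5)" "\<beta> 3 < start + 2 * pi"
  using chart_facts(7) [of 1 1] \<alpha>_bounds(1) [of "3/5"] \<beta>_bounds(2) [of 3] by (auto simp: \<alpha>_less \<beta>_less)

text \<open>The new curve, as a function of the angle: each case is a stretch of the knot between strand ends.\<close>

definition flip_path :: "real \<Rightarrow> complex" where
  "flip_path t = (if t \<le> \<alpha> (3/5) then imm V (pt t)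
     else if t \<le> \<alpha> 1 then \<kappa> (kink (inv_into dom_\<alpha> \<alpha> t))
     else if t \<le> \<beta> 1 then imm V (pt (turn - t))
     else if t \<le> \<beta> 3 then \<kappa> (cap (inv_into dom_\<beta> \<beta> t))
     else imm V (pt t))"

lemma inv_\<alpha>: "s \<in> dom_\<alpha> \<Longrightarrow> inv_into dom_\<alpha> \<alpha> (\<alpha> s) = s"
  and inv_\<beta>: "t \<in> dom_\<beta> \<Longrightarrow> inv_into dom_\<beta> \<beta> (\<beta> t) = t"
  using chart_facts(4,6) strict_mono_on_imp_inj_on inv_into_f_f by metis+

lemma flip_path_cont: "continuous_on {start..start + 2 * pi} flip_path"
proof -
  have c: "continuous_on S (\<lambda>t. imm V (pt (f t)))" if "continuous_on S f" for f and S :: "real set"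
    using that pt_in_circles [OF V1]
    by (intro continuous_on_compose2 [OF V_cont] continuous_on_compose2 [OF continuous_pt [of UNIV]]) auto
  have ia: "\<alpha> ` {3/5..1} = {\<alpha> (3/5)..\<alpha> 1}" by (rule strict_mono_interval_image [OF chart_facts(3,4)]) auto
  have ib: "\<beta> ` {1..3} = {\<beta> 1..\<beta> 3}" by (rule strict_mono_interval_image [OF chart_facts(5,6)]) auto
  have ca: "continuous_on {\<alpha> (3/5)..\<alpha> 1} (\<lambda>t. \<kappa> (kink (inv_into dom_\<alpha> \<alpha> t)))"
  proof (intro continuous_on_compose2 [OF chart_facts(1)] continuous_on_compose2 [OF continuous_kink [of UNIV]])
    show "continuous_on {\<alpha> (3/5)..\<alpha> 1} (inv_into dom_\<alpha> \<alpha>)"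
      unfolding ia [symmetric] by (intro continuous_on_subset [OF strict_mono_inverse_continuous [OF chart_facts(3,4)]] image_mono) auto
    show "(\<lambda>t. kink (inv_into dom_\<alpha> \<alpha> t)) ` {\<alpha> (3/5)..\<alpha> 1} \<subseteq> window"
      unfolding ia [symmetric]
    proof (rule image_subsetI)
      fix t assume "t \<in> \<alpha> ` {3/5..1}"
      then obtain s where s: "s \<in> {3/5..1}" "t = \<alpha> s" by blast
      then have "s \<in> dom_\<alpha>" "s \<in> {-1/2<..<3}" by auto
      then show "kink (inv_into dom_\<alpha> \<alpha> t) \<in> window"
        using kink_in_window [of s] inv_\<alpha> [of s] s(2) by simp
    qed
  qed auto
  have cb: "continuous_on {\<beta> 1..\<beta> 3} (\<lambda>t. \<kappa> (cap (inv_into dom_\<beta> \<beta> t)))"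
  proof (intro continuous_on_compose2 [OF chart_facts(1)] continuous_on_compose2 [OF continuous_cap [of UNIV]])
    show "continuous_on {\<beta> 1..\<beta> 3} (inv_into dom_\<beta> \<beta>)"
      unfolding ib [symmetric] by (intro continuous_on_subset [OF strict_mono_inverse_continuous [OF chart_facts(5,6)]] image_mono) auto
    show "(\<lambda>t. cap (inv_into dom_\<beta> \<beta> t)) ` {\<beta> 1..\<beta> 3} \<subseteq> window"
      unfolding ib [symmetric]
    proof (rule image_subsetI)
      fix t assume "t \<in> \<beta> ` {1..3}"
      then obtain s where s: "s \<in> {1..3}" "t = \<beta> s" by blast
      then have "s \<in> dom_\<beta>" "s \<in> {0<..<4}" by auto
      then show "cap (inv_into dom_\<beta> \<beta> t) \<in> window"
        using cap_in_window [of s] inv_\<beta> [of s] s(2) by simp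
    qed
  qed auto
  have i: "inv_into dom_\<alpha> \<alpha> (\<alpha> (3/5)) = 3/5" "inv_into dom_\<alpha> \<alpha> (\<alpha> 1) = 1"
    "inv_into dom_\<beta> \<beta> (\<beta> 1) = 1" "inv_into dom_\<beta> \<beta> (\<beta> 3) = 3"
    by (rule inv_\<alpha> inv_\<beta>; simp)+
  have k: "kink (inv_into dom_\<alpha> \<alpha> (\<alpha> (3/5))) = Complex (3/5) (- (4/5))"
    by (subst inv_\<alpha>) (auto simp: kink_def)
  show ?thesis
    unfolding flip_path_def
  proof (intro continuous_on_if_interval c ca cb continuous_intros)
  qed (use order i(2-4) k chart_facts(11) [of "3/5"] chart_facts(11) [of 1] chart_facts(12) [of 1] chart_facts(12) [of 3]
    in \<open>auto simp: kink_def cap_def turn_def\<close>)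
qed

definition imm_flip :: "nat \<times> complex \<Rightarrow> complex" where
  "imm_flip z = flip_path (ang z)"

lemma imm_flip_pt: "t \<in> {start..start + 2 * pi} \<Longrightarrow> imm_flip (pt t) = flip_path t"
proof (cases "t = start + 2 * pi")
  case True
  have "flip_path (start + 2 * pi) = flip_path start"
    using order pt_add_2pi(1) [of start] by (simp add: flip_path_def)
  moreover have "ang (pt (start + 2 * pi)) = start"
    using ang_pt [of start] by (simp add: pt_add_2pi)
  ultimately show ?thesis using True by (simp add: imm_flip_def)
qed (simp add: imm_flip_def ang_pt)

text \<open>An over-crossing is carried along by the reversal.  The strands in the unit disk have no crossings.\<close>

definition flip :: vdiagram where
  "flip = \<lparr>ncomp = 1, imm = imm_flip,
     over = {z \<in> circles V. ang z \<notin> {\<alpha> (3/5)..\<alpha> 1} \<union> {\<beta> 1..\<beta> 3} \<and>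
       (if ang z \<in> {\<alpha> 1..\<beta> 1} then pt (turn - ang z) else z) \<in> over V}\<rparr>"

lemma flip_simps: "ncomp flip = 1" "imm flip = imm_flip" "circles flip = circles V"
  using V1 by (simp_all add: flip_def circles_def)

lemma flip_cont: "continuous_on (circles V) imm_flip"
  by (rule continuous_on_circle [OF flip_path_cont imm_flip_pt V1])

definition rev_arc :: "nat \<times> complex \<Rightarrow> nat \<times> complex" where
  "rev_arc z = (if ang z \<in> {\<alpha> 1..\<beta> 1} then pt (turn - ang z) else z)"

text \<open>The parts of the circle which lie over the unit disk, and over the complement of its interior, for
  the old and for the new diagram alike (\<open>V_preimage_disk\<close>, \<open>flip_preimage_disk\<close>).\<close>

definition inner :: "(nat \<times> complex) set" where
  "inner = {z \<in> circles V. ang z \<in> {\<alpha> (3/5)..\<alpha> 1} \<union> {\<beta> 1..\<beta> 3}}"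

definition outer :: "(nat \<times> complex) set" where
  "outer = {z \<in> circles V. ang z \<notin> {\<alpha> (3/5)<..<\<alpha> 1} \<union> {\<beta> 1<..<\<beta> 3}}"

lemma over_flip: "over flip = {z \<in> circles V - inner. rev_arc z \<in> over V}"
  by (auto simp: flip_def inner_def rev_arc_def)

lemma rev_arc_circles: "z \<in> circles V \<Longrightarrow> rev_arc z \<in> circles V"
  by (simp add: rev_arc_def pt_in_circles [OF V1])

lemma ang_rev_arc:
  assumes "z \<in> circles V"
  shows "ang (rev_arc z) = (if ang z \<in> {\<alpha> 1..\<beta> 1} then turn - ang z else ang z)"
  using assms order by (auto simp: rev_arc_def turn_def intro!: ang_pt)

lemma rev_arc_rev_arc: "z \<in> circles V \<Longrightarrow> rev_arc (rev_arc z) = z"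
  using ang_rev_arc [of z] ang(3) [of z] by (auto simp: rev_arc_def turn_def split: if_splits)

lemma rev_arc_inner: "z \<in> circles V \<Longrightarrow> rev_arc z \<in> inner \<longleftrightarrow> z \<in> inner"
  using ang_rev_arc [of z] rev_arc_circles [of z] order by (auto simp: inner_def turn_def split: if_splits)

lemma rev_arc_outer: "z \<in> circles V \<Longrightarrow> rev_arc z \<in> outer \<longleftrightarrow> z \<in> outer"
  using ang_rev_arc [of z] rev_arc_circles [of z] order by (auto simp: outer_def turn_def split: if_splits)

lemma inner_outer: "z \<in> circles V \<Longrightarrow> z \<notin> inner \<Longrightarrow> z \<in> outer"
  by (auto simp: inner_def outer_def)

lemma imm_flip_outer:
  assumes "z \<in> outer"
  shows "imm_flip z = imm V (rev_arc z)"
proof -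
  have z: "z \<in> circles V" using assms by (simp add: outer_def)
  define t where "t = ang z"
  have t: "start \<le> t" "t < start + 2 * pi" "pt t = z" using ang [OF z] by (simp_all add: t_def)
  have i: "inv_into dom_\<alpha> \<alpha> (\<alpha> (3/5)) = 3/5" "inv_into dom_\<alpha> \<alpha> (\<alpha> 1) = 1"
    "inv_into dom_\<beta> \<beta> (\<beta> 1) = 1" "inv_into dom_\<beta> \<beta> (\<beta> 3) = 3"
    by (rule inv_\<alpha> inv_\<beta>; simp)+
  have tP: "t \<notin> {\<alpha> (3/5)<..<\<alpha> 1} \<union> {\<beta> 1<..<\<beta> 3}" using assms by (simp add: outer_def t_def)
  have eq: "imm_flip z = flip_path t" "rev_arc z = (if t \<in> {\<alpha> 1..\<beta> 1} then pt (turn - t) else z)"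
    by (simp_all add: imm_flip_def rev_arc_def t_def)
  consider "t \<le> \<alpha> (3/5)" | "t = \<alpha> 1" | "\<alpha> 1 < t" "t \<le> \<beta> 1" | "t = \<beta> 3" | "\<beta> 3 < t"
    using tP order by fastforce
  then show ?thesis
  proof cases
    case 1 then show ?thesis using order t by (simp add: eq flip_path_def)
  next
    case 2 then show ?thesis using order i chart_facts(12) [of 1] by (simp add: eq flip_path_def kink_def turn_def)
  next
    case 3 then show ?thesis using order by (simp add: eq flip_path_def)
  next
    case 4 then show ?thesis using order i chart_facts(12) [of 3] t by (simp add: eq flip_path_def cap_def)
  next
    case 5 then show ?thesis using order t by (simp add: eq flip_path_def)
  qed
qed

lemma inner_cases:
  assumes "z \<in> inner"
  obtains s where "s \<in> {3/5..1}" "z = pt (\<alpha> s)" "imm_flip z = \<kappa> (kink s)"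
  | s where "s \<in> {1..3}" "z = pt (\<beta> s)" "imm_flip z = \<kappa> (cap s)"
proof -
  have z: "z \<in> circles V" "pt (ang z) = z" using assms ang(3) by (auto simp: inner_def)
  have ia: "\<alpha> ` {3/5..1} = {\<alpha> (3/5)..\<alpha> 1}" by (rule strict_mono_interval_image [OF chart_facts(3,4)]) auto
  have ib: "\<beta> ` {1..3} = {\<beta> 1..\<beta> 3}" by (rule strict_mono_interval_image [OF chart_facts(5,6)]) auto
  have "ang z \<in> \<alpha> ` {3/5..1} \<or> ang z \<in> \<beta> ` {1..3}" using assms ia ib by (auto simp: inner_def)
  then consider s where "s \<in> {3/5..1}" "ang z = \<alpha> s" | s where "s \<in> {1..3}" "ang z = \<beta> s" by blast
  then show thesis
  proof cases
    case 1
    then have "s \<in> dom_\<alpha>" by auto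
    have "flip_path (\<alpha> s) = \<kappa> (kink s)"
    proof (cases "s = 3/5")
      case True
      show ?thesis unfolding True using chart_facts(11) [of "3/5"] by (simp add: flip_path_def kink_def)
    next
      case False
      then have "\<not> \<alpha> s \<le> \<alpha> (3/5)" "\<alpha> s \<le> \<alpha> 1" using 1 \<open>s \<in> dom_\<alpha>\<close> by (auto simp: \<alpha>_le)
      then show ?thesis using inv_\<alpha> [OF \<open>s \<in> dom_\<alpha>\<close>] by (simp add: flip_path_def)
    qed
    then show thesis using that(1) 1 z by (simp add: imm_flip_def)
  next
    case 2
    then have s: "s \<in> dom_\<beta>" by auto
    have "flip_path (\<beta> s) = \<kappa> (cap s)"
    proof (cases "s = 1")
      case True
      show ?thesis unfolding True using chart_facts(11) [of 1] order by (simp add: flip_path_def cap_def turn_def)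
    next
      case False
      then have "\<not> \<beta> s \<le> \<beta> 1" "\<beta> s \<le> \<beta> 3" using 2 s by (auto simp: \<beta>_le)
      moreover from this have "\<not> \<beta> s \<le> \<alpha> 1" "\<not> \<beta> s \<le> \<alpha> (3/5)" using order by linarith+
      ultimately show ?thesis using inv_\<beta> [OF s] by (simp add: flip_path_def)
    qed
    then show thesis using that(2) 2 z by (simp add: imm_flip_def)
  qed
qed

text \<open>The angles of the points of \<open>kink\<close> and \<open>cap\<close>: past the strand in the unit disk, the first continues
  into the beginning of the reversed arc, and the second comes from its end.\<close>

definition kink_angle :: "real \<Rightarrow> real" where
  "kink_angle u = (if u \<le> 1 then \<alpha> u else turn - \<beta> (2 - u))"

definition cap_angle :: "real \<Rightarrow> real" where
  "cap_angle u = (if u \<le> 1 then turn - \<alpha> (2 - u) else \<beta> u)"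

abbreviation "dom_kink \<equiv> {-1/2<..<3 :: real}"
abbreviation "dom_cap \<equiv> {0<..<4 :: real}"

lemma kink_angle_mono: "strict_mono_on dom_kink kink_angle"
proof (rule strict_mono_onI)
  fix u v :: real assume uv: "u \<in> dom_kink" "v \<in> dom_kink" "u < v"
  consider "v \<le> 1" | "u \<le> 1" "1 < v" | "1 < u" by linarith
  then show "kink_angle u < kink_angle v"
  proof cases
    case 1 then show ?thesis using uv by (simp add: kink_angle_def \<alpha>_less)
  next
    case 2
    then have "\<alpha> u \<le> \<alpha> 1" "\<beta> (2 - v) < \<beta> 1" using uv by (auto simp: \<alpha>_le \<beta>_less)
    then show ?thesis using 2 by (simp add: kink_angle_def turn_def)
  next
    case 3
    then have "\<beta> (2 - v) < \<beta> (2 - u)" using uv by (simp add: \<beta>_less)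
    then show ?thesis using 3 uv by (simp add: kink_angle_def)
  qed
qed

lemma cap_angle_mono: "strict_mono_on dom_cap cap_angle"
proof (rule strict_mono_onI)
  fix u v :: real assume uv: "u \<in> dom_cap" "v \<in> dom_cap" "u < v"
  consider "v \<le> 1" | "u \<le> 1" "1 < v" | "1 < u" by linarith
  then show "cap_angle u < cap_angle v"
  proof cases
    case 1
    then have "\<alpha> (2 - v) < \<alpha> (2 - u)" using uv by (simp add: \<alpha>_less)
    then show ?thesis using 1 uv by (simp add: cap_angle_def)
  next
    case 2
    then have "\<alpha> 1 \<le> \<alpha> (2 - u)" "\<beta> 1 < \<beta> v" using uv by (auto simp: \<alpha>_le \<beta>_less)
    then show ?thesis using 2 by (simp add: cap_angle_def turn_def)
  next
    case 3
    then show ?thesis using uv by (simp add: cap_angle_def \<beta>_less)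
  qed
qed

lemma kink_angle_cont: "continuous_on dom_kink kink_angle"
proof -
  have "continuous_on ({-1/2<..1} \<union> {1..<3}) (\<lambda>u. if u \<le> 1 then \<alpha> u else turn - \<beta> (2 - u))"
  proof (rule continuous_on_cases_local)
    show "closedin (top_of_set ({-1/2<..1} \<union> {1..<3})) {-1/2<..(1::real)}"
      unfolding closedin_closed by (intro exI [of _ "{..1}"]) auto
    show "closedin (top_of_set ({-1/2<..1} \<union> {1..<3})) {1..<(3::real)}"
      unfolding closedin_closed by (intro exI [of _ "{1..}"]) auto
  qed (auto simp: turn_def intro!: continuous_intros continuous_on_compose2 [OF chart_facts(5)] continuous_on_subset [OF chart_facts(3)])
  moreover have "{-1/2<..1} \<union> {1..<3} = dom_kink" by auto
  ultimately show ?thesis unfolding kink_angle_def by simp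
qed

lemma cap_angle_cont: "continuous_on dom_cap cap_angle"
proof -
  have "continuous_on ({0<..1} \<union> {1..<4}) (\<lambda>u. if u \<le> 1 then turn - \<alpha> (2 - u) else \<beta> u)"
  proof (rule continuous_on_cases_local)
    show "closedin (top_of_set ({0<..1} \<union> {1..<4})) {0<..(1::real)}"
      unfolding closedin_closed by (intro exI [of _ "{..1}"]) auto
    show "closedin (top_of_set ({0<..1} \<union> {1..<4})) {1..<(4::real)}"
      unfolding closedin_closed by (intro exI [of _ "{1..}"]) auto
  qed (auto simp: turn_def intro!: continuous_intros continuous_on_compose2 [OF chart_facts(3)] continuous_on_subset [OF chart_facts(5)])
  moreover have "{0<..1} \<union> {1..<4} = dom_cap" by auto
  ultimately show ?thesis unfolding cap_angle_def by simp
qed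

lemma imm_flip_middle:
  assumes "t \<in> {\<alpha> 1..\<beta> 1}"
  shows "imm_flip (pt t) = imm V (pt (turn - t))"
proof -
  have t: "start \<le> t" "t < start + 2 * pi" using assms order by auto
  have "pt t \<in> outer" using assms order ang_pt [OF t] pt_in_circles [OF V1] by (auto simp: outer_def)
  then show ?thesis using imm_flip_outer ang_pt [OF t] assms by (simp add: rev_arc_def)
qed

lemma imm_flip_outside:
  assumes "start \<le> t" "t < start + 2 * pi" "t \<le> \<alpha> (3/5) \<or> \<beta> 3 \<le> t"
  shows "imm_flip (pt t) = imm V (pt t)"
proof -
  have "pt t \<in> outer" using assms order ang_pt [OF assms(1,2)] pt_in_circles [OF V1] by (auto simp: outer_def)
  moreover have "rev_arc (pt t) = pt t" using assms order ang_pt [OF assms(1,2)] by (auto simp: rev_arc_def)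
  ultimately show ?thesis using imm_flip_outer by simp
qed

lemma inner_mem: "s \<in> {3/5..1} \<Longrightarrow> pt (\<alpha> s) \<in> inner" "t \<in> {1..3} \<Longrightarrow> pt (\<beta> t) \<in> inner"
proof -
  assume "s \<in> {3/5..1}"
  then have "s \<in> dom_\<alpha>" "s \<in> {3/5..1}" by auto
  then show "pt (\<alpha> s) \<in> inner"
    using \<alpha>_le [of "3/5" s] \<alpha>_le [of s 1] pt_in_circles [OF V1] by (simp add: inner_def ang_\<alpha>)
next
  assume "t \<in> {1..3}"
  then have "t \<in> dom_\<beta>" "t \<in> {1..3}" by auto
  then show "pt (\<beta> t) \<in> inner"
    using \<beta>_le [of 1 t] \<beta>_le [of t 3] pt_in_circles [OF V1] by (simp add: inner_def ang_\<beta>)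
qed

lemma \<alpha>_inj: "s \<in> dom_\<alpha> \<Longrightarrow> t \<in> dom_\<alpha> \<Longrightarrow> pt (\<alpha> s) = pt (\<alpha> t) \<longleftrightarrow> s = t"
  and \<beta>_inj: "s \<in> dom_\<beta> \<Longrightarrow> t \<in> dom_\<beta> \<Longrightarrow> pt (\<beta> s) = pt (\<beta> t) \<longleftrightarrow> s = t"
  and \<alpha>\<beta>_ne: "s \<in> dom_\<alpha> \<Longrightarrow> t \<in> dom_\<beta> \<Longrightarrow> pt (\<alpha> s) \<noteq> pt (\<beta> t)"
  using ang_\<alpha> ang_\<beta> inv_\<alpha> inv_\<beta> chart_facts(7) by (metis, metis, metis less_irrefl)

lemma imm_flip_inner:
  "s \<in> {3/5..1} \<Longrightarrow> imm_flip (pt (\<alpha> s)) = \<kappa> (kink s)"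
  "t \<in> {1..3} \<Longrightarrow> imm_flip (pt (\<beta> t)) = \<kappa> (cap t)"
proof -
  assume s: "s \<in> {3/5..1}"
  show "imm_flip (pt (\<alpha> s)) = \<kappa> (kink s)"
  proof (rule inner_cases [OF inner_mem(1) [OF s]])
    fix u assume u: "u \<in> {3/5..1}" "pt (\<alpha> s) = pt (\<alpha> u)" "imm_flip (pt (\<alpha> s)) = \<kappa> (kink u)"
    then have "s = u" using \<alpha>_inj [of s u] s by auto
    then show ?thesis using u by simp
  next
    fix u assume u: "u \<in> {1..3}" "pt (\<alpha> s) = pt (\<beta> u)"
    then show ?thesis using \<alpha>\<beta>_ne [of s u] s by auto
  qed
next
  assume s: "t \<in> {1..3}"
  show "imm_flip (pt (\<beta> t)) = \<kappa> (cap t)"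
  proof (rule inner_cases [OF inner_mem(2) [OF s]])
    fix u assume u: "u \<in> {3/5..1}" "pt (\<beta> t) = pt (\<alpha> u)"
    then show ?thesis using \<alpha>\<beta>_ne [of u t] s by auto
  next
    fix u assume u: "u \<in> {1..3}" "pt (\<beta> t) = pt (\<beta> u)" "imm_flip (pt (\<beta> t)) = \<kappa> (cap u)"
    then have "t = u" using \<beta>_inj [of t u] s by auto
    then show ?thesis using u by simp
  qed
qed

lemma kink_angle_bounds: "u \<in> dom_kink \<Longrightarrow> kink_angle u \<in> {start<..<start + 2 * pi}"
  and cap_angle_bounds: "u \<in> dom_cap \<Longrightarrow> cap_angle u \<in> {start<..<start + 2 * pi}"
proof -
  have m: "turn - \<beta> v \<in> {\<alpha> 1..\<beta> 1}" if "v \<in> dom_\<beta>" "v \<le> 1" for v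
    using that \<beta>_le [of v 1] chart_facts(7) [of 1 v] by (auto simp: turn_def)
  have m': "turn - \<alpha> v \<in> {\<alpha> 1..\<beta> 1}" if "v \<in> dom_\<alpha>" "1 \<le> v" for v
    using that \<alpha>_le [of 1 v] chart_facts(7) [of v 1] by (auto simp: turn_def)
  show "kink_angle u \<in> {start<..<start + 2 * pi}" if "u \<in> dom_kink"
    using that m [of "2 - u"] \<alpha>_bounds [of u] order by (auto simp: kink_angle_def)
  show "cap_angle u \<in> {start<..<start + 2 * pi}" if "u \<in> dom_cap"
    using that m' [of "2 - u"] \<beta>_bounds [of u] order by (auto simp: cap_angle_def)
qed

lemma imm_flip_kink_angle:
  assumes "u \<in> dom_kink"
  shows "imm_flip (pt (kink_angle u)) = \<kappa> (kink u)"
proof -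
  consider "u \<in> {-1/2<..<3/5}" | "u \<in> {3/5..1}" | "u \<in> {1<..<3}" using assms by fastforce
  then show ?thesis
  proof cases
    case 1
    then have "u \<in> dom_\<alpha>" by auto
    then show ?thesis
      using 1 imm_flip_outside [of "\<alpha> u"] \<alpha>_bounds [of u] \<alpha>_le [of u "3/5"] chart_facts(11) [of u]
      by (simp add: kink_angle_def kink_def)
  next
    case 2
    then show ?thesis using imm_flip_inner(1) by (simp add: kink_angle_def)
  next
    case 3
    then have v: "2 - u \<in> dom_\<beta>" "2 - u \<le> 1" by auto
    have "turn - \<beta> (2 - u) \<in> {\<alpha> 1..\<beta> 1}"
      using v \<beta>_le [of "2 - u" 1] chart_facts(7) [of 1 "2 - u"] by (auto simp: turn_def)
    then show ?thesis
      using 3 imm_flip_middle chart_facts(12) [OF v(1)] by (simp add: kink_angle_def kink_def)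
  qed
qed

lemma imm_flip_cap_angle:
  assumes "u \<in> dom_cap"
  shows "imm_flip (pt (cap_angle u)) = \<kappa> (cap u)"
proof -
  consider "u \<in> {0<..<1}" | "u \<in> {1..3}" | "u \<in> {3<..<4}" using assms by fastforce
  then show ?thesis
  proof cases
    case 1
    then have v: "2 - u \<in> dom_\<alpha>" "1 \<le> 2 - u" by auto
    have "turn - \<alpha> (2 - u) \<in> {\<alpha> 1..\<beta> 1}"
      using v \<alpha>_le [of 1 "2 - u"] chart_facts(7) [of "2 - u" 1] by (auto simp: turn_def)
    then show ?thesis
      using 1 imm_flip_middle chart_facts(11) [OF v(1)] by (simp add: cap_angle_def cap_def)
  next
    case 2
    then have "cap_angle u = \<beta> u" by (auto simp: cap_angle_def turn_def)
    then show ?thesis using 2 imm_flip_inner(2) by simp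
  next
    case 3
    then have "u \<in> dom_\<beta>" by auto
    then show ?thesis
      using 3 imm_flip_outside [of "\<beta> u"] \<beta>_bounds [of u] \<beta>_le [of 3 u] chart_facts(12) [of u]
      by (simp add: cap_angle_def cap_def)
  qed
qed

lemma imm_flip_window:
  "{z \<in> circles V. imm_flip z \<in> \<kappa> ` window} = pt ` kink_angle ` dom_kink \<union> pt ` cap_angle ` dom_cap"
proof (intro equalityI subsetI)
  fix z assume z: "z \<in> {z \<in> circles V. imm_flip z \<in> \<kappa> ` window}"
  show "z \<in> pt ` kink_angle ` dom_kink \<union> pt ` cap_angle ` dom_cap"
  proof (cases "z \<in> inner")
    case True
    then show ?thesis
    proof (rule inner_cases)
      fix s assume s: "s \<in> {3/5..1}" "z = pt (\<alpha> s)"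
      then have "\<alpha> s = kink_angle s" "s \<in> dom_kink" by (auto simp: kink_angle_def)
      then show ?thesis using s by blast
    next
      fix s assume s: "s \<in> {1..3}" "z = pt (\<beta> s)"
      then have "\<beta> s = cap_angle s" "s \<in> dom_cap" by (auto simp: cap_angle_def turn_def)
      then show ?thesis using s by blast
    qed
  next
    case False
    then have z_outer: "z \<in> outer" "z \<in> circles V" using inner_outer z by auto
    then have "rev_arc z \<in> {z \<in> circles V. imm V z \<in> \<kappa> ` window}"
      using imm_flip_outer z rev_arc_circles by auto
    then have "rev_arc z \<in> pt ` \<alpha> ` dom_\<alpha> \<union> pt ` \<beta> ` dom_\<beta>" using chart_facts(13) by simp
    then consider s where "s \<in> dom_\<alpha>" "rev_arc z = pt (\<alpha> s)" | s where "s \<in> dom_\<beta>" "rev_arc z = pt (\<beta> s)" by blast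
    then show ?thesis
    proof cases
      case 1
      then have a: "ang (rev_arc z) = \<alpha> s" using ang_\<alpha> by simp
      show ?thesis
      proof (cases "ang z \<in> {\<alpha> 1..\<beta> 1}")
        case True
        then have "turn - ang z = \<alpha> s" using a ang_rev_arc z_outer by simp
        then have *: "ang z = turn - \<alpha> s" "\<alpha> 1 \<le> \<alpha> s" using True by (auto simp: turn_def)
        then have "1 \<le> s" using \<alpha>_le [of 1 s] 1 by simp
        then have "ang z = cap_angle (2 - s)" "2 - s \<in> dom_cap" using * 1 by (auto simp: cap_angle_def)
        then show ?thesis using ang(3) [OF z_outer(2)] by (metis UnI2 imageI)
      next
        case no: False
        then have *: "ang z = \<alpha> s" using a no unfolding ang_rev_arc [OF z_outer(2)] by (simp only: if_False)
        have "s < 1"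
        proof (rule ccontr)
          assume "\<not> s < 1"
          then have "\<alpha> 1 \<le> \<alpha> s" "\<alpha> s \<le> \<beta> 1" using \<alpha>_le [of 1 s] chart_facts(7) [of s 1] 1 by auto
          then show False using no * by simp
        qed
        then have "ang z = kink_angle s" "s \<in> dom_kink" using * 1 by (auto simp: kink_angle_def)
        then show ?thesis using ang(3) [OF z_outer(2)] by (metis UnI1 imageI)
      qed
    next
      case 2
      then have a: "ang (rev_arc z) = \<beta> s" using ang_\<beta> by simp
      show ?thesis
      proof (cases "ang z \<in> {\<alpha> 1..\<beta> 1}")
        case True
        then have "turn - ang z = \<beta> s" using a ang_rev_arc z_outer by simp
        then have *: "ang z = turn - \<beta> s" "\<beta> s \<le> \<beta> 1" using True by (auto simp: turn_def)
        then have "s \<le> 1" using \<beta>_le [of s 1] 2 by simp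
        then have "ang z = kink_angle (2 - s)" "2 - s \<in> dom_kink" using * 2 by (auto simp: kink_angle_def turn_def)
        then show ?thesis using ang(3) [OF z_outer(2)] by (metis UnI1 imageI)
      next
        case no: False
        then have *: "ang z = \<beta> s" using a no unfolding ang_rev_arc [OF z_outer(2)] by (simp only: if_False)
        have "1 < s"
        proof (rule ccontr)
          assume "\<not> 1 < s"
          then have "\<beta> s \<le> \<beta> 1" "\<alpha> 1 \<le> \<beta> s" using \<beta>_le [of s 1] chart_facts(7) [of 1 s] 2 by auto
          then show False using no * by simp
        qed
        then have "ang z = cap_angle s" "s \<in> dom_cap" using * 2 by (auto simp: cap_angle_def)
        then show ?thesis using ang(3) [OF z_outer(2)] by (metis UnI2 imageI)
      qed
    qed
  qed
next
  fix z assume "z \<in> pt ` kink_angle ` dom_kink \<union> pt ` cap_angle ` dom_cap"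
  then consider u where "u \<in> dom_kink" "z = pt (kink_angle u)" | u where "u \<in> dom_cap" "z = pt (cap_angle u)" by blast
  then show "z \<in> {z \<in> circles V. imm_flip z \<in> \<kappa> ` window}"
  proof cases
    case 1 then show ?thesis using imm_flip_kink_angle kink_in_window pt_in_circles [OF V1] by auto
  next
    case 2 then show ?thesis using imm_flip_cap_angle cap_in_window pt_in_circles [OF V1] by auto
  qed
qed

abbreviation "disk \<equiv> \<kappa> ` cball 0 1"

lemma interior_disk: "interior disk = \<kappa> ` ball 0 1" and frontier_disk: "frontier disk = \<kappa> ` sphere 0 1"
  using chart_interior [OF open_window chart_facts(1,2) disk_in_window]
    chart_frontier [OF open_window chart_facts(1,2) disk_in_window] by auto

lemma in_disk:
  assumes "w \<in> window"
  shows "\<kappa> w \<in> disk \<longleftrightarrow> norm w \<le> 1" "\<kappa> w \<in> interior disk \<longleftrightarrow> norm w < 1" "\<kappa> w \<in> frontier disk \<longleftrightarrow> norm w = 1"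
proof -
  have b: "ball 0 1 \<subseteq> window" "sphere 0 1 \<subseteq> window" using disk_in_window by auto
  show "\<kappa> w \<in> disk \<longleftrightarrow> norm w \<le> 1" "\<kappa> w \<in> interior disk \<longleftrightarrow> norm w < 1" "\<kappa> w \<in> frontier disk \<longleftrightarrow> norm w = 1"
    unfolding interior_disk frontier_disk
    using inj_on_image_mem_iff [OF chart_facts(2) assms disk_in_window] inj_on_image_mem_iff [OF chart_facts(2) assms b(1)]
      inj_on_image_mem_iff [OF chart_facts(2) assms b(2)] by simp_all
qed

lemma V_window_points:
  "s \<in> dom_\<alpha> \<Longrightarrow> Complex s (2 * s - 2) \<in> window" "t \<in> dom_\<beta> \<Longrightarrow> Complex 0 (t - 2) \<in> window"
  by (auto simp: window_def)

lemma V_preimage_disk: "{z \<in> circles V. imm V z \<in> disk} = inner"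
  and V_preimage_interior: "{z \<in> circles V. imm V z \<notin> interior disk} = outer"
proof -
  have *: "(imm V z \<in> disk \<longleftrightarrow> z \<in> inner) \<and> (imm V z \<notin> interior disk \<longleftrightarrow> z \<in> outer)" if z: "z \<in> circles V" for z
  proof (cases "imm V z \<in> \<kappa> ` window")
    case True
    then have "z \<in> {z \<in> circles V. imm V z \<in> \<kappa> ` window}" using z by simp
    then have "z \<in> pt ` \<alpha> ` dom_\<alpha> \<union> pt ` \<beta> ` dom_\<beta>" by (simp only: chart_facts(13))
    then consider s where "s \<in> dom_\<alpha>" "z = pt (\<alpha> s)" | s where "s \<in> dom_\<beta>" "z = pt (\<beta> s)" by blast
    then show ?thesis
    proof cases
      case 1
      have a: "ang z = \<alpha> s" using 1 ang_\<alpha> by simp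
      have "\<alpha> s < \<beta> 1" "\<alpha> s < \<beta> 3" using chart_facts(7) 1 by auto
      then have "z \<in> inner \<longleftrightarrow> s \<in> {3/5..1}" "z \<in> outer \<longleftrightarrow> s \<notin> {3/5<..<1}"
        using 1 z a \<alpha>_le [of "3/5" s] \<alpha>_le [of s 1] \<alpha>_less [of "3/5" s] \<alpha>_less [of s 1]
        by (auto simp: inner_def outer_def)
      then show ?thesis
        using in_disk [OF V_window_points(1) [OF 1(1)]] oblique_line_in_disk [of s] chart_facts(11) [OF 1(1)] 1(2) by simp
    next
      case 2
      have a: "ang z = \<beta> s" using 2 ang_\<beta> by simp
      have "\<alpha> 1 < \<beta> s" "\<alpha> (3/5) < \<beta> s" using chart_facts(7) 2 by auto
      then have "z \<in> inner \<longleftrightarrow> s \<in> {1..3}" "z \<in> outer \<longleftrightarrow> s \<notin> {1<..<3}"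
        using 2 z a \<beta>_le [of 1 s] \<beta>_le [of s 3] \<beta>_less [of 1 s] \<beta>_less [of s 3]
        by (auto simp: inner_def outer_def)
      then show ?thesis
        using in_disk [OF V_window_points(2) [OF 2(1)]] vertical_line_in_disk [of "s - 2"] chart_facts(12) [OF 2(1)] 2(2)
        by (auto simp: abs_le_iff abs_less_iff)
    qed
  next
    case False
    have "z \<notin> inner"
    proof
      assume "z \<in> inner"
      then show False
      proof (rule inner_cases)
        fix s assume s: "s \<in> {3/5..1}" "z = pt (\<alpha> s)"
        then have "s \<in> dom_\<alpha>" by auto
        then show False using False s chart_facts(11) V_window_points by auto
      next
        fix s assume s: "s \<in> {1..3}" "z = pt (\<beta> s)"
        then have "s \<in> dom_\<beta>" by auto
        then show False using False s chart_facts(12) V_window_points by auto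
      qed
    qed
    moreover have "imm V z \<notin> disk" using False disk_in_window by blast
    moreover have "interior disk \<subseteq> disk" by (rule interior_subset)
    ultimately show ?thesis using inner_outer z by blast
  qed
  then show "{z \<in> circles V. imm V z \<in> disk} = inner" by (auto simp: inner_def)
  show "{z \<in> circles V. imm V z \<notin> interior disk} = outer" using * by (auto simp: outer_def)
qed

lemma flip_preimage_disk: "{z \<in> circles V. imm_flip z \<in> disk} = inner"
  and flip_preimage_interior: "{z \<in> circles V. imm_flip z \<notin> interior disk} = outer"
proof -
  have *: "(imm_flip z \<in> disk \<longleftrightarrow> z \<in> inner) \<and> (imm_flip z \<notin> interior disk \<longleftrightarrow> z \<in> outer)" if z: "z \<in> circles V" for z
  proof (cases "z \<in> inner")
    case True
    then show ?thesis
    proof (rule inner_cases)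
      fix s assume s: "s \<in> {3/5..1}" "z = pt (\<alpha> s)" "imm_flip z = \<kappa> (kink s)"
      then have d: "s \<in> dom_\<alpha>" "s \<in> dom_kink" by auto
      have a: "ang z = \<alpha> s" using s ang_\<alpha> d by simp
      have "\<alpha> s < \<beta> 1" using chart_facts(7) d by auto
      then have "z \<in> outer \<longleftrightarrow> s \<notin> {3/5<..<1}"
        using d z a \<alpha>_less [of "3/5" s] \<alpha>_less [of s 1] by (auto simp: outer_def)
      then show ?thesis using True s kink_in_disk [OF s(1)] in_disk [OF kink_in_window [OF d(2)]] by simp
    next
      fix s assume s: "s \<in> {1..3}" "z = pt (\<beta> s)" "imm_flip z = \<kappa> (cap s)"
      then have d: "s \<in> dom_\<beta>" "s \<in> dom_cap" by auto
      have a: "ang z = \<beta> s" using s ang_\<beta> d by simp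
      have "\<alpha> 1 < \<beta> s" using chart_facts(7) d by auto
      then have "z \<in> outer \<longleftrightarrow> s \<notin> {1<..<3}"
        using d z a \<beta>_less [of 1 s] \<beta>_less [of s 3] by (auto simp: outer_def)
      then show ?thesis using True s cap_in_disk [OF s(1)] in_disk [OF cap_in_window [OF d(2)]] by simp
    qed
  next
    case False
    then have "z \<in> outer" "rev_arc z \<notin> inner" "rev_arc z \<in> outer" using inner_outer rev_arc_inner rev_arc_outer z by blast+
    then show ?thesis
      using imm_flip_outer [of z] V_preimage_disk V_preimage_interior rev_arc_circles [OF z] False by force
  qed
  then show "{z \<in> circles V. imm_flip z \<in> disk} = inner" by (auto simp: inner_def)
  show "{z \<in> circles V. imm_flip z \<notin> interior disk} = outer" using * by (auto simp: outer_def)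
qed

lemma V_inj_inner: "inj_on (imm V) inner"
proof (rule inj_onI)
  fix z w assume z: "z \<in> inner" and w: "w \<in> inner" and eq: "imm V z = imm V w"
  have *: "\<exists>u\<in>window. imm V z = \<kappa> u \<and> (\<exists>s\<in>{3/5..1}. z = pt (\<alpha> s) \<and> u = Complex s (2 * s - 2)) \<or>
     (\<exists>u\<in>window. imm V z = \<kappa> u \<and> (\<exists>s\<in>{1..3}. z = pt (\<beta> s) \<and> u = Complex 0 (s - 2)))" if "z \<in> inner" for z
    using that
  proof (rule inner_cases)
    fix s assume s: "s \<in> {3/5..1}" "z = pt (\<alpha> s)"
    then have "s \<in> dom_\<alpha>" by auto
    then show ?thesis using s chart_facts(11) V_window_points by blast
  next
    fix s assume s: "s \<in> {1..3}" "z = pt (\<beta> s)"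
    then have "s \<in> dom_\<beta>" by auto
    then show ?thesis using s chart_facts(12) V_window_points by blast
  qed
  obtain u v where uv: "u \<in> window" "v \<in> window" "imm V z = \<kappa> u" "imm V w = \<kappa> v"
    "(\<exists>s\<in>{3/5..1}. z = pt (\<alpha> s) \<and> u = Complex s (2 * s - 2)) \<or> (\<exists>s\<in>{1..3}. z = pt (\<beta> s) \<and> u = Complex 0 (s - 2))"
    "(\<exists>s\<in>{3/5..1}. w = pt (\<alpha> s) \<and> v = Complex s (2 * s - 2)) \<or> (\<exists>s\<in>{1..3}. w = pt (\<beta> s) \<and> v = Complex 0 (s - 2))"
    using *[OF z] *[OF w] by blast
  have "u = v" using inj_onD [OF chart_facts(2)] uv eq by simp
  then show "z = w" using uv(5,6) by auto
qed

lemma flip_inj_inner: "inj_on imm_flip inner"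
proof (rule inj_onI)
  fix z w assume z: "z \<in> inner" and w: "w \<in> inner" and eq: "imm_flip z = imm_flip w"
  have *: "\<exists>u\<in>window. imm_flip z = \<kappa> u \<and> ((\<exists>s\<in>{3/5..1}. z = pt (\<alpha> s) \<and> u = kink s) \<or>
     (\<exists>s\<in>{1..3}. z = pt (\<beta> s) \<and> u = cap s))" if "z \<in> inner" for z
    using that
  proof (rule inner_cases)
    fix s assume s: "s \<in> {3/5..1}" "z = pt (\<alpha> s)" "imm_flip z = \<kappa> (kink s)"
    then have "s \<in> dom_kink" by auto
    then show ?thesis using s kink_in_window by blast
  next
    fix s assume s: "s \<in> {1..3}" "z = pt (\<beta> s)" "imm_flip z = \<kappa> (cap s)"
    then have "s \<in> dom_cap" by auto
    then show ?thesis using s cap_in_window by blast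
  qed
  obtain u where u: "u \<in> window" "imm_flip z = \<kappa> u"
    "(\<exists>s\<in>{3/5..1}. z = pt (\<alpha> s) \<and> u = kink s) \<or> (\<exists>s\<in>{1..3}. z = pt (\<beta> s) \<and> u = cap s)"
    using *[OF z] by blast
  obtain v where v: "v \<in> window" "imm_flip w = \<kappa> v"
    "(\<exists>s\<in>{3/5..1}. w = pt (\<alpha> s) \<and> v = kink s) \<or> (\<exists>s\<in>{1..3}. w = pt (\<beta> s) \<and> v = cap s)"
    using *[OF w] by blast
  have "u = v" using inj_onD [OF chart_facts(2)] u v eq by simp
  moreover have "s = t" if "kink s = kink t" "s \<in> {3/5..1}" "t \<in> {3/5..1}" for s t
    using kink_crossing [of s t] kink_crossing [of t s] that by fastforce
  moreover have "s = t" if "cap s = cap t" for s t using inj_cap that by (simp add: inj_eq)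
  ultimately show "z = w" using u(3) v(3) kink_cap by metis
qed

end

text \<open>Polar coordinates around 0, turned so that 0 is mapped to the end point -\<i> and so that the lower half
  plane is mapped into the unit disk.  The factor 1/100 makes the image of the square so small that
  of both diagrams only the imaginary axis passes through it.\<close>

definition polar :: "complex \<Rightarrow> complex" where
  "polar w = Complex (exp (Im w / 100) * sin (Re w / 100)) (- (exp (Im w / 100) * cos (Re w / 100)))"

definition strip :: "complex set" where
  "strip = {w. \<bar>Re w\<bar> < 1/4 \<and> -3/2 < Im w \<and> Im w < -17/20}"

lemma norm_polar: "norm (polar w) = exp (Im w / 100)"
proof -
  have "(norm (polar w))\<^sup>2 = (exp (Im w / 100))\<^sup>2 * (sin (Re w / 100))\<^sup>2 + (exp (Im w / 100))\<^sup>2 * (cos (Re w / 100))\<^sup>2"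
    by (simp add: polar_def cmod_power2 power_mult_distrib)
  also have "\<dots> = (exp (Im w / 100))\<^sup>2 * ((sin (Re w / 100))\<^sup>2 + (cos (Re w / 100))\<^sup>2)"
    by (simp only: distrib_left)
  finally have "(norm (polar w))\<^sup>2 = (exp (Im w / 100))\<^sup>2" by simp
  then show ?thesis by (simp add: power2_eq_iff_nonneg)
qed

lemma exp_bounds:
  assumes "\<bar>u\<bar> < 8"
  shows "22/25 < exp (u / 100)" "exp (u / 100) < (10/9 :: real)"
proof -
  have "1 + u / 100 \<le> exp (u / 100)" by (rule exp_ge_add_one_self)
  then show "22/25 < exp (u / 100)" using assms by linarith
  have "1 + (- u / 100) \<le> exp (- u / 100)" by (rule exp_ge_add_one_self)
  then have "9/10 < exp (- u / 100)" using assms by linarith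
  then show "exp (u / 100) < 10/9" by (simp add: exp_minus field_simps)
qed

lemma polar_in_strip:
  assumes "w \<in> square"
  shows "polar w \<in> strip"
proof -
  define r where "r = exp (Im w / 100)"
  define a where "a = Re w / 100"
  have a: "\<bar>a\<bar> < 2/25" and r: "22/25 < r" "r < 10/9"
    using assms exp_bounds [of "Im w"] by (auto simp: square_def a_def r_def)
  have s: "\<bar>sin a\<bar> \<le> \<bar>a\<bar>" by (rule abs_sin_x_le_abs_x)
  have "(sin a)\<^sup>2 \<le> (2/25)\<^sup>2" using s a by (intro power2_le_iff_abs_le [THEN iffD2]) auto
  then have "(cos a)\<^sup>2 \<ge> (99/100)\<^sup>2" using sin_cos_squared_add [of a] by (simp add: power2_eq_square)
  moreover have "cos a > 0" using a pi_gt3 by (intro cos_gt_zero_pi) auto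
  ultimately have c: "99/100 \<le> cos a" by (meson less_imp_le power2_le_imp_le)
  have "\<bar>r * sin a\<bar> \<le> r * (2/25)" using s a r by (simp add: abs_mult)
  then have 1: "\<bar>r * sin a\<bar> < 1/4" using r by linarith
  have "r * cos a \<le> r * 1" using r by (intro mult_left_mono) auto
  then have 2: "r * cos a < 3/2" using r by linarith
  have "(22/25) * (99/100) \<le> r * cos a" using r c by (intro mult_mono) auto
  then have 3: "17/20 < r * cos a" by simp
  show ?thesis using 1 2 3 by (simp add: polar_def strip_def r_def a_def)
qed

lemma inj_polar: "inj_on polar square"
proof (rule inj_onI)
  fix w z assume w: "w \<in> square" and z: "z \<in> square" and eq: "polar w = polar z"
  then have "exp (Im w / 100) = exp (Im z / 100)" using norm_polar by metis
  then have Im: "Im w = Im z" by simp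
  then have "sin (Re w / 100) = sin (Re z / 100)" using eq by (simp add: polar_def)
  moreover have "- (pi / 2) \<le> Re w / 100" "Re w / 100 \<le> pi / 2" "- (pi / 2) \<le> Re z / 100" "Re z / 100 \<le> pi / 2"
    using w z pi_gt3 by (auto simp: square_def)
  ultimately have "Re w / 100 = Re z / 100" using sin_inj_pi by blast
  then show "w = z" using Im by (simp add: complex_eq_iff)
qed

lemma continuous_polar: "continuous_on S polar"
  unfolding polar_def by (intro continuous_intros) auto

lemma polar_vertical: "polar (Complex 0 s) = Complex 0 (- exp (s / 100))"
  by (simp add: polar_def)

lemma polar_horizontal: "polar (complex_of_real s) = - \<i> * cis (s / 100)"
  by (simp add: polar_def complex_eq_iff)

lemma open_strip: "open strip"
  unfolding strip_def by (intro open_Collect_conj open_Collect_less continuous_intros)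

text \<open>The angle, lifted continuously over the arc, is the inverse map.\<close>

lemma pt_homeomorphism:
  fixes g :: "real \<Rightarrow> real"
  assumes "open S" "continuous_on S g" "inj_on g S" "g ` S \<subseteq> {a<..<a + 2 * pi}"
  shows "homeomorphism S ((pt \<circ> g) ` S) (pt \<circ> g) (inv_into S (pt \<circ> g))"
proof -
  obtain k where k: "homeomorphism S (g ` S) g k"
    using invariance_of_domain_homeomorphism [OF assms(1,2) _ assms(3)] by auto
  have "t \<in> {0} \<times> sphere 0 1 - {pt a}" if "t \<in> pt ` g ` S" for t
    using that assms(4) pt_eq_iff [of _ a] by (fastforce simp: pt_def abs_less_iff)
  then obtain A where A: "continuous_on (pt ` g ` S) A" "\<And>z. z \<in> pt ` g ` S \<Longrightarrow> A z \<in> {a<..<a + 2 * pi}"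
    "\<And>z. z \<in> pt ` g ` S \<Longrightarrow> pt (A z) = z"
    using arg_lift [OF continuous_on_id, of "pt ` g ` S" a] by metis
  have Apt: "A (pt t) = t" if t: "t \<in> g ` S" for t
  proof -
    have "pt (A (pt t)) = pt t" "A (pt t) \<in> {a<..<a + 2 * pi}" "t \<in> {a<..<a + 2 * pi}"
      using A t assms(4) by blast+
    then show ?thesis using pt_eq_iff [of "A (pt t)" t] by (auto simp: abs_less_iff)
  qed
  have 1: "homeomorphism (g ` S) (pt ` g ` S) pt A"
    using A(1,3) Apt by (intro homeomorphismI continuous_pt) auto
  have "homeomorphism S (pt ` g ` S) (pt \<circ> g) (k \<circ> A)" by (rule homeomorphism_compose [OF k 1])
  then show ?thesis by (simp add: homeomorphism_inv_into image_comp)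
qed

context crossing_flip
begin

lemma rev_arc_cont: "continuous_on outer rev_arc"
proof -
  let ?A = "pt ` {\<alpha> 1..\<beta> 1}" and ?B = "pt ` {\<beta> 3..\<alpha> (3/5) + 2 * pi}"
  have ang_A: "ang (pt t) = t" if "t \<in> {\<alpha> 1..\<beta> 1}" for t
    using that order by (intro ang_pt) auto
  have ang_B: "ang (pt t) \<notin> {\<alpha> 1..\<beta> 1}" if t: "t \<in> {\<beta> 3..\<alpha> (3/5) + 2 * pi}" for t
  proof (cases "t < start + 2 * pi")
    case True
    then have "ang (pt t) = t" using t order by (intro ang_pt) auto
    then show ?thesis using t order by auto
  next
    case False
    have "ang (pt (t - 2 * pi)) = t - 2 * pi" using False t order by (intro ang_pt) auto
    then have "ang (pt t) = t - 2 * pi" by (simp add: pt_add_2pi)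
    then show ?thesis using t order by auto
  qed
  have "outer \<subseteq> ?A \<union> ?B"
  proof
    fix z assume "z \<in> outer"
    then have z: "z \<in> circles V" "ang z \<notin> {\<alpha> (3/5)<..<\<alpha> 1} \<union> {\<beta> 1<..<\<beta> 3}" by (auto simp: outer_def)
    then consider "ang z \<le> \<alpha> (3/5)" | "ang z \<in> {\<alpha> 1..\<beta> 1}" | "\<beta> 3 \<le> ang z" by fastforce
    then show "z \<in> ?A \<union> ?B"
    proof cases
      case 1
      then have "ang z + 2 * pi \<in> {\<beta> 3..\<alpha> (3/5) + 2 * pi}" using ang(1) [OF z(1)] order by auto
      moreover have "z = pt (ang z + 2 * pi)" using ang(3) [OF z(1)] by (simp add: pt_add_2pi)
      ultimately show ?thesis by blast
    next
      case 2
      then show ?thesis using ang(3) [OF z(1)] by (metis UnI1 imageI)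
    next
      case 3
      then have "ang z \<in> {\<beta> 3..\<alpha> (3/5) + 2 * pi}" using ang(2) [OF z(1)] order by auto
      then show ?thesis using ang(3) [OF z(1)] by (metis UnI2 imageI)
    qed
  qed
  moreover have "continuous_on (?A \<union> ?B) rev_arc"
  proof (rule continuous_on_closed_Un)
    show "closed ?A" "closed ?B"
      by (intro compact_imp_closed compact_continuous_image continuous_pt compact_Icc)+
    have "continuous_on ?A ang"
      by (rule continuous_on_inv [OF continuous_pt compact_Icc]) (use ang_A in blast)
    then have "continuous_on ?A (\<lambda>z. pt (turn - ang z))"
      by (intro continuous_on_compose2 [OF continuous_pt [of UNIV]] continuous_intros) auto
    then show "continuous_on ?A rev_arc"
      by (rule continuous_on_eq) (use ang_A in \<open>auto simp: rev_arc_def\<close>)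
    show "continuous_on ?B rev_arc"
      by (rule continuous_on_eq [OF continuous_on_id]) (use ang_B in \<open>auto simp: rev_arc_def\<close>)
  qed
  ultimately show ?thesis using continuous_on_subset by blast
qed

lemma rev_arc_inj: "inj_on rev_arc (circles V)"
  by (rule inj_on_inverseI) (rule rev_arc_rev_arc)

lemma compact_inner: "compact inner"
proof -
  have "closed disk"
    by (intro compact_imp_closed compact_continuous_image continuous_on_subset [OF chart_facts(1) disk_in_window]) simp
  then have "closedin (top_of_set (circles V)) (circles V \<inter> imm V -` disk)"
    by (intro continuous_closedin_preimage V_cont)
  moreover have "circles V \<inter> imm V -` disk = inner" using V_preimage_disk by (simp add: Int_def vimage_def)
  ultimately show ?thesis using closedin_compact [OF compact_circles] by metis
qed

text \<open>No double points lie over the unit disk, and outside the diagram is the old one after the reversal.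
  Local injectivity at the ends of the strands is seen from \<open>kink\<close> and \<open>cap\<close>, which continue them.\<close>

lemma flip_curve: "immersed flip \<and> generic flip"
proof (rule replacement_generic [where K = inner and \<phi> = rev_arc and D = V])
  show "continuous_on (circles flip) (imm flip)" using flip_cont by (simp add: flip_simps)
  show "closed inner" using compact_inner compact_imp_closed by blast
  show "inner \<subseteq> circles flip" by (auto simp: inner_def flip_simps)
  have sub: "circles V - inner \<subseteq> outer" using inner_outer by blast
  show "continuous_on (circles flip - inner) rev_arc"
    using continuous_on_subset [OF rev_arc_cont sub] by (simp add: flip_simps)
  show "inj_on rev_arc (circles flip - inner)"
    using inj_on_subset [OF rev_arc_inj] by (simp add: flip_simps)
  show "rev_arc ` (circles flip - inner) \<subseteq> circles V" using rev_arc_circles by (auto simp: flip_simps)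
  show "imm flip z = imm V (rev_arc z)" if "z \<in> circles flip - inner" for z
    using imm_flip_outer [of z] sub that unfolding flip_simps by blast
  show "imm flip z \<noteq> imm flip w" if "z \<in> inner" "w \<in> circles flip - inner" for z w
  proof
    assume eq: "imm flip z = imm flip w"
    have "z \<in> {z \<in> circles V. imm_flip z \<in> disk}" using that(1) flip_preimage_disk by simp
    then have "w \<in> {z \<in> circles V. imm_flip z \<in> disk}" using eq that(2) by (simp add: flip_simps)
    then have "w \<in> inner" by (simp only: flip_preimage_disk)
    then show False using that by simp
  qed
  have no: "z = w" if "z \<in> inner" "w \<in> inner" "imm flip z = imm flip w" for z w
    using that inj_onD [OF flip_inj_inner] by (simp add: flip_simps)
  have "{z \<in> inner. \<exists>w\<in>inner. z \<noteq> w \<and> imm flip z = imm flip w} = {}" using no by blast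
  then show "finite {z \<in> inner. \<exists>w\<in>inner. z \<noteq> w \<and> imm flip z = imm flip w}" by (simp only: finite.emptyI)
  show "v = w" if "z \<in> inner" "v \<in> inner" "w \<in> inner" "z \<noteq> v" "z \<noteq> w" "imm flip z = imm flip v" "imm flip z = imm flip w" for z v w
    using no that by blast
  show "transverse_at flip z w" if "z \<in> inner" "w \<in> inner" "double_pair flip z w" for z w
    using no that unfolding double_pair_def by blast
  fix z assume z_inner: "z \<in> inner"
  have local: "\<exists>N. openin (top_of_set (circles flip)) N \<and> z \<in> N \<and> inj_on (imm flip) N"
    if S: "open S" "g ` S \<subseteq> {start<..<start + 2 * pi}" "continuous_on S g" "strict_mono_on S g" "s \<in> S" "z = pt (g s)"
      and im: "\<And>u. u \<in> S \<Longrightarrow> imm_flip (pt (g u)) = \<kappa> (\<Gamma> u)" "\<And>u. u \<in> S \<Longrightarrow> \<Gamma> u \<in> window" "inj_on \<Gamma> S"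
    for S :: "real set" and g s \<Gamma>
  proof (intro exI [of _ "pt ` g ` S"] conjI)
    have "open (g ` S)"
      using invariance_of_domain [OF S(3,1) strict_mono_on_imp_inj_on [OF S(4)]] .
    have "openin (top_of_set (circles V)) (pt ` g ` S)"
    proof (subst openin_subopen, intro ballI)
      fix w assume "w \<in> pt ` g ` S"
      then obtain u where u: "u \<in> g ` S" "w = pt u" by blast
      then obtain e where e: "e > 0" "ball u e \<subseteq> g ` S" using \<open>open (g ` S)\<close> open_contains_ball by blast
      define d where "d = min e 1"
      have "d \<le> e" by (simp add: d_def)
      then have "{u - d<..<u + d} \<subseteq> ball u e" by (auto simp: dist_real_def)
      then have d: "{u - d<..<u + d} \<subseteq> g ` S" using e(2) by (rule subset_trans)
      have "openin (top_of_set (circles V)) (pt ` {u - d<..<u + d})"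
        using pi_gt3 by (intro openin_arc [OF V1]) (auto simp: d_def)
      moreover have "w \<in> pt ` {u - d<..<u + d}" using u e by (auto simp: d_def)
      ultimately show "\<exists>T. openin (top_of_set (circles V)) T \<and> w \<in> T \<and> T \<subseteq> pt ` g ` S"
        by (intro exI [of _ "pt ` {u - d<..<u + d}"] conjI image_mono d)
    qed
    then show "openin (top_of_set (circles flip)) (pt ` g ` S)" by (simp add: flip_simps)
    show "z \<in> pt ` g ` S" using S by blast
    show "inj_on (imm flip) (pt ` g ` S)"
    proof (rule inj_onI)
      fix v w assume "v \<in> pt ` g ` S" "w \<in> pt ` g ` S" and eq: "imm flip v = imm flip w"
      then obtain a b where ab: "a \<in> S" "v = pt (g a)" "b \<in> S" "w = pt (g b)" by blast
      then have "\<kappa> (\<Gamma> a) = \<kappa> (\<Gamma> b)" using eq im(1) by (simp add: flip_simps)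
      then have "\<Gamma> a = \<Gamma> b" using inj_onD [OF chart_facts(2)] im(2) ab by blast
      then have "a = b" using inj_onD [OF im(3)] ab by blast
      then show "v = w" using ab by simp
    qed
  qed
  from z_inner show "\<exists>N. openin (top_of_set (circles flip)) N \<and> z \<in> N \<and> inj_on (imm flip) N"
  proof (rule inner_cases)
    fix s assume s: "s \<in> {3/5..1}" "z = pt (\<alpha> s)"
    have sub: "{0<..<2} \<subseteq> dom_kink" by auto
    show ?thesis
    proof (rule local [of "{0<..<2}" kink_angle s kink])
      show "continuous_on {0<..<2} kink_angle" using kink_angle_cont sub by (rule continuous_on_subset)
      show "strict_mono_on {0<..<2} kink_angle"
        by (rule strict_mono_onI) (use strict_mono_onD [OF kink_angle_mono] in auto)
      show "z = pt (kink_angle s)" using s by (simp add: kink_angle_def)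
      show "inj_on kink {0<..<2}"
      proof (rule inj_onI)
        fix u v :: real assume "u \<in> {0<..<2}" "v \<in> {0<..<2}" "kink u = kink v"
        then show "u = v" using kink_crossing [of u v] kink_crossing [of v u] by fastforce
      qed
      show "kink_angle ` {0<..<2} \<subseteq> {start<..<start + 2 * pi}" using kink_angle_bounds sub by blast
      show "imm_flip (pt (kink_angle u)) = \<kappa> (kink u)" "kink u \<in> window" if "u \<in> {0<..<2}" for u
        using imm_flip_kink_angle kink_in_window sub that by blast+
    qed (use s in auto)
  next
    fix s assume s: "s \<in> {1..3}" "z = pt (\<beta> s)"
    show ?thesis
    proof (rule local [of dom_cap cap_angle s cap])
      show "z = pt (cap_angle s)" using s by (auto simp: cap_angle_def turn_def)
      show "cap_angle ` dom_cap \<subseteq> {start<..<start + 2 * pi}" using cap_angle_bounds by blast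
      show "imm_flip (pt (cap_angle u)) = \<kappa> (cap u)" "cap u \<in> window" if "u \<in> dom_cap" for u
        using imm_flip_cap_angle cap_in_window that by blast+
      show "inj_on cap dom_cap" using inj_cap inj_on_subset by blast
    qed (use s cap_angle_cont cap_angle_mono in auto)
  qed
qed (use V_imm V_gen in \<open>auto simp: flip_simps\<close>)

lemma double_pair_not_inner: "double_pair V z w \<Longrightarrow> z \<notin> inner"
proof
  assume dp: "double_pair V z w" and z: "z \<in> inner"
  have zw: "z \<in> circles V" "w \<in> circles V" "z \<noteq> w" "imm V z = imm V w" using dp by (auto simp: double_pair_def)
  have "z \<in> {z \<in> circles V. imm V z \<in> disk}" using z V_preimage_disk by simp
  then have "w \<in> {z \<in> circles V. imm V z \<in> disk}" using zw by simp
  then have "w \<in> inner" by (simp only: V_preimage_disk)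
  then show False using inj_onD [OF V_inj_inner] z zw by blast
qed

lemma over_V_double: "z \<in> over V \<Longrightarrow> \<exists>w. double_pair V z w"
  using knot by (auto simp: virtual_knot_diagram_def virtual_link_diagram_def)

lemma flip_knot: "virtual_knot_diagram flip"
proof -
  have "\<exists>w. double_pair flip z w" if "z \<in> over flip" for z
  proof -
    have z: "z \<in> circles V" "z \<notin> inner" "rev_arc z \<in> over V" using that by (auto simp: over_flip)
    then obtain w where w: "double_pair V (rev_arc z) w" using over_V_double by blast
    have wc: "w \<in> circles V" "imm V (rev_arc z) = imm V w" "rev_arc z \<noteq> w" using w by (auto simp: double_pair_def)
    have "double_pair V w (rev_arc z)" using w by (auto simp: double_pair_def)
    then have w_inner: "w \<notin> inner" by (rule double_pair_not_inner)
    have "imm_flip (rev_arc w) = imm V (rev_arc (rev_arc w))"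
      using imm_flip_outer rev_arc_outer inner_outer wc(1) w_inner by blast
    then have "imm_flip (rev_arc w) = imm_flip z"
      using rev_arc_rev_arc [OF wc(1)] wc(2) imm_flip_outer [OF inner_outer [OF z(1,2)]] by simp
    moreover have "z \<noteq> rev_arc w" using rev_arc_rev_arc [OF wc(1)] wc(3) by auto
    ultimately have "double_pair flip z (rev_arc w)"
      using z(1) rev_arc_circles [OF wc(1)] by (simp add: double_pair_def flip_simps)
    then show ?thesis by blast
  qed
  moreover have "\<not> (z \<in> over flip \<and> w \<in> over flip)" if dp: "double_pair flip z w" for z w
  proof
    assume "z \<in> over flip \<and> w \<in> over flip"
    then have z: "z \<in> circles V" "z \<notin> inner" "rev_arc z \<in> over V" and w: "w \<in> circles V" "w \<notin> inner" "rev_arc w \<in> over V"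
      by (auto simp: over_flip)
    have "z \<noteq> w" "imm_flip z = imm_flip w" using dp by (auto simp: double_pair_def flip_simps)
    moreover from this have "rev_arc z \<noteq> rev_arc w" using inj_onD [OF rev_arc_inj _ z(1) w(1)] by blast
    ultimately have "double_pair V (rev_arc z) (rev_arc w)"
      using rev_arc_circles z(1) w(1) imm_flip_outer [OF inner_outer [OF z(1,2)]] imm_flip_outer [OF inner_outer [OF w(1,2)]]
      by (simp add: double_pair_def)
    then show False
      using knot z(3) w(3) unfolding virtual_knot_diagram_def virtual_link_diagram_def by blast
  qed
  ultimately show ?thesis
    using flip_curve unfolding virtual_knot_diagram_def virtual_link_diagram_def by (simp add: flip_simps subset_iff)
qed

text \<open>The reversal is an involution, which therefore is its own inverse.\<close>

lemma flip_agree: "agree_outside disk V flip"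
proof -
  have h: "homeomorphism outer outer rev_arc rev_arc"
  proof -
    have "z \<in> circles V" if "z \<in> outer" for z using that by (simp add: outer_def)
    then show ?thesis using rev_arc_cont rev_arc_outer rev_arc_rev_arc by (intro homeomorphismI) blast+
  qed
  have outer: "{z \<in> circles V. imm V z \<notin> interior disk} = outer" "{z \<in> circles flip. imm flip z \<notin> interior disk} = outer"
    using V_preimage_interior flip_preimage_interior by (simp_all add: flip_simps)
  have "imm flip (rev_arc z) = imm V z \<and> (rev_arc z \<in> over flip \<longleftrightarrow> z \<in> over V)"
    if z: "z \<in> circles V" "imm V z \<notin> interior disk" for z
  proof -
    have z_outer: "z \<in> outer" using V_preimage_interior z by blast
    have "imm_flip (rev_arc z) = imm V z"
      using imm_flip_outer [of "rev_arc z"] rev_arc_outer [OF z(1)] z_outer rev_arc_rev_arc [OF z(1)] by simp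
    moreover have "rev_arc z \<in> over flip \<longleftrightarrow> z \<notin> inner \<and> z \<in> over V"
      using rev_arc_circles [OF z(1)] rev_arc_inner [OF z(1)] rev_arc_rev_arc [OF z(1)] by (simp add: over_flip)
    moreover have "z \<in> over V \<Longrightarrow> z \<notin> inner" using over_V_double double_pair_not_inner by blast
    ultimately show ?thesis by (auto simp: flip_simps)
  qed
  then show ?thesis unfolding agree_outside_def outer using h by blast
qed

end

lemma cis_three_halves_pi: "cis (3 * pi / 2) = - \<i>"
proof -
  have "cis (3 * pi / 2) = cis (pi + pi / 2)" by (simp add: field_simps)
  also have "\<dots> = - \<i>" unfolding cis_mult [symmetric] by simp
  finally show ?thesis .
qed

context crossing_flip
begin

text \<open>The end point with the number 0.\<close>

definition base_point :: complex where "base_point = Complex (3/5) (- 4/5)"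

definition disk_param :: "complex \<Rightarrow> complex" where "disk_param z = \<kappa> (z * base_point)"

definition angle0 :: real where "angle0 = arccos (3/5)"

definition end_angle :: "nat \<Rightarrow> real" where
  "end_angle j = (if j = 0 then 0 else if j = 1 then angle0 else if j = 2 then angle0 + pi / 2 else angle0 + 3 * pi / 2)"

lemma angle0: "0 < angle0" "angle0 + 3 * pi / 2 + 2/25 < 2 * pi" "cis angle0 = Complex (3/5) (4/5)"
proof -
  have c: "cos angle0 = 3/5" by (simp add: angle0_def)
  have s: "sin angle0 = 4/5"
  proof -
    have "sin angle0 = sqrt (1 - (3/5)\<^sup>2)" unfolding angle0_def by (rule sin_arccos) auto
    also have "1 - (3/5)\<^sup>2 = (4/5 :: real)\<^sup>2" by (simp add: power2_eq_square)
    finally show ?thesis by simp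
  qed
  show "cis angle0 = Complex (3/5) (4/5)" using c s by (simp add: complex_eq_iff)
  show "0 < angle0" unfolding angle0_def by (rule arccos_lt_bounded [THEN conjunct1]) auto
  have "sin (2/25) \<le> (2/25 :: real)" by (rule sin_x_le_x) simp
  then have "cos (pi / 2 - 2/25) < cos angle0" unfolding c by (simp add: cos_diff)
  moreover have "angle0 \<le> pi" unfolding angle0_def by (rule arccos_ubound) auto
  ultimately have "angle0 < pi / 2 - 2/25"
    using cos_mono_less_eq [of "pi / 2 - 2/25" angle0] \<open>0 < angle0\<close> pi_gt3 by simp
  then show "angle0 + 3 * pi / 2 + 2/25 < 2 * pi" by simp
qed

lemma norm_base_point: "norm base_point = 1"
proof -
  have "norm base_point = sqrt ((3/5)\<^sup>2 + (- 4/5)\<^sup>2)" by (simp add: base_point_def cmod_def)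
  also have "(3/5)\<^sup>2 + (- 4/5)\<^sup>2 = (1 :: real)" by (simp add: power2_eq_square)
  finally show ?thesis by simp
qed

lemma disk_param_disk: "\<exists>e'. homeomorphism (cball 0 1) disk disk_param e'"
proof -
  have sub: "(\<lambda>z. z * base_point) ` cball 0 1 = cball 0 1"
  proof (intro equalityI subsetI)
    fix z :: complex assume "z \<in> cball 0 1"
    then have "z / base_point \<in> cball 0 1" "z = (z / base_point) * base_point" using norm_base_point by (auto simp: norm_divide)
    then show "z \<in> (\<lambda>z. z * base_point) ` cball 0 1" by blast
  qed (use norm_base_point in \<open>auto simp: norm_mult\<close>)
  have "continuous_on (cball 0 1) disk_param"
    unfolding disk_param_def using sub
    by (intro continuous_on_compose2 [OF continuous_on_subset [OF chart_facts(1) disk_in_window]] continuous_intros) auto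
  moreover have "disk_param ` cball 0 1 = disk"
    unfolding disk_param_def using sub by (metis (no_types, lifting) image_cong image_image)
  moreover have "inj_on disk_param (cball 0 1)"
  proof (rule inj_onI)
    fix z w :: complex assume z: "z \<in> cball 0 1" and w: "w \<in> cball 0 1" and eq: "disk_param z = disk_param w"
    then have "z * base_point \<in> window" "w * base_point \<in> window" using sub disk_in_window by blast+
    moreover have "\<kappa> (z * base_point) = \<kappa> (w * base_point)" using eq by (simp only: disk_param_def)
    ultimately have "z * base_point = w * base_point" using inj_onD [OF chart_facts(2)] by blast
    moreover have "base_point \<noteq> 0" using norm_base_point by auto
    ultimately show "z = w" by simp
  qed
  ultimately show ?thesis using homeomorphism_compact [OF compact_cball] by blast
qed

lemma disk_param_points:
  "disk_param (cis (end_angle 0)) = \<kappa> (Complex (3/5) (- 4/5))" "disk_param (cis (end_angle 1)) = \<kappa> (Complex 1 0)"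
  "disk_param (cis (end_angle 2)) = \<kappa> (Complex 0 1)" "disk_param (cis (end_angle 3)) = \<kappa> (Complex 0 (- 1))"
proof -
  have 1: "cis angle0 * base_point = Complex 1 0" by (simp add: angle0 base_point_def complex_eq_iff)
  have "cis (angle0 + pi / 2) * base_point = \<i> * (cis angle0 * base_point)"
    unfolding cis_mult [symmetric] by (simp add: ac_simps)
  then have 2: "cis (angle0 + pi / 2) * base_point = Complex 0 1" by (simp add: 1 complex_eq_iff)
  have "cis (angle0 + 3 * pi / 2) * base_point = - \<i> * (cis angle0 * base_point)"
    unfolding cis_mult [symmetric] cis_three_halves_pi by (simp add: ac_simps)
  then have 3: "cis (angle0 + 3 * pi / 2) * base_point = Complex 0 (- 1)" by (simp add: 1 complex_eq_iff)
  show "disk_param (cis (end_angle 0)) = \<kappa> (Complex (3/5) (- 4/5))" "disk_param (cis (end_angle 1)) = \<kappa> (Complex 1 0)"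
    "disk_param (cis (end_angle 2)) = \<kappa> (Complex 0 1)" "disk_param (cis (end_angle 3)) = \<kappa> (Complex 0 (- 1))"
    using 1 2 3 by (simp_all add: disk_param_def end_angle_def base_point_def)
qed

lemma strands_disk:
  assumes g: "imm D = g" "circles D = circles V" and pre: "{z \<in> circles V. g z \<in> disk} = inner"
    and fr: "\<And>s. s \<in> {3/5..1} \<Longrightarrow> g (pt (\<alpha> s)) \<in> frontier disk \<longleftrightarrow> s = 3/5 \<or> s = 1"
      "\<And>s. s \<in> {1..3} \<Longrightarrow> g (pt (\<beta> s)) \<in> frontier disk \<longleftrightarrow> s = 1 \<or> s = 3"
    and uv: "{u, v} = {3/5, 1}" and uv': "{u', v'} = {1, 3}"
  shows "strands disk 2 D (\<lambda>i. if i = 0 then (\<lambda>t. pt (\<alpha> (u + t * (v - u)))) else (\<lambda>t. pt (\<beta> (u' + t * (v' - u')))))"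
    "strands disk 2 D (\<lambda>i. if i = 0 then (\<lambda>t. pt (\<beta> (u' + t * (v' - u')))) else (\<lambda>t. pt (\<alpha> (u + t * (v - u)))))"
proof -
  define a where "a = (\<lambda>t. pt (\<alpha> (u + t * (v - u))))"
  define b where "b = (\<lambda>t. pt (\<beta> (u' + t * (v' - u'))))"
  have cu: "u = 3/5 \<and> v = 1 \<or> u = 1 \<and> v = 3/5" using uv by (auto simp: doubleton_eq_iff)
  have cu': "u' = 1 \<and> v' = 3 \<or> u' = 3 \<and> v' = 1" using uv' by (auto simp: doubleton_eq_iff)
  have sub: "{3/5..1} \<subseteq> dom_\<alpha>" "{1..3} \<subseteq> dom_\<beta>" by auto
  have arcs: "arc a" "arc b"
  proof -
    have "continuous_on {3/5..1} (pt \<circ> \<alpha>)" "continuous_on {1..3} (pt \<circ> \<beta>)"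
      by (rule continuous_on_compose [OF continuous_on_subset [OF chart_facts(3) sub(1)] continuous_pt])
        (rule continuous_on_compose [OF continuous_on_subset [OF chart_facts(5) sub(2)] continuous_pt])
    moreover have "inj_on (pt \<circ> \<alpha>) {3/5..1}" "inj_on (pt \<circ> \<beta>) {1..3}"
      using \<alpha>_inj \<beta>_inj sub by (auto simp: inj_on_def)
    ultimately show "arc a" "arc b"
      using arc_reparam [of "3/5" 1 "pt \<circ> \<alpha>" u v] arc_reparam [of 1 3 "pt \<circ> \<beta>" u' v'] cu cu'
      by (auto simp: a_def b_def)
  qed
  have img: "path_image a = pt ` \<alpha> ` {3/5..1}" "path_image b = pt ` \<beta> ` {1..3}"
  proof -
    have 1: "path_image (\<lambda>t. pt (\<alpha> (3/5 + t * (1 - 3/5)))) = pt ` \<alpha> ` {3/5..1}"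
      using path_image_reparam [of "3/5" 1 "pt \<circ> \<alpha>"] by (simp add: image_comp)
    have 2: "path_image (\<lambda>t. pt (\<beta> (1 + t * (3 - 1)))) = pt ` \<beta> ` {1..3}"
      using path_image_reparam [of 1 3 "pt \<circ> \<beta>"] by (simp add: image_comp)
    have "a = (\<lambda>t. pt (\<alpha> (3/5 + t * (1 - 3/5)))) \<or> a = reversepath (\<lambda>t. pt (\<alpha> (3/5 + t * (1 - 3/5))))"
    proof -
      have rev: "reversepath (\<lambda>t. pt (\<alpha> (3/5 + t * (1 - 3/5)))) = (\<lambda>t. pt (\<alpha> (1 + t * (3/5 - 1))))"
        unfolding reversepath_def
        by (rule ext, rule arg_cong [where f = "\<lambda>s. pt (\<alpha> s)"]) (simp add: field_simps)
      show ?thesis using cu by (elim disjE conjE) (simp_all only: a_def rev simp_thms)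
    qed
    then show "path_image a = pt ` \<alpha> ` {3/5..1}" using 1 by (metis path_image_reversepath)
    have "b = (\<lambda>t. pt (\<beta> (1 + t * (3 - 1)))) \<or> b = reversepath (\<lambda>t. pt (\<beta> (1 + t * (3 - 1))))"
    proof -
      have rev: "reversepath (\<lambda>t. pt (\<beta> (1 + t * (3 - 1)))) = (\<lambda>t. pt (\<beta> (3 + t * (1 - 3))))"
        unfolding reversepath_def
        by (rule ext, rule arg_cong [where f = "\<lambda>s. pt (\<beta> s)"]) (simp add: field_simps)
      show ?thesis using cu' by (elim disjE conjE) (simp_all only: b_def rev simp_thms)
    qed
    then show "path_image b = pt ` \<beta> ` {1..3}" using 2 by (metis path_image_reversepath)
  qed
  have un: "path_image a \<union> path_image b = {z \<in> circles V. g z \<in> disk}"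
    unfolding pre img
  proof (intro equalityI subsetI)
    fix z assume "z \<in> inner"
    then show "z \<in> pt ` \<alpha> ` {3/5..1} \<union> pt ` \<beta> ` {1..3}" by (rule inner_cases) blast+
  qed (use inner_mem in blast)
  have dis: "path_image a \<inter> path_image b = {}"
    unfolding img using \<alpha>\<beta>_ne sub by blast
  have fra: "g (a t) \<in> frontier disk \<longleftrightarrow> t = 0 \<or> t = 1" "g (b t) \<in> frontier disk \<longleftrightarrow> t = 0 \<or> t = 1"
    if t: "t \<in> {0..1}" for t
  proof -
    define r where "r = u + t * (v - u)"
    have "r = 3/5 + t * (1 - 3/5) \<or> r = 1 + t * (3/5 - 1)"
      unfolding r_def using cu by (elim disjE conjE) (simp_all only: simp_thms)
    then have "r \<in> {3/5..1} \<and> (r = 3/5 \<or> r = 1 \<longleftrightarrow> t = 0 \<or> t = 1)"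
      using t by auto
    then have "u + t * (v - u) \<in> {3/5..1}" "u + t * (v - u) = 3/5 \<or> u + t * (v - u) = 1 \<longleftrightarrow> t = 0 \<or> t = 1"
      unfolding r_def by simp_all
    then show "g (a t) \<in> frontier disk \<longleftrightarrow> t = 0 \<or> t = 1" using fr(1) by (simp add: a_def)
    have "u' + t * (v' - u') \<in> {1..3}" "u' + t * (v' - u') = 1 \<or> u' + t * (v' - u') = 3 \<longleftrightarrow> t = 0 \<or> t = 1"
      using cu' t by auto
    then show "g (b t) \<in> frontier disk \<longleftrightarrow> t = 0 \<or> t = 1" using fr(2) by (simp add: b_def)
  qed
  have 2: "{..<2} = {0, 1 :: nat}" by auto
  have "strands disk 2 D (\<lambda>i. if i = 0 then a else b)" "strands disk 2 D (\<lambda>i. if i = 0 then b else a)"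
    unfolding strands_def g 2 using arcs un dis fra by (auto simp: less_2_cases_iff)
  then show "strands disk 2 D (\<lambda>i. if i = 0 then (\<lambda>t. pt (\<alpha> (u + t * (v - u)))) else (\<lambda>t. pt (\<beta> (u' + t * (v' - u')))))"
    "strands disk 2 D (\<lambda>i. if i = 0 then (\<lambda>t. pt (\<beta> (u' + t * (v' - u')))) else (\<lambda>t. pt (\<alpha> (u + t * (v - u)))))"
    unfolding a_def b_def .
qed

lemma V_frontier:
  "s \<in> {3/5..1} \<Longrightarrow> imm V (pt (\<alpha> s)) \<in> frontier disk \<longleftrightarrow> s = 3/5 \<or> s = 1"
  "t \<in> {1..3} \<Longrightarrow> imm V (pt (\<beta> t)) \<in> frontier disk \<longleftrightarrow> t = 1 \<or> t = 3"
proof -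
  assume "s \<in> {3/5..1}"
  then have s: "s \<in> {3/5..1}" "s \<in> dom_\<alpha>" by auto
  show "imm V (pt (\<alpha> s)) \<in> frontier disk \<longleftrightarrow> s = 3/5 \<or> s = 1"
    using in_disk(3) [OF V_window_points(1) [OF s(2)]] oblique_line_in_disk [of s] chart_facts(11) [OF s(2)] s(1)
    by (auto simp: order_le_less)
next
  assume "t \<in> {1..3}"
  then have t: "t \<in> {1..3}" "t \<in> dom_\<beta>" by auto
  show "imm V (pt (\<beta> t)) \<in> frontier disk \<longleftrightarrow> t = 1 \<or> t = 3"
    using in_disk(3) [OF V_window_points(2) [OF t(2)]] chart_facts(12) [OF t(2)] t(1)
    by (auto simp: cmod_def)
qed

lemma flip_frontier:
  "s \<in> {3/5..1} \<Longrightarrow> imm_flip (pt (\<alpha> s)) \<in> frontier disk \<longleftrightarrow> s = 3/5 \<or> s = 1"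
  "t \<in> {1..3} \<Longrightarrow> imm_flip (pt (\<beta> t)) \<in> frontier disk \<longleftrightarrow> t = 1 \<or> t = 3"
proof -
  assume "s \<in> {3/5..1}"
  then have s: "s \<in> {3/5..1}" "s \<in> dom_kink" by auto
  show "imm_flip (pt (\<alpha> s)) \<in> frontier disk \<longleftrightarrow> s = 3/5 \<or> s = 1"
    using in_disk(3) [OF kink_in_window [OF s(2)]] kink_in_disk [OF s(1)] imm_flip_inner(1) [OF s(1)] s(1)
    by (auto simp: order_le_less)
next
  assume "t \<in> {1..3}"
  then have t: "t \<in> {1..3}" "t \<in> dom_cap" by auto
  show "imm_flip (pt (\<beta> t)) \<in> frontier disk \<longleftrightarrow> t = 1 \<or> t = 3"
    using in_disk(3) [OF cap_in_window [OF t(2)]] cap_in_disk [OF t(1)] imm_flip_inner(2) [OF t(1)] t(1)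
    by (auto simp: order_le_less)
qed

definition strands_V :: "nat \<Rightarrow> real \<Rightarrow> nat \<times> complex" where
  "strands_V = (\<lambda>i. if i = 0 then (\<lambda>t. pt (\<alpha> (3/5 + t * (1 - 3/5)))) else (\<lambda>t. pt (\<beta> (3 + t * (1 - 3)))))"

definition strands_flip :: "nat \<Rightarrow> real \<Rightarrow> nat \<times> complex" where
  "strands_flip = (\<lambda>i. if i = 0 then (\<lambda>t. pt (\<beta> (1 + t * (3 - 1)))) else (\<lambda>t. pt (\<alpha> (1 + t * (3/5 - 1)))))"

lemma H_config_flip: "H_config 2 V flip disk strands_V strands_flip disk_param end_angle"
proof -
  have st: "strands disk 2 V strands_V"
    unfolding strands_V_def using V_preimage_disk V_frontier by (intro strands_disk(1)) auto
  have st': "strands disk 2 flip strands_flip"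
    unfolding strands_flip_def using flip_preimage_disk flip_frontier
    by (intro strands_disk(2)) (auto simp: flip_simps)
  have lt: "j < 4 \<longleftrightarrow> j = 0 \<or> j = 1 \<or> j = 2 \<or> j = (3::nat)" for j by auto
  have \<theta>: "0 \<le> end_angle j \<and> end_angle j < 2 * pi" "k < j \<Longrightarrow> end_angle k < end_angle j" if "j < 4" for j k
    using that angle0(1,2) pi_gt_zero by (auto simp: end_angle_def lt)
  have endsV: "imm V (strands_V 0 0) = disk_param (cis (end_angle 0))" "imm V (strands_V 0 1) = disk_param (cis (end_angle 1))"
    "imm V (strands_V 1 0) = disk_param (cis (end_angle 2))" "imm V (strands_V 1 1) = disk_param (cis (end_angle 3))"
    unfolding disk_param_points using chart_facts(11) [of "3/5"] chart_facts(11) [of 1] chart_facts(12) [of 1] chart_facts(12) [of 3] by (simp_all add: strands_V_def)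
  have endsF: "imm flip (strands_flip 0 0) = disk_param (cis (end_angle 1))" "imm flip (strands_flip 0 1) = disk_param (cis (end_angle 2))"
    "imm flip (strands_flip 1 0) = disk_param (cis (end_angle 3))" "imm flip (strands_flip 1 1) = disk_param (cis (end_angle 0))"
    unfolding disk_param_points flip_simps
    using imm_flip_inner(1) [of "3/5"] imm_flip_inner(1) [of 1] imm_flip_inner(2) [of 1] imm_flip_inner(2) [of 3]
    by (simp_all add: strands_flip_def kink_def cap_def)
  have 2: "i < 2 \<longleftrightarrow> i = 0 \<or> i = (1::nat)" for i by auto
  show ?thesis
    unfolding H_config_def
  proof (intro conjI knot flip_knot st st' flip_agree disk_param_disk)
    show "inj_on (imm V) {x \<in> circles V. imm V x \<in> disk}" using V_inj_inner V_preimage_disk by simp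
    show "inj_on (imm flip) {x \<in> circles flip. imm flip x \<in> disk}"
      using flip_inj_inner flip_preimage_disk by (simp add: flip_simps)
    show "\<forall>j<2 * 2. 0 \<le> end_angle j \<and> end_angle j < 2 * pi" "\<forall>j<2 * 2. \<forall>k<j. end_angle k < end_angle j" using \<theta> by auto
    show "\<forall>i<2. imm V (strands_V i 0) = disk_param (cis (end_angle (2 * i))) \<and> imm V (strands_V i 1) = disk_param (cis (end_angle (2 * i + 1)))"
      using endsV by (auto simp: 2)
    show "\<forall>i<2. imm flip (strands_flip i 0) = disk_param (cis (end_angle (2 * i + 1))) \<and>
          imm flip (strands_flip i 1) = disk_param (cis (end_angle ((2 * i + 2) mod (2 * 2))))"
      using endsF by (auto simp: 2) (simp_all add: numeral_2_eq_2)
  qed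
qed

lemma strip_in_window: "strip \<subseteq> window"
  by (auto simp: strip_def window_def)

lemma V_strip: "strand_chart V \<kappa> strip (pt \<circ> (\<lambda>s. \<beta> (2 - s))) {17/20<..<3/2} (\<lambda>s. Complex 0 (- s))"
proof -
  let ?I = "{17/20<..<3/2 :: real}"
  have d: "2 - s \<in> dom_\<beta>" if "s \<in> ?I" for s using that by auto
  have h: "homeomorphism ?I ((pt \<circ> (\<lambda>s. \<beta> (2 - s))) ` ?I) (pt \<circ> (\<lambda>s. \<beta> (2 - s))) (inv_into ?I (pt \<circ> (\<lambda>s. \<beta> (2 - s))))"
  proof (rule pt_homeomorphism [where a = start])
    show "continuous_on ?I (\<lambda>s. \<beta> (2 - s))"
      using d by (intro continuous_on_compose2 [OF chart_facts(5)] continuous_intros) auto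
    show "inj_on (\<lambda>s. \<beta> (2 - s)) ?I"
    proof (rule inj_onI)
      fix s t assume st: "s \<in> ?I" "t \<in> ?I" "\<beta> (2 - s) = \<beta> (2 - t)"
      then have "2 - s = 2 - t" using \<beta>_inj [OF d d] by metis
      then show "s = t" by simp
    qed
    show "(\<lambda>s. \<beta> (2 - s)) ` ?I \<subseteq> {start<..<start + 2 * pi}" using d \<beta>_bounds by auto
  qed simp
  have im: "imm V (pt (\<beta> (2 - s))) = \<kappa> (Complex 0 (- s))" if "s \<in> ?I" for s
    using chart_facts(12) [OF d [OF that]] by simp
  have st: "Complex 0 (- s) \<in> strip" if "s \<in> ?I" for s using that by (auto simp: strip_def)
  have "{z \<in> circles V. imm V z \<in> \<kappa> ` strip} = (pt \<circ> (\<lambda>s. \<beta> (2 - s))) ` ?I"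
  proof (intro equalityI subsetI)
    fix z assume "z \<in> {z \<in> circles V. imm V z \<in> \<kappa> ` strip}"
    then obtain w where w: "z \<in> circles V" "w \<in> strip" "imm V z = \<kappa> w" by auto
    then have ww: "w \<in> window" using strip_in_window by blast
    then have "z \<in> {z \<in> circles V. imm V z \<in> \<kappa> ` window}" using w by auto
    then have "z \<in> pt ` \<alpha> ` dom_\<alpha> \<union> pt ` \<beta> ` dom_\<beta>" by (simp only: chart_facts(13))
    then consider s where "s \<in> dom_\<alpha>" "z = pt (\<alpha> s)" | s where "s \<in> dom_\<beta>" "z = pt (\<beta> s)" by blast
    then show "z \<in> (pt \<circ> (\<lambda>s. \<beta> (2 - s))) ` ?I"
    proof cases
      case 1
      then have "\<kappa> w = \<kappa> (Complex s (2 * s - 2))" using chart_facts(11) w by simp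
      then have "w = Complex s (2 * s - 2)" using inj_onD [OF chart_facts(2)] ww V_window_points(1) [OF 1(1)] by blast
      then show ?thesis using w(2) by (auto simp: strip_def)
    next
      case 2
      then have "\<kappa> w = \<kappa> (Complex 0 (s - 2))" using chart_facts(12) w by simp
      then have "w = Complex 0 (s - 2)" using inj_onD [OF chart_facts(2)] ww V_window_points(2) [OF 2(1)] by blast
      then have "2 - s \<in> ?I" using w(2) by (auto simp: strip_def)
      then show ?thesis using 2 by (intro image_eqI [of _ _ "2 - s"]) auto
    qed
  next
    fix z assume "z \<in> (pt \<circ> (\<lambda>s. \<beta> (2 - s))) ` ?I"
    then obtain s where "s \<in> ?I" "z = pt (\<beta> (2 - s))" by auto
    then show "z \<in> {z \<in> circles V. imm V z \<in> \<kappa> ` strip}" using im st pt_in_circles [OF V1] by auto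
  qed
  then show ?thesis
    unfolding strand_chart_def
    using open_strip continuous_on_subset [OF chart_facts(1) strip_in_window] inj_on_subset [OF chart_facts(2) strip_in_window] h im st
    by auto
qed

lemma flip_strand_chart:
  assumes "open Q" "Q \<subseteq> window" "open I" "I \<subseteq> dom_kink"
    and kink: "\<And>u. u \<in> dom_kink \<Longrightarrow> kink u \<in> Q \<longleftrightarrow> u \<in> I" and cap: "\<And>u. u \<in> dom_cap \<Longrightarrow> cap u \<notin> Q"
  shows "strand_chart flip \<kappa> Q (pt \<circ> kink_angle) I kink"
proof -
  have h: "homeomorphism I ((pt \<circ> kink_angle) ` I) (pt \<circ> kink_angle) (inv_into I (pt \<circ> kink_angle))"
  proof (rule pt_homeomorphism [where a = start])
    show "continuous_on I kink_angle" using kink_angle_cont assms(4) by (rule continuous_on_subset)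
    show "inj_on kink_angle I" using strict_mono_on_imp_inj_on [OF kink_angle_mono] assms(4) by (rule inj_on_subset)
    show "kink_angle ` I \<subseteq> {start<..<start + 2 * pi}" using kink_angle_bounds assms(4) by blast
  qed (rule assms(3))
  have "{z \<in> circles V. imm_flip z \<in> \<kappa> ` Q} = (pt \<circ> kink_angle) ` I"
  proof (intro equalityI subsetI)
    fix z assume "z \<in> {z \<in> circles V. imm_flip z \<in> \<kappa> ` Q}"
    then obtain w where w: "z \<in> circles V" "w \<in> Q" "imm_flip z = \<kappa> w" by auto
    then have ww: "w \<in> window" using assms(2) by blast
    then have "z \<in> {z \<in> circles V. imm_flip z \<in> \<kappa> ` window}" using w by auto
    then have "z \<in> pt ` kink_angle ` dom_kink \<union> pt ` cap_angle ` dom_cap" by (simp only: imm_flip_window)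
    then consider u where "u \<in> dom_kink" "z = pt (kink_angle u)" | u where "u \<in> dom_cap" "z = pt (cap_angle u)" by blast
    then show "z \<in> (pt \<circ> kink_angle) ` I"
    proof cases
      case 1
      then have "\<kappa> w = \<kappa> (kink u)" using imm_flip_kink_angle w by simp
      then have "w = kink u" using inj_onD [OF chart_facts(2)] ww kink_in_window [OF 1(1)] by blast
      then show ?thesis using kink 1 w(2) by auto
    next
      case 2
      then have "\<kappa> w = \<kappa> (cap u)" using imm_flip_cap_angle w by simp
      then have "w = cap u" using inj_onD [OF chart_facts(2)] ww cap_in_window [OF 2(1)] by blast
      then show ?thesis using cap 2 w(2) by auto
    qed
  next
    fix z assume "z \<in> (pt \<circ> kink_angle) ` I"
    then obtain u where u: "u \<in> I" "z = pt (kink_angle u)" by auto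
    then have "u \<in> dom_kink" using assms(4) by blast
    then show "z \<in> {z \<in> circles V. imm_flip z \<in> \<kappa> ` Q}"
      using u imm_flip_kink_angle kink pt_in_circles [OF V1] by auto
  qed
  moreover have "kink u \<in> Q \<and> imm_flip (pt (kink_angle u)) = \<kappa> (kink u)" if "u \<in> I" for u
    using that assms(4) kink imm_flip_kink_angle by blast
  ultimately show ?thesis
    unfolding strand_chart_def flip_simps
    using assms(1) continuous_on_subset [OF chart_facts(1) assms(2)] inj_on_subset [OF chart_facts(2) assms(2)] h by auto
qed

lemma flip_strip: "strand_chart flip \<kappa> strip (pt \<circ> kink_angle) {17/20<..<3/2} (\<lambda>s. Complex 0 (- s))"
proof -
  have "strand_chart flip \<kappa> strip (pt \<circ> kink_angle) {17/20<..<3/2} kink"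
  proof (rule flip_strand_chart [OF open_strip strip_in_window])
    show "kink u \<in> strip \<longleftrightarrow> u \<in> {17/20<..<3/2}" for u
      by (auto simp: kink_def strip_def abs_if split: if_splits)
    show "cap u \<notin> strip" if "u \<in> dom_cap" for u
      using that by (auto simp: cap_def strip_def)
  qed auto
  then show ?thesis unfolding strand_chart_def by (simp add: kink_def)
qed

lemma end_chart_flip:
  "end_chart 2 V flip disk disk_param end_angle (\<kappa> \<circ> polar) (pt \<circ> (\<lambda>s. \<beta> (2 - s)) \<circ> (\<lambda>s. exp (s / 100)))
     (pt \<circ> kink_angle \<circ> (\<lambda>s. exp (s / 100))) (\<lambda>s. angle0 + 3 * pi / 2 + s / 100)"
proof -
  have pre: "(\<exists>w\<in>square. Complex 0 (- s) = polar w) \<longleftrightarrow> s \<in> (\<lambda>s. exp (s / 100)) ` span"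
    if "s \<in> {17/20<..<3/2}" for s
  proof
    assume "\<exists>w\<in>square. Complex 0 (- s) = polar w"
    then obtain w where w: "w \<in> square" "Complex 0 (- s) = polar w" by blast
    then have "norm (Complex 0 (- s)) = exp (Im w / 100)" using norm_polar by metis
    then have "s = exp (Im w / 100)" using that by (simp add: cmod_def)
    moreover have "Im w \<in> span" using w(1) by (auto simp: square_def)
    ultimately show "s \<in> (\<lambda>s. exp (s / 100)) ` span" by blast
  next
    assume "s \<in> (\<lambda>s. exp (s / 100)) ` span"
    then obtain r where r: "r \<in> span" "s = exp (r / 100)" by blast
    then show "\<exists>w\<in>square. Complex 0 (- s) = polar w"
      by (intro bexI [of _ "Complex 0 r"]) (auto simp: polar_vertical square_def)
  qed
  have g: "(\<lambda>s. exp (s / 100)) ` span \<subseteq> {17/20<..<3/2 :: real}"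
  proof (rule image_subsetI)
    fix s :: real assume "s \<in> span"
    then have "\<bar>s\<bar> < 8" by auto
    then show "exp (s / 100) \<in> {17/20<..<3/2}" using exp_bounds [of s] by auto
  qed
  have gi: "continuous_on span (\<lambda>s::real. exp (s / 100))" "inj_on (\<lambda>s::real. exp (s / 100)) span"
    by (auto intro!: continuous_intros simp: inj_on_def)
  have ps: "polar ` square \<subseteq> strip" using polar_in_strip by blast
  have sq: "Complex 0 t \<in> square" "Complex 0 (- exp (t / 100)) = polar (Complex 0 t)" if "t \<in> span" for t
    using that by (auto simp: square_def polar_vertical)
  note resc = strand_chart_rescale [OF _ open_square continuous_polar inj_polar ps _ gi g pre sq]
  show ?thesis
    unfolding end_chart_def
  proof (intro conjI ballI)
    show "strand_chart V (\<kappa> \<circ> polar) square (pt \<circ> (\<lambda>s. \<beta> (2 - s)) \<circ> (\<lambda>s. exp (s / 100))) span (Complex 0)"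
      by (rule resc [OF V_strip]) auto
    show "strand_chart flip (\<kappa> \<circ> polar) square (pt \<circ> kink_angle \<circ> (\<lambda>s. exp (s / 100))) span (Complex 0)"
      by (rule resc [OF flip_strip]) auto
    show "(\<kappa> \<circ> polar) w \<in> disk \<longleftrightarrow> Im w \<le> 0" if "w \<in> square" for w
    proof -
      have "polar w \<in> window" using polar_in_strip [OF that] strip_in_window by blast
      then show ?thesis using in_disk(1) [of "polar w"] by (simp add: norm_polar)
    qed
    show "strict_mono_on {0..<8} (\<lambda>s. angle0 + 3 * pi / 2 + s / 100)" by (rule strict_mono_onI) simp
    show "angle0 + 3 * pi / 2 + 0 / 100 = end_angle (2 * 2 - 1)" by (simp add: end_angle_def)
    fix s :: real assume s: "s \<in> {0..<8}"
    then have "s / 100 < 2/25" by simp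
    then show "angle0 + 3 * pi / 2 + s / 100 < 2 * pi" using angle0(2) by linarith
    have "Complex 0 (- 1) = cis (end_angle 3) * base_point"
    proof -
      have "cis (end_angle 3) = cis angle0 * cis (3 * pi / 2)" by (simp add: end_angle_def cis_mult)
      then show ?thesis unfolding cis_three_halves_pi by (simp add: angle0 base_point_def complex_eq_iff)
    qed
    moreover have "cis (angle0 + 3 * pi / 2 + s / 100) = cis (end_angle 3) * cis (s / 100)"
      by (simp add: end_angle_def cis_mult)
    ultimately have "cis (angle0 + 3 * pi / 2 + s / 100) * base_point = Complex 0 (- 1) * cis (s / 100)"
      by (simp add: ac_simps)
    also have "\<dots> = polar (complex_of_real s)" by (simp add: polar_horizontal complex_eq_iff)
    finally show "(\<kappa> \<circ> polar) (complex_of_real s) = disk_param (cis (angle0 + 3 * pi / 2 + s / 100))"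
      by (simp add: disk_param_def)
  qed
qed

end

section \<open>Crossing virtualization\<close>

text \<open>The lower part of the window, which only the first strand of \<open>flip\<close> enters.\<close>

definition curl_region :: "complex set" where
  "curl_region = {w. (\<bar>Re w\<bar> < 2 \<and> -3 < Im w) \<and> Im w < -1/2}"

definition kink_box :: "complex set" where
  "kink_box = cbox (Complex (- 1) (- 5/2)) (Complex 1 (- 3/5))"

lemma kink_box: "compact kink_box" "convex kink_box" "interior kink_box \<noteq> {}" "kink_box \<subseteq> curl_region"
proof -
  have "Complex 0 (- 1) \<in> interior kink_box" by (simp add: kink_box_def interior_cbox in_box_complex_iff)
  then show "interior kink_box \<noteq> {}" by blast
  show "kink_box \<subseteq> curl_region" by (auto simp: kink_box_def curl_region_def in_cbox_complex_iff)
qed (auto simp: kink_box_def)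

lemma strand_in_kink_box:
  "u \<in> {-1/2<..<3} \<Longrightarrow> corner u \<in> kink_box \<longleftrightarrow> u \<in> {-1/4..5/2}"
  "u \<in> {-1/2<..<3} \<Longrightarrow> kink u \<in> kink_box \<longleftrightarrow> u \<in> {-1/4..5/2}"
  "u \<in> {-1/4..5/2} \<Longrightarrow> corner u \<in> frontier kink_box \<longleftrightarrow> u = -1/4 \<or> u = 5/2"
  "u \<in> {-1/4..5/2} \<Longrightarrow> kink u \<in> frontier kink_box \<longleftrightarrow> u = -1/4 \<or> u = 5/2"
  by (auto simp: kink_box_def frontier_cbox in_cbox_complex_iff in_box_complex_iff corner_def kink_def field_simps)

context crossing_flip
begin

lemma flip_curl_chart: "strand_chart flip \<kappa> curl_region (pt \<circ> kink_angle) dom_kink kink"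
proof (rule flip_strand_chart)
  show "open curl_region"
    unfolding curl_region_def by (intro open_Collect_conj open_Collect_less continuous_intros)
  show "curl_region \<subseteq> window" by (auto simp: curl_region_def window_def)
  show "kink u \<in> curl_region \<longleftrightarrow> u \<in> dom_kink" if "u \<in> dom_kink" for u
    using that by (auto simp: kink_def curl_region_def abs_if)
  show "cap u \<notin> curl_region" if "u \<in> dom_cap" for u
    using that by (auto simp: cap_def curl_region_def)
qed auto

text \<open>The diagram after the H(2)-move, without the curl; the crossing at x is cut off with it.\<close>

definition smoothed :: vdiagram where
  "smoothed = replace_strand flip \<kappa> (pt \<circ> kink_angle) dom_kink corner"

lemma flip_uncurl: "R1 smoothed flip \<or> VR1 smoothed flip"
proof -
  have ends: "corner u = kink u" if "u \<notin> {-1/8<..<9/4}" for u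
    using that by (auto simp: corner_def kink_def)
  have region: "corner ` dom_kink \<subseteq> curl_region" by (auto simp: corner_def curl_region_def abs_if field_simps)
  have *: "virtual_knot_diagram smoothed \<and> strand_chart smoothed \<kappa> curl_region (pt \<circ> kink_angle) dom_kink corner"
    unfolding smoothed_def
  proof (rule replace_strand_diagram [OF flip_knot flip_curl_chart, where l = "-1/8" and r = "9/4" and a = 1 and b = 1])
    show "(s, t) = (1, 1) \<or> (s, t) = (1, 1)" if "s \<noteq> t" "corner s = corner t" for s t
      using that inj_corner by (simp add: inj_eq)
  qed (use ends region continuous_corner in auto)
  show ?thesis
  proof (rule curl_move [OF conjunct1 [OF *] flip_knot conjunct2 [OF *] flip_curl_chart,
        where l = "-1/4" and r = "5/2" and R = kink_box and a = 0 and b = 2])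
    show "imm flip z = imm smoothed z" "z \<in> over flip \<longleftrightarrow> z \<in> over smoothed" if "z \<notin> (pt \<circ> kink_angle) ` dom_kink" for z
      unfolding smoothed_def using that by (simp_all only: replace_strand_simps Diff_iff simp_thms)
    show "kink s = corner s" if "s \<notin> {-1/4<..<5/2}" for s
      using ends [of s] that by auto
    show "inj_on corner dom_kink" using inj_corner inj_on_subset by blast
    show "(s, t) = (0, 2) \<or> (s, t) = (2, 0)" if "s \<noteq> t" "kink s = kink t" for s t
      using kink_crossing [of s t] kink_crossing [of t s] that by (metis linorder_neqE)
    show "kink 0 = kink 2" by (simp add: kink_def)
  qed (use kink_box strand_in_kink_box in auto)
qed

lemma realizable:
  assumes "n \<ge> 2"
  shows "(diagram_step n)\<^sup>*\<^sup>* V flip" "(diagram_step n)\<^sup>*\<^sup>* flip V"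
proof -
  have "2 + (n - 2) = n" using assms by simp
  then show "(diagram_step n)\<^sup>*\<^sup>* V flip" "(diagram_step n)\<^sup>*\<^sup>* flip V"
    using H_config_realizable [OF H_config_flip end_chart_flip, of "n - 2"] by simp_all
qed

end

theorem mainTheorem2:
  fixes n :: nat and V V' :: vdiagram
  assumes "n \<ge> 2"
    and "virtual_knot_diagram V"
    and "crossing_virtualization V V'"
  shows "(diagram_step n)\<^sup>*\<^sup>* V V'"
proof -
  have V: "virtual_link_diagram V" "ncomp V = 1" using assms(2) by (auto simp: virtual_knot_diagram_def)
  obtain x where x: "x \<in> over V" "planar_isotopic (V\<lparr>over := over V - {x}\<rparr>) V'"
    using assms(3) by (auto simp: crossing_virtualization_def)
  obtain y where y: "double_pair V x y" using x(1) V(1) by (auto simp: virtual_link_diagram_def)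
  have "transverse_at V x y" "imm V x = imm V y"
  proof -
    show "imm V x = imm V y" using y by (simp add: double_pair_def)
    have "generic V" using V(1) by (simp add: virtual_link_diagram_def)
    then show "transverse_at V x y" using y unfolding generic_def by blast
  qed
  then obtain \<kappa> \<alpha> \<beta> where chart: "crossing_chart V x y \<kappa> \<alpha> \<beta>"
    using crossing_chart_exists [OF V(2)] by blast
  define W where "W = V\<lparr>over := over V - {x}\<rparr>"
  have W: "imm W = imm V" "circles W = circles V" "over W = over V - {x}" "ncomp W = ncomp V"
    by (simp_all add: W_def circles_def)
  have dp: "double_pair W = double_pair V" by (intro ext) (simp add: double_pair_def W)
  have tr: "transverse_at W = transverse_at V" by (intro ext) (simp add: transverse_at_def W)
  have "virtual_knot_diagram W"
  proof -
    have "immersed W" "generic W"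
      using V(1) unfolding virtual_link_diagram_def immersed_def generic_def dp tr W by simp_all
    moreover have "over W \<subseteq> {z. \<exists>w. double_pair W z w}"
      using V(1) unfolding virtual_link_diagram_def dp W by auto
    moreover have "\<not> (z \<in> over W \<and> w \<in> over W)" if "double_pair W z w" for z w
      using V(1) that unfolding virtual_link_diagram_def dp W by blast
    ultimately show ?thesis using V(2) W(4) unfolding virtual_knot_diagram_def virtual_link_diagram_def by simp
  qed
  moreover have "crossing_chart W x y \<kappa> \<alpha> \<beta>" using chart by (simp add: crossing_chart_def W)
  ultimately interpret W: crossing_flip W x y \<kappa> \<alpha> \<beta> by unfold_locales
  interpret V: crossing_flip V x y \<kappa> \<alpha> \<beta> by unfold_locales (rule assms(2), rule chart)
  \<comment> \<open>Only x is over in V and not in W, and x lies on the strand which loses its crossing.\<close>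
  have "W.smoothed = V.smoothed"
  proof -
    have "W.flip_path = V.flip_path" by (intro ext) (simp add: W.flip_path_def V.flip_path_def W)
    then have im: "W.imm_flip = V.imm_flip" by (intro ext) (simp add: W.imm_flip_def V.imm_flip_def)
    have inner: "W.inner = V.inner" by (simp add: W.inner_def V.inner_def W)
    have "z \<in> (pt \<circ> V.kink_angle) ` {-1/2<..<3}" if "z \<in> circles V" "V.rev_arc z = x" for z
    proof -
      have "V.ang x = \<alpha> 0" unfolding V.chart_facts(9) by (rule V.ang_\<alpha>) simp
      then have "V.rev_arc x = x" using V.\<alpha>_less [of 0 1] by (simp add: V.rev_arc_def)
      then have "z = pt (V.kink_angle 0)" using V.rev_arc_rev_arc [OF that(1)] that(2) V.chart_facts(9) by (simp add: V.kink_angle_def)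
      then show ?thesis by (intro image_eqI [of _ _ 0]) auto
    qed
    then have "over W.flip - (pt \<circ> V.kink_angle) ` {-1/2<..<3} = over V.flip - (pt \<circ> V.kink_angle) ` {-1/2<..<3}"
      unfolding W.over_flip V.over_flip W inner by blast
    then show ?thesis
      unfolding W.smoothed_def V.smoothed_def replace_strand_def W.flip_simps V.flip_simps im
      by (intro vdiagram.equality) (simp_all add: W.flip_simps V.flip_simps)
  qed
  with V.flip_uncurl W.flip_uncurl have
    "diagram_step n V.flip V.smoothed" "diagram_step n V.smoothed W.flip"
    by (simp_all add: curl_steps)
  then have "(diagram_step n)\<^sup>*\<^sup>* V.flip W.flip" by (meson converse_rtranclp_into_rtranclp r_into_rtranclp)
  then have "(diagram_step n)\<^sup>*\<^sup>* V W"
    using V.realizable(1) [OF assms(1)] W.realizable(2) [OF assms(1)] by (meson rtranclp_trans)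
  moreover have "diagram_step n W V'" using x(2) by (simp add: diagram_step_def W_def)
  ultimately show ?thesis by (rule rtranclp.rtrancl_into_rtrancl)
qed

end
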